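(* For the Jacobi preconditioner $B_1$ on $V_h^1=V_h^\Gamma$ there are strictly positive constants $\gamma_1,\rho_1$, independent of $h$ and of how the domain $\Omega_h$ is intersected by $\Gamma$, such that $$\gamma_1(B_1u,u)_{\Omega_h}\le(A_1u,u)_{\Omega_h}\le\rho_1(B_1u,u)_{\Omega_h}\quad\text{for all }u\in V_h^1 .$$
   Context: Geometry and mesh. Let $d\in\{2,3\}$, $\Omega\subset\mathbb{R}^d$ an open connected Lipschitz domain, $\Gamma=\partial\Omega$ with outward unit normal $n_\Gamma$. Let $\Omega^\ast\supset\Omega$ be a polygonal (polyhedral) domain with a family $\{\mathcal{T}_h^\ast\}_{h>0}$ of shape regular (not necessarily quasi-uniform) simplicial triangulations; $h_T$, $h_F$ denote the diameters of a simplex $T$, a face $F$. Define $\mathcal{T}_h=\{T\in\mathcal{T}_h^\ast : \mathrm{meas}_{d-1}(T\cap\Omega)>0\}$, $\Omega_h=\bigcup_{T\in\mathcal{T}_h}T$, $\mathcal{T}_h^\Gamma=\{T\in\mathcal{T}_h: T\cap\Gamma\ne\emptyset\}$. Standing assumption ($\Gamma$ sufficiently resolved, $h$ sufficiently small): $\mathcal{T}_h^\Gamma=\{T\in\mathcal{T}_h: T\cap\partial\Omega_h\neq\emptyset\}$. Finite element spaces. For fixed $k\ge1$, $V_h=\{v_h\in C(\Omega_h): v_h|_T\in\mathcal{P}_k\ \forall T\in\mathcal{T}_h\}$ with nodal (Lagrange) basis $\phi_i$ and nodes $\xi_i$, $1\le i\le N$, ordered so that $\xi_i\in\partial\Omega_h$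 iff $i>N_0$. Set $\mathcal{I}=\{i: N_0+1\le i\le N\}$ and $V_h^1=V_h^\Gamma=\mathrm{span}\{\phi_i: i\in\mathcal{I}\}$. Bilinear forms. $(\cdot,\cdot)_\omega$ is the $L^2(\omega)$ scalar product; $(h^{-1}u,v)_\Gamma:=\sum_{T\in\mathcal{T}_h^\Gamma}h_T^{-1}(u,v)_{T\cap\Gamma}$. With fixed $\gamma,\beta>0$, $\mathcal{F}_g$ the set of faces $F$ of simplices $T\in\mathcal{T}_h^\Gamma$ with $F\not\subset\partial\Omega_h$, $[\![\cdot]\!]$ the jump across $F$, $\partial_n$ the derivative normal to $F$, $$a_h(u,v)=(\nabla u,\nabla v)_\Omega-(n_\Gamma\cdot\nabla u,v)_\Gamma-(u,n_\Gamma\cdot\nabla v)_\Gamma+\gamma(h^{-1}u,v)_\Gamma+\beta\sum_{\ell=1}^k\sum_{F\in\mathcal{F}_g}h_F^{2\ell-1}([\![\partial_n^\ell u]\!],[\![\partial_n^\ell v]\!])_F .$$ Standing assumption: $\gamma$ is sufficiently large; then, by a known result from the literature taken as background, $a_h(v_h,v_h)$ is equivalent, for all $v_h\in V_h$, to $\|v_h\|_b^2:=\|\nabla v_h\|_{\Omega_h}^2+\gamma(h^{-1}v_h,v_h)_\Gamma$, with constants independent of $h$ and of how $\Gamma$ cuts the triangulation. Operators. $A_1:V_h^1\to V_h^1$ is defined by $(A_1u,v)_{\Omega_h}=a_h(u,v)$ for all $u,v\in V_h^1$. The Jacobi preconditioner $B_1:V_h^1\to V_h^1$ is defined by $$(B_1u,v)_{\Omega_h}=\sum_{i\in\mathcal{I}}\mu_i\zeta_i\,a_h(\phi_i,\phi_i)\quad\text{for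 } u=\sum_{i\in\mathcal{I}}\mu_i\phi_i,\ v=\sum_{i\in\mathcal{I}}\zeta_i\phi_i .$$ Constants "independent of $h$ and of how $\Omega_h$ is intersected by $\Gamma$" may depend only on fixed data such as $d,k,\gamma,\beta$, $\Omega$ and the shape regularity of the family. *)

theory Defs
  imports "HOL-Analysis.Analysis"
begin

section \<open>Surface measure\<close>

text \<open>The \<open>n\<close>-dimensional Hausdorff measure, for \<open>n \<ge> 1\<close>, normalised to agree with
  Lebesgue measure on \<open>n\<close>-dimensional planes. It is completed, as \<^const>\<open>lebesgue\<close> is,
  because normals and gradient traces on a Lipschitz boundary exist only almost everywhere.\<close>

definition hausdorff_pre :: "nat \<Rightarrow> real \<Rightarrow> 'a::euclidean_space set \<Rightarrow> ennreal" where
  "hausdorff_pre n \<delta> S =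
     (INF C \<in> {C :: nat \<Rightarrow> 'a set. S \<subseteq> (\<Union>i. C i) \<and> (\<forall>i. bounded (C i) \<and> diameter (C i) \<le> \<delta>)}.
        \<Sum>i. ennreal (unit_ball_vol (real n) * (diameter (C i) / 2) ^ n))"

definition hausdorff_outer :: "nat \<Rightarrow> 'a::euclidean_space set \<Rightarrow> ennreal" where
  "hausdorff_outer n S = (SUP \<delta> \<in> {0<..}. hausdorff_pre n \<delta> S)"

definition hausdorff_measure :: "nat \<Rightarrow> 'a::euclidean_space measure" where
  "hausdorff_measure n = completion (measure_of UNIV (sets borel) (hausdorff_outer n))"

abbreviation surface_measure :: "'a::euclidean_space measure" where
  "surface_measure \<equiv> hausdorff_measure (DIM('a) - 1)"


section \<open>Domains\<close>

definition lipschitz_domain :: "'a::euclidean_space set \<Rightarrow> bool" where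
  "lipschitz_domain \<Omega> \<longleftrightarrow> open \<Omega> \<and> connected \<Omega> \<and> \<Omega> \<noteq> {} \<and>
     (\<forall>x \<in> frontier \<Omega>. \<exists>r > 0. \<exists>\<nu> L g. norm \<nu> = 1 \<and> L-lipschitz_on {z. z \<bullet> \<nu> = 0} g \<and>
        \<Omega> \<inter> ball x r = {y \<in> ball x r. g (y - (y \<bullet> \<nu>) *\<^sub>R \<nu>) < y \<bullet> \<nu>})"

definition polyhedral_domain :: "'a::euclidean_space set \<Rightarrow> bool" where
  "polyhedral_domain \<Omega> \<longleftrightarrow> open \<Omega> \<and> connected \<Omega> \<and> bounded \<Omega> \<and>
     (\<exists>\<P>. finite \<P> \<and> (\<forall>P \<in> \<P>. polytope P) \<and> frontier \<Omega> = \<Union>\<P>)"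

text \<open>\<open>n\<close> is the outward unit normal at \<open>x\<close> if, to first order at \<open>x\<close>, the set \<open>\<Omega>\<close> is the
  half-space \<open>{y. (y - x) \<bullet> n < 0}\<close>. For a Lipschitz domain this determines \<open>n\<close> at each
  boundary point where the local graph function is differentiable, hence almost everywhere.\<close>

definition is_outward_normal :: "'a::euclidean_space set \<Rightarrow> 'a \<Rightarrow> 'a \<Rightarrow> bool" where
  "is_outward_normal \<Omega> x n \<longleftrightarrow> norm n = 1 \<and>
     (\<forall>\<epsilon> > 0. \<exists>\<delta> > 0. \<forall>y \<in> ball x \<delta>.
        (y \<in> \<Omega> \<longrightarrow> (y - x) \<bullet> n \<le> \<epsilon> * norm (y - x)) \<and>
        (y \<notin> \<Omega> \<longrightarrow> (y - x) \<bullet> n \<ge> - \<epsilon> * norm (y - x)))"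

definition outward_normal :: "'a::euclidean_space set \<Rightarrow> 'a \<Rightarrow> 'a" where
  "outward_normal \<Omega> x =
     (if \<exists>n. is_outward_normal \<Omega> x n then (THE n. is_outward_normal \<Omega> x n) else 0)"


section \<open>Meshes\<close>

definition inradius :: "'a::euclidean_space set \<Rightarrow> real" where
  "inradius T = Sup {r. \<exists>x. cball x r \<subseteq> T}"

definition shape_regular :: "real \<Rightarrow> 'a::euclidean_space set set \<Rightarrow> bool" where
  "shape_regular \<sigma> \<T> \<longleftrightarrow> (\<forall>T \<in> \<T>. diameter T \<le> \<sigma> * inradius T)"

text \<open>\<^const>\<open>triangulation\<close> provides finiteness and conformity; it allows simplices of any dimension.\<close>

definition simplicial_mesh_of :: "'a::euclidean_space set \<Rightarrow> 'a set set \<Rightarrow> bool" where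
  "simplicial_mesh_of D \<T> \<longleftrightarrow> triangulation \<T> \<and> (\<forall>T \<in> \<T>. int DIM('a) simplex T) \<and>
     \<Union>\<T> = closure D"

definition active_mesh :: "'a::euclidean_space set \<Rightarrow> 'a set set \<Rightarrow> 'a set set" where
  "active_mesh \<Omega> \<T> = {T \<in> \<T>. emeasure surface_measure (T \<inter> \<Omega>) > 0}"

abbreviation active_domain :: "'a::euclidean_space set \<Rightarrow> 'a set set \<Rightarrow> 'a set" where
  "active_domain \<Omega> \<T> \<equiv> \<Union>(active_mesh \<Omega> \<T>)"

definition cut_elements :: "'a::euclidean_space set \<Rightarrow> 'a set set \<Rightarrow> 'a set set" where
  "cut_elements \<Omega> \<T> = {T \<in> active_mesh \<Omega> \<T>. T \<inter> frontier \<Omega> \<noteq> {}}"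

definition boundary_resolved :: "'a::euclidean_space set \<Rightarrow> 'a set set \<Rightarrow> bool" where
  "boundary_resolved \<Omega> \<T> \<longleftrightarrow>
     cut_elements \<Omega> \<T> = {T \<in> active_mesh \<Omega> \<T>. T \<inter> frontier (active_domain \<Omega> \<T>) \<noteq> {}}"

definition ghost_faces :: "'a::euclidean_space set \<Rightarrow> 'a set set \<Rightarrow> 'a set set" where
  "ghost_faces \<Omega> \<T> =
     {F. (\<exists>T \<in> cut_elements \<Omega> \<T>. F facet_of T) \<and> \<not> F \<subseteq> frontier (active_domain \<Omega> \<T>)}"


section \<open>Finite element spaces\<close>

definition poly_space :: "nat \<Rightarrow> ('a::euclidean_space \<Rightarrow> real) set" where
  "poly_space k = {p. \<exists>c. \<forall>x. p x =
     (\<Sum>\<alpha> \<in> {\<alpha> \<in> Basis \<rightarrow>\<^sub>E {..k}. (\<Sum>b\<in>Basis. \<alpha> b) \<le> k}. c \<alpha> * (\<Prod>b\<in>Basis. (x \<bullet> b) ^ \<alpha> b))}"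

text \<open>Functions on \<open>\<Omega>\<^sub>h\<close> are encoded as functions on the whole space that vanish outside \<open>\<Omega>\<^sub>h\<close>.\<close>

definition fe_space :: "nat \<Rightarrow> 'a::euclidean_space set \<Rightarrow> 'a set set \<Rightarrow> ('a \<Rightarrow> real) set" where
  "fe_space k \<Omega> \<T> = {v. continuous_on (active_domain \<Omega> \<T>) v \<and>
     (\<forall>T \<in> active_mesh \<Omega> \<T>. \<exists>p \<in> poly_space k. \<forall>x \<in> T. v x = p x) \<and>
     (\<forall>x. x \<notin> active_domain \<Omega> \<T> \<longrightarrow> v x = 0)}"

definition lagrange_nodes :: "nat \<Rightarrow> 'a::euclidean_space set \<Rightarrow> 'a set" where
  "lagrange_nodes k T =
     {(\<Sum>v | v extreme_point_of T. (real (a v) / real k) *\<^sub>R v) | a :: 'a \<Rightarrow> nat.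
        (\<Sum>v | v extreme_point_of T. a v) = k}"

definition fe_nodes :: "nat \<Rightarrow> 'a::euclidean_space set \<Rightarrow> 'a set set \<Rightarrow> 'a set" where
  "fe_nodes k \<Omega> \<T> = (\<Union>T \<in> active_mesh \<Omega> \<T>. lagrange_nodes k T)"

text \<open>The nodal basis functions are indexed by the nodes themselves; the index set \<open>\<I>\<close> thus
  becomes the set of nodes on \<open>\<partial>\<Omega>\<^sub>h\<close>.\<close>

definition nodal_basis ::
    "nat \<Rightarrow> 'a::euclidean_space set \<Rightarrow> 'a set set \<Rightarrow> ('a \<Rightarrow> 'a \<Rightarrow> real) \<Rightarrow> bool" where
  "nodal_basis k \<Omega> \<T> \<phi> \<longleftrightarrow>
     (\<forall>\<xi> \<in> fe_nodes k \<Omega> \<T>. \<phi> \<xi> \<in> fe_space k \<Omega> \<T> \<and>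
        (\<forall>\<eta> \<in> fe_nodes k \<Omega> \<T>. \<phi> \<xi> \<eta> = (if \<eta> = \<xi> then 1 else 0)))"

definition boundary_nodes :: "nat \<Rightarrow> 'a::euclidean_space set \<Rightarrow> 'a set set \<Rightarrow> 'a set" where
  "boundary_nodes k \<Omega> \<T> = fe_nodes k \<Omega> \<T> \<inter> frontier (active_domain \<Omega> \<T>)"

definition boundary_comb :: "nat \<Rightarrow> 'a::euclidean_space set \<Rightarrow> 'a set set \<Rightarrow>
    ('a \<Rightarrow> 'a \<Rightarrow> real) \<Rightarrow> ('a \<Rightarrow> real) \<Rightarrow> 'a \<Rightarrow> real" where
  "boundary_comb k \<Omega> \<T> \<phi> \<mu> = (\<lambda>x. \<Sum>\<xi> \<in> boundary_nodes k \<Omega> \<T>. \<mu> \<xi> * \<phi> \<xi> x)"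

definition boundary_space :: "nat \<Rightarrow> 'a::euclidean_space set \<Rightarrow> 'a set set \<Rightarrow>
    ('a \<Rightarrow> 'a \<Rightarrow> real) \<Rightarrow> ('a \<Rightarrow> real) set" where
  "boundary_space k \<Omega> \<T> \<phi> = range (boundary_comb k \<Omega> \<T> \<phi>)"


section \<open>Bilinear forms\<close>

text \<open>\<open>grad S u x\<close> is the gradient at \<open>x\<close> of the restriction of \<open>u\<close> to \<open>S\<close>. With \<open>S = \<Omega>\<close> it is
  the usual gradient almost everywhere in \<open>\<Omega>\<close>, and almost everywhere on \<open>\<partial>\<Omega>\<close> it is the trace
  taken from inside \<open>\<Omega>\<close>, also where \<open>\<partial>\<Omega>\<close> runs along a face of the mesh.\<close>

definition grad :: "'a::euclidean_space set \<Rightarrow> ('a \<Rightarrow> real) \<Rightarrow> 'a \<Rightarrow> 'a" where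
  "grad S u x = (\<Sum>b\<in>Basis. frechet_derivative u (at x within S) b *\<^sub>R b)"

definition normal_deriv :: "'a::euclidean_space set \<Rightarrow> ('a \<Rightarrow> real) \<Rightarrow> 'a \<Rightarrow> real" where
  "normal_deriv \<Omega> u x = outward_normal \<Omega> x \<bullet> grad \<Omega> u x"

definition l2 :: "'a measure \<Rightarrow> 'a set \<Rightarrow> ('a \<Rightarrow> real) \<Rightarrow> ('a \<Rightarrow> real) \<Rightarrow> real" where
  "l2 M S u v = (LINT x:S|M. u x * v x)"

definition dirichlet_form ::
    "'a::euclidean_space set \<Rightarrow> ('a \<Rightarrow> real) \<Rightarrow> ('a \<Rightarrow> real) \<Rightarrow> real" where
  "dirichlet_form S u v = (LINT x:S|lebesgue. grad S u x \<bullet> grad S v x)"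

definition scaled_boundary_form ::
    "'a::euclidean_space set \<Rightarrow> 'a set set \<Rightarrow> ('a \<Rightarrow> real) \<Rightarrow> ('a \<Rightarrow> real) \<Rightarrow> real" where
  "scaled_boundary_form \<Omega> \<T> u v =
     (\<Sum>T \<in> cut_elements \<Omega> \<T>. l2 surface_measure (T \<inter> frontier \<Omega>) u v / diameter T)"

definition local_poly :: "nat \<Rightarrow> ('a::euclidean_space \<Rightarrow> real) \<Rightarrow> 'a set \<Rightarrow> 'a \<Rightarrow> real" where
  "local_poly k u T = (THE p. p \<in> poly_space k \<and> (\<forall>x \<in> T. p x = u x))"

definition face_normal :: "'a::euclidean_space set \<Rightarrow> 'a" where
  "face_normal F = (SOME n. norm n = 1 \<and> (\<forall>x \<in> F. \<forall>y \<in> F. (x - y) \<bullet> n = 0))"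

definition face_sides :: "'a::euclidean_space set \<Rightarrow> 'a set set \<Rightarrow> 'a set \<Rightarrow> 'a set \<times> 'a set" where
  "face_sides \<Omega> \<T> F = (SOME (T1, T2). T1 \<in> active_mesh \<Omega> \<T> \<and> T2 \<in> active_mesh \<Omega> \<T> \<and>
     T1 \<noteq> T2 \<and> F facet_of T1 \<and> F facet_of T2)"

definition directional_deriv ::
    "nat \<Rightarrow> 'a::euclidean_space \<Rightarrow> ('a \<Rightarrow> real) \<Rightarrow> 'a \<Rightarrow> real" where
  "directional_deriv l n p x = (deriv ^^ l) (\<lambda>t. p (x + t *\<^sub>R n)) 0"

text \<open>The choices made by \<^const>\<open>face_normal\<close> and \<^const>\<open>face_sides\<close> affect only the sign of the jump,
  by a factor that does not depend on \<open>u\<close>; it cancels in \<open>ghost_penalty\<close>.\<close>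

definition deriv_jump :: "nat \<Rightarrow> 'a::euclidean_space set \<Rightarrow> 'a set set \<Rightarrow> nat \<Rightarrow> 'a set \<Rightarrow>
    ('a \<Rightarrow> real) \<Rightarrow> 'a \<Rightarrow> real" where
  "deriv_jump k \<Omega> \<T> l F u x = (case face_sides \<Omega> \<T> F of (T1, T2) \<Rightarrow>
     directional_deriv l (face_normal F) (local_poly k u T1) x -
     directional_deriv l (face_normal F) (local_poly k u T2) x)"

definition ghost_penalty :: "nat \<Rightarrow> 'a::euclidean_space set \<Rightarrow> 'a set set \<Rightarrow>
    ('a \<Rightarrow> real) \<Rightarrow> ('a \<Rightarrow> real) \<Rightarrow> real" where
  "ghost_penalty k \<Omega> \<T> u v = (\<Sum>l = 1..k. \<Sum>F \<in> ghost_faces \<Omega> \<T>. diameter F ^ (2 * l - 1) *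
     l2 surface_measure F (deriv_jump k \<Omega> \<T> l F u) (deriv_jump k \<Omega> \<T> l F v))"

definition cut_form :: "nat \<Rightarrow> real \<Rightarrow> real \<Rightarrow> 'a::euclidean_space set \<Rightarrow> 'a set set \<Rightarrow>
    ('a \<Rightarrow> real) \<Rightarrow> ('a \<Rightarrow> real) \<Rightarrow> real" where
  "cut_form k \<gamma> \<beta> \<Omega> \<T> u v =
     dirichlet_form \<Omega> u v
     - l2 surface_measure (frontier \<Omega>) (normal_deriv \<Omega> u) v
     - l2 surface_measure (frontier \<Omega>) u (normal_deriv \<Omega> v)
     + \<gamma> * scaled_boundary_form \<Omega> \<T> u v
     + \<beta> * ghost_penalty k \<Omega> \<T> u v"

definition norm_b_sq ::
    "real \<Rightarrow> 'a::euclidean_space set \<Rightarrow> 'a set set \<Rightarrow> ('a \<Rightarrow> real) \<Rightarrow> real" where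
  "norm_b_sq \<gamma> \<Omega> \<T> v =
     dirichlet_form (active_domain \<Omega> \<T>) v v + \<gamma> * scaled_boundary_form \<Omega> \<T> v v"

text \<open>The norm equivalence that holds for all sufficiently large \<open>\<gamma>\<close>, with explicit constants.\<close>

definition norm_equivalence :: "real \<Rightarrow> real \<Rightarrow> nat \<Rightarrow> real \<Rightarrow> real \<Rightarrow>
    'a::euclidean_space set \<Rightarrow> 'a set set \<Rightarrow> bool" where
  "norm_equivalence c C k \<gamma> \<beta> \<Omega> \<T> \<longleftrightarrow> (\<forall>v \<in> fe_space k \<Omega> \<T>.
     c * norm_b_sq \<gamma> \<Omega> \<T> v \<le> cut_form k \<gamma> \<beta> \<Omega> \<T> v v \<and>
     cut_form k \<gamma> \<beta> \<Omega> \<T> v v \<le> C * norm_b_sq \<gamma> \<Omega> \<T> v)"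


section \<open>Operators\<close>

abbreviation l2_active :: "'a::euclidean_space set \<Rightarrow> 'a set set \<Rightarrow>
    ('a \<Rightarrow> real) \<Rightarrow> ('a \<Rightarrow> real) \<Rightarrow> real" where
  "l2_active \<Omega> \<T> \<equiv> l2 lebesgue (active_domain \<Omega> \<T>)"

definition is_boundary_operator :: "nat \<Rightarrow> real \<Rightarrow> real \<Rightarrow> 'a::euclidean_space set \<Rightarrow> 'a set set \<Rightarrow>
    ('a \<Rightarrow> 'a \<Rightarrow> real) \<Rightarrow> (('a \<Rightarrow> real) \<Rightarrow> ('a \<Rightarrow> real)) \<Rightarrow> bool" where
  "is_boundary_operator k \<gamma> \<beta> \<Omega> \<T> \<phi> A \<longleftrightarrow>
     A \<in> boundary_space k \<Omega> \<T> \<phi> \<rightarrow> boundary_space k \<Omega> \<T> \<phi> \<and>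
     (\<forall>u \<in> boundary_space k \<Omega> \<T> \<phi>. \<forall>v \<in> boundary_space k \<Omega> \<T> \<phi>.
        l2_active \<Omega> \<T> (A u) v = cut_form k \<gamma> \<beta> \<Omega> \<T> u v)"

definition is_jacobi_preconditioner ::
    "nat \<Rightarrow> real \<Rightarrow> real \<Rightarrow> 'a::euclidean_space set \<Rightarrow> 'a set set \<Rightarrow>
     ('a \<Rightarrow> 'a \<Rightarrow> real) \<Rightarrow> (('a \<Rightarrow> real) \<Rightarrow> ('a \<Rightarrow> real)) \<Rightarrow> bool" where
  "is_jacobi_preconditioner k \<gamma> \<beta> \<Omega> \<T> \<phi> B \<longleftrightarrow>
     B \<in> boundary_space k \<Omega> \<T> \<phi> \<rightarrow> boundary_space k \<Omega> \<T> \<phi> \<and>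
     (\<forall>\<mu> \<zeta>. l2_active \<Omega> \<T> (B (boundary_comb k \<Omega> \<T> \<phi> \<mu>)) (boundary_comb k \<Omega> \<T> \<phi> \<zeta>) =
        (\<Sum>\<xi> \<in> boundary_nodes k \<Omega> \<T>. \<mu> \<xi> * \<zeta> \<xi> * cut_form k \<gamma> \<beta> \<Omega> \<T> (\<phi> \<xi>) (\<phi> \<xi>)))"

end

theory Submission
  imports Defs
begin

text \<open>By the norm equivalence the claim reduces to the stability
  \<open>\<Sum> \<mu>\<^sub>i\<^sup>2 \<parallel>\<phi>\<^sub>i\<parallel>\<^sub>b\<^sup>2 \<simeq> \<parallel>\<Sum> \<mu>\<^sub>i \<phi>\<^sub>i\<parallel>\<^sub>b\<^sup>2\<close> of the boundary basis. One inequality is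
  Cauchy-Schwarz on each element, where only boundedly many basis functions live. For the other,
  \<open>\<parallel>\<phi>\<^sub>i\<parallel>\<^sub>b\<^sup>2\<close> is at most a constant times \<open>h\<^sup>d\<^sup>-\<^sup>2\<close> on an element \<open>T\<close> of diameter \<open>h\<close>, so
  \<open>h\<^sup>d\<^sup>-\<^sup>2 max\<^sub>T u\<^sup>2\<close> has to be bounded by the norm of \<open>u\<close> near \<open>T\<close>. By a Poincare inequality for
  polynomials it suffices to control \<open>u\<close> at one vertex of \<open>T\<close>. If a vertex of \<open>T\<close> lies in the domain,
  \<open>u\<close> vanishes there. Otherwise \<open>T\<close> shares a vertex with an element of comparable size in which the
  boundary has measure at least a constant times \<open>h\<^sup>d\<^sup>-\<^sup>1\<close>, and the boundary term of the norm
  controls \<open>u\<close> there; the part of the boundary in \<open>T\<close> itself may be arbitrarily small.\<close>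

section \<open>Polynomial spaces\<close>

text \<open>The gradient part of the norm runs over whole active elements, not over their
  intersections with the domain, so every polynomial estimate takes place on a complete simplex. It
  is transported by dilation and translation of balls, because a simplex of diameter h contains a
  ball of radius \<open>\<rho> * h\<close> and lies in one of radius h; affine maps onto a reference
  simplex occur only for the Lagrange nodes. The position of the cut enters through the surface
  measure alone. The two parts of the norm of a basis function scale alike, as
  \<open>h\<^sup>-\<^sup>2\<close> times a volume \<open>h\<^sup>d\<close> and as
  \<open>h\<^sup>-\<^sup>1\<close> times an area \<open>h\<^sup>d\<^sup>-\<^sup>1\<close>. As the
  mesh is not quasi-uniform, sizes are compared only within the star of a vertex. The bilinear form
  is never expanded: normal derivatives and ghost penalty are seen only through
  \<open>norm_equivalence\<close>. All constants are fixed before the mesh. They depend on shape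
  regularity through \<open>\<rho>\<close>, on the domain through its cones and charts, and on an
  upper bound \<open>D\<close> for all diameters, which takes the place of smallness of h.\<close>

text \<open>The only compactness argument needed: all inverse and norm equivalence estimates for polynomials are
  instances. Generators are split off one at a time, projecting the others \<open>Q\<close>-orthogonally.\<close>

lemma psd_form_bounds_functionals:
  fixes Q :: "('b \<Rightarrow> real) \<Rightarrow> ('b \<Rightarrow> real) \<Rightarrow> real" and f :: "'i \<Rightarrow> 'b \<Rightarrow> real"
  assumes "finite I" and "\<And>i. i \<in> I \<Longrightarrow> f i \<in> V"
    and V: "\<And>u v a b. u \<in> V \<Longrightarrow> v \<in> V \<Longrightarrow> (\<lambda>x. a * u x + b * v x) \<in> V" and V0: "(\<lambda>x. 0) \<in> V"
    and Ql: "\<And>u v w a b. u \<in> V \<Longrightarrow> v \<in> V \<Longrightarrow> w \<in> V \<Longrightarrow>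
      Q (\<lambda>x. a * u x + b * v x) w = a * Q u w + b * Q v w"
    and Qs: "\<And>u v. u \<in> V \<Longrightarrow> v \<in> V \<Longrightarrow> Q u v = Q v u"
    and Qp: "\<And>u. u \<in> V \<Longrightarrow> 0 \<le> Q u u"
    and l: "\<And>s u v a b. s \<in> S \<Longrightarrow> u \<in> V \<Longrightarrow> v \<in> V \<Longrightarrow>
      l s (\<lambda>x. a * u x + b * v x) = a * l s u + b * l s v"
    and lb: "\<And>u. u \<in> V \<Longrightarrow> \<exists>B. \<forall>s\<in>S. \<bar>l s u :: real\<bar> \<le> B"
    and null: "\<And>s u. s \<in> S \<Longrightarrow> u \<in> V \<Longrightarrow> Q u u = 0 \<Longrightarrow> l s u = 0"
  shows "\<exists>C\<ge>0. \<forall>c. \<forall>s\<in>S. (l s (\<lambda>x. \<Sum>i\<in>I. c i * f i x))\<^sup>2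
      \<le> C * Q (\<lambda>x. \<Sum>i\<in>I. c i * f i x) (\<lambda>x. \<Sum>i\<in>I. c i * f i x)"
  using assms(1,2)
proof (induction I arbitrary: f rule: finite_induct)
  case empty
  have "Q (\<lambda>x. 0 * (0::real) + 0 * 0) (\<lambda>x. 0) = 0"
    using Ql[OF V0 V0 V0, of 0 0] by simp
  then show ?case using null[OF _ V0] by auto
next
  case (insert j I)
  define q where "q = Q (f j) (f j)"
  have fj: "f j \<in> V" and fi: "\<And>i. i \<in> I \<Longrightarrow> f i \<in> V" using insert by auto
  have q0: "q \<ge> 0" using Qp[OF fj] by (simp add: q_def)
  have Qr: "Q w (\<lambda>x. a * u x + b * v x) = a * Q w u + b * Q w v"
    if "u \<in> V" "v \<in> V" "w \<in> V" for a b u v w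
    using Ql[OF that, of a b] Qs that V by metis
  have sq: "Q (\<lambda>x. a * u x + b * v x) (\<lambda>x. a * u x + b * v x) = a\<^sup>2 * Q u u + 2 * a * b * Q u v + b\<^sup>2 * Q v v"
    if uv: "u \<in> V" "v \<in> V" for a b u v
  proof -
    have "Q (\<lambda>x. a * u x + b * v x) (\<lambda>x. a * u x + b * v x)
      = a * Q u (\<lambda>x. a * u x + b * v x) + b * Q v (\<lambda>x. a * u x + b * v x)"
      by (rule Ql[OF uv V[OF uv]])
    then show ?thesis
      using Qr[OF uv uv(1)] Qr[OF uv uv(2)] Qs[OF uv] by (simp add: power2_eq_square algebra_simps)
  qed
  \<comment> \<open>\<open>p w\<close> is the coefficient of the \<open>Q\<close>-orthogonal
    projection of \<open>w\<close> onto \<open>f j\<close>. For \<open>q = 0\<close> no projection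
    is made, as positivity then already forces \<open>Q w (f j) = 0\<close>.\<close>
  define p where "p w = (if q = 0 then 0 else Q w (f j) / q)" for w
  have orth: "Q (\<lambda>x. 1 * w x + (- p w) * f j x) (f j) = 0" if w: "w \<in> V" for w
  proof (cases "q = 0")
    case True
    \<comment> \<open>Along \<open>w + t * f j\<close> the form is now affine in \<open>t\<close>;
      with a nonzero slope it would be -1 at the parameter inserted below.\<close>
    have "2 * t * Q w (f j) + Q w w \<ge> 0" for t
      using Qp[OF V[OF w fj, of 1 t]] sq[OF w fj, of 1 t] True by (simp add: q_def)
    from this[of "- (Q w w + 1) / (2 * Q w (f j))"] have "Q w (f j) = 0"
      by (cases "Q w (f j) = 0") (auto simp: field_simps)
    then show ?thesis using Ql[OF w fj fj, of 1 "- p w"] by (simp add: p_def True)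
  next
    case False
    then show ?thesis using Ql[OF w fj fj, of 1 "- p w"] by (simp add: p_def q_def)
  qed
  define g where "g i = (\<lambda>x. 1 * f i x + (- p (f i)) * f j x)" for i
  have gV: "g i \<in> V" if "i \<in> I" for i unfolding g_def by (rule V[OF fi[OF that] fj])
  have sumV: "(\<lambda>x. \<Sum>i\<in>J. c i * g i x) \<in> V \<and> Q (\<lambda>x. \<Sum>i\<in>J. c i * g i x) (f j) = 0"
    if "J \<subseteq> I" for c J
    using finite_subset[OF that insert(1)] that
  proof (induction J rule: finite_induct)
    case empty
    show ?case using V0 Ql[OF V0 V0 fj, of 0 0] by simp
  next
    case (insert i J)
    have e: "(\<lambda>x. \<Sum>i\<in>insert i J. c i * g i x) = (\<lambda>x. c i * g i x + 1 * (\<Sum>i\<in>J. c i * g i x))"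
      using insert by auto
    show ?case unfolding e using V[OF gV, of i _ "c i" 1] Ql[OF gV _ fj, of i _ "c i" 1] insert
        orth[OF fi, of i] g_def by auto
  qed
  obtain C where C: "C \<ge> 0" "\<And>c s. s \<in> S \<Longrightarrow> (l s (\<lambda>x. \<Sum>i\<in>I. c i * g i x))\<^sup>2
      \<le> C * Q (\<lambda>x. \<Sum>i\<in>I. c i * g i x) (\<lambda>x. \<Sum>i\<in>I. c i * g i x)"
    using insert(3)[of g] gV by auto
  obtain B where B: "\<And>s. s \<in> S \<Longrightarrow> \<bar>l s (f j)\<bar> \<le> B" using lb[OF fj] by auto
  \<comment> \<open>The price of the direction \<open>f j\<close>: \<open>B\<close> bounds the
    functionals there, \<open>q\<close> is its energy, and 2 comes from splitting a squared sum. If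
    \<open>q = 0\<close>, the functionals vanish on \<open>f j\<close>.\<close>
  define K where "K = (if q = 0 then 0 else 2 * B\<^sup>2 / q)"
  have K0: "K \<ge> 0" using q0 by (auto simp: K_def)
  show ?case
  proof (intro exI[of _ "2 * C + K"] conjI allI ballI)
    fix c s assume s: "s \<in> S"
    define v where "v = (\<lambda>x. \<Sum>i\<in>I. c i * g i x)"
    define a where "a = c j + (\<Sum>i\<in>I. c i * p (f i))"
    have v: "v \<in> V" "Q v (f j) = 0" using sumV[of I c] by (auto simp: v_def)
    have e: "(\<lambda>x. \<Sum>i\<in>insert j I. c i * f i x) = (\<lambda>x. 1 * v x + a * f j x)"
      using insert(1,2) by (auto simp: v_def a_def g_def algebra_simps sum.distrib sum_subtractf sum_distrib_left sum_distrib_right)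
    have Qe: "Q (\<lambda>x. 1 * v x + a * f j x) (\<lambda>x. 1 * v x + a * f j x) = Q v v + a\<^sup>2 * q"
      using sq[OF v(1) fj, of 1 a] v(2) by (simp add: q_def)
    have "(l s (\<lambda>x. 1 * v x + a * f j x))\<^sup>2 = (l s v + a * l s (f j))\<^sup>2"
      using l[OF s v(1) fj, of 1 a] by simp
    also have "\<dots> \<le> 2 * (l s v)\<^sup>2 + 2 * (a * l s (f j))\<^sup>2"
      using sum_squares_bound[of "l s v" "a * l s (f j)"] by (simp add: power2_sum)
    also have "\<dots> \<le> 2 * C * Q v v + K * (a\<^sup>2 * q)"
    proof -
      have "(l s v)\<^sup>2 \<le> C * Q v v" using C(2)[OF s] by (simp add: v_def)
      moreover have "2 * (a * l s (f j))\<^sup>2 \<le> K * (a\<^sup>2 * q)"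
      proof (cases "q = 0")
        case True then show ?thesis using null[OF s fj] by (simp add: q_def)
      next
        case False
        have "(l s (f j))\<^sup>2 \<le> B\<^sup>2" using B[OF s] by (metis abs_ge_zero power2_abs power_mono)
        then have "a\<^sup>2 * (l s (f j))\<^sup>2 \<le> a\<^sup>2 * B\<^sup>2" by (simp add: mult_left_mono)
        then show ?thesis using False by (simp add: K_def power_mult_distrib mult.commute)
      qed
      ultimately show ?thesis by simp
    qed
    also have "\<dots> \<le> (2 * C + K) * (Q v v + a\<^sup>2 * q)"
      using C(1) K0 q0 Qp[OF v(1)] by (simp add: algebra_simps)
    finally show "(l s (\<lambda>x. \<Sum>i\<in>insert j I. c i * f i x))\<^sup>2
      \<le> (2 * C + K) * Q (\<lambda>x. \<Sum>i\<in>insert j I. c i * f i x) (\<lambda>x. \<Sum>i\<in>insert j I. c i * f i x)"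
      unfolding e Qe .
  qed (use C K0 in auto)
qed

section \<open>Polynomial spaces: algebra, affine substitution, gradients and zeros\<close>

lemma finite_multi_indices:
  "finite {\<alpha> \<in> (Basis :: 'a::euclidean_space set) \<rightarrow>\<^sub>E {..k::nat}. (\<Sum>b\<in>Basis. \<alpha> b) \<le> k}"
  by (rule finite_subset[of _ "Basis \<rightarrow>\<^sub>E {..k}"]) (auto intro: finite_PiE)

lemma monomial_in_poly_space:
  fixes \<alpha> :: "'a::euclidean_space \<Rightarrow> nat"
  assumes "(\<Sum>b\<in>Basis. \<alpha> b) \<le> k"
  shows "(\<lambda>x. \<Prod>b\<in>Basis. (x \<bullet> b) ^ \<alpha> b) \<in> poly_space k"
proof -
  define \<beta> where "\<beta> = restrict \<alpha> Basis"
  let ?I = "{\<alpha> \<in> (Basis :: 'a set) \<rightarrow>\<^sub>E {..k}. (\<Sum>b\<in>Basis. \<alpha> b) \<le> k}"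
  have "\<alpha> b \<le> k" if "b \<in> Basis" for b
    using member_le_sum[OF that, of \<alpha>] assms by simp
  then have "\<beta> \<in> ?I" using assms by (auto simp: \<beta>_def)
  then have "(\<Sum>\<alpha>' \<in> ?I. (if \<alpha>' = \<beta> then 1 else 0) * (\<Prod>b\<in>Basis. (x \<bullet> b) ^ \<alpha>' b))
      = (\<Prod>b\<in>Basis. (x \<bullet> b) ^ \<alpha> b)" for x
    by (subst sum.mono_neutral_cong_right[OF finite_multi_indices, of "{\<beta>}"]) (auto simp: \<beta>_def)
  then show ?thesis unfolding poly_space_def
    by (auto intro!: exI[of _ "\<lambda>\<alpha>'. if \<alpha>' = \<beta> then 1 else 0"])
qed

lemma poly_space_lincomb:
  assumes "f \<in> poly_space k" "g \<in> poly_space k"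
  shows "(\<lambda>x. a * f x + b * g x) \<in> poly_space k"
proof -
  obtain c d where "\<And>x. f x = (\<Sum>\<alpha> \<in> {\<alpha> \<in> Basis \<rightarrow>\<^sub>E {..k}. (\<Sum>b\<in>Basis. \<alpha> b) \<le> k}. c \<alpha> * (\<Prod>b\<in>Basis. (x \<bullet> b) ^ \<alpha> b))"
    "\<And>x. g x = (\<Sum>\<alpha> \<in> {\<alpha> \<in> Basis \<rightarrow>\<^sub>E {..k}. (\<Sum>b\<in>Basis. \<alpha> b) \<le> k}. d \<alpha> * (\<Prod>b\<in>Basis. (x \<bullet> b) ^ \<alpha> b))"
    using assms unfolding poly_space_def by auto
  then show ?thesis unfolding poly_space_def
    by (auto intro!: exI[of _ "\<lambda>\<alpha>. a * c \<alpha> + b * d \<alpha>"] simp: algebra_simps sum.distrib sum_distrib_left)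
qed

lemma poly_space_0: "(\<lambda>x. 0) \<in> poly_space k"
  unfolding poly_space_def by (auto intro!: exI[of _ "\<lambda>_. 0"])

lemma poly_space_scale: "f \<in> poly_space k \<Longrightarrow> (\<lambda>x. a * f x) \<in> poly_space k"
  using poly_space_lincomb[of f k f a 0] by simp

lemma poly_space_add: "f \<in> poly_space k \<Longrightarrow> g \<in> poly_space k \<Longrightarrow> (\<lambda>x. f x + g x) \<in> poly_space k"
  using poly_space_lincomb[of f k g 1 1] by simp

lemma poly_space_sum: "(\<And>i. i \<in> I \<Longrightarrow> f i \<in> poly_space k) \<Longrightarrow> (\<lambda>x. \<Sum>i\<in>I. f i x) \<in> poly_space k"
  by (induction I rule: infinite_finite_induct) (auto intro: poly_space_0 poly_space_add)

lemma poly_space_mono: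
  assumes "f \<in> poly_space j" "j \<le> k" shows "f \<in> poly_space k"
proof -
  obtain c where c: "\<And>x. f x = (\<Sum>\<alpha> \<in> {\<alpha> \<in> Basis \<rightarrow>\<^sub>E {..j}. (\<Sum>b\<in>Basis. \<alpha> b) \<le> j}. c \<alpha> * (\<Prod>b\<in>Basis. (x \<bullet> b) ^ \<alpha> b))"
    using assms unfolding poly_space_def by auto
  then have "f = (\<lambda>x. \<Sum>\<alpha> \<in> {\<alpha> \<in> Basis \<rightarrow>\<^sub>E {..j}. (\<Sum>b\<in>Basis. \<alpha> b) \<le> j}. c \<alpha> * (\<Prod>b\<in>Basis. (x \<bullet> b) ^ \<alpha> b))"
    by auto
  also have "\<dots> \<in> poly_space k"
    using assms(2) by (intro poly_space_sum poly_space_scale monomial_in_poly_space) auto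
  finally show ?thesis .
qed

lemma poly_space_mult:
  assumes "f \<in> poly_space j" "g \<in> poly_space k" shows "(\<lambda>x. f x * g x) \<in> poly_space (j + k)"
proof -
  obtain c d where c: "\<And>x. f x = (\<Sum>\<alpha> \<in> {\<alpha> \<in> Basis \<rightarrow>\<^sub>E {..j}. (\<Sum>b\<in>Basis. \<alpha> b) \<le> j}. c \<alpha> * (\<Prod>b\<in>Basis. (x \<bullet> b) ^ \<alpha> b))"
    and d: "\<And>x. g x = (\<Sum>\<alpha> \<in> {\<alpha> \<in> Basis \<rightarrow>\<^sub>E {..k}. (\<Sum>b\<in>Basis. \<alpha> b) \<le> k}. d \<alpha> * (\<Prod>b\<in>Basis. (x \<bullet> b) ^ \<alpha> b))"
    using assms unfolding poly_space_def by auto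
  have "(\<lambda>x. f x * g x) = (\<lambda>x. \<Sum>\<alpha> \<in> {\<alpha> \<in> Basis \<rightarrow>\<^sub>E {..j}. (\<Sum>b\<in>Basis. \<alpha> b) \<le> j}.
      \<Sum>\<beta> \<in> {\<alpha> \<in> Basis \<rightarrow>\<^sub>E {..k}. (\<Sum>b\<in>Basis. \<alpha> b) \<le> k}. (c \<alpha> * d \<beta>) * (\<Prod>b\<in>Basis. (x \<bullet> b) ^ (\<alpha> b + \<beta> b)))"
    by (auto simp: c d sum_product power_add prod.distrib mult_ac)
  also have "\<dots> \<in> poly_space (j + k)"
    by (intro poly_space_sum poly_space_scale monomial_in_poly_space) (auto simp: sum.distrib intro: add_mono)
  finally show ?thesis .
qed

lemma poly_space_const: "(\<lambda>x. c) \<in> poly_space k"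
  using poly_space_scale[OF monomial_in_poly_space[of "\<lambda>_. 0" k], of c] by simp

lemma poly_space_coord:
  assumes b: "b \<in> Basis" and k: "1 \<le> k"
  shows "(\<lambda>x. x \<bullet> b) \<in> poly_space k"
proof -
  have "(\<Prod>c\<in>Basis. (x \<bullet> c) ^ (if c = b then 1 else 0)) = x \<bullet> b" for x
    using b by (subst prod.mono_neutral_cong_right[of _ "{b}"]) auto
  then show ?thesis
    using monomial_in_poly_space[of "\<lambda>c. if c = b then 1 else 0" k] b k by simp
qed

text \<open>Polynomials are generated from constants and coordinates by sums and products, with a
  degree bound carried along. Later proofs check these cases and avoid sums over multi-indices. The
  case \<open>mono\<close> lifts monomials of lower degree to the common bound
  \<open>k\<close>.\<close>

lemma poly_space_induct [consumes 1, case_names const coord add mult mono]: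
  fixes f :: "'a::euclidean_space \<Rightarrow> real"
  assumes f: "f \<in> poly_space k"
    and const: "\<And>c. Pr 0 (\<lambda>x. c)"
    and coord: "\<And>b. b \<in> Basis \<Longrightarrow> Pr 1 (\<lambda>x. x \<bullet> b)"
    and add: "\<And>k f g. Pr k f \<Longrightarrow> Pr k g \<Longrightarrow> Pr k (\<lambda>x. f x + g x)"
    and mult: "\<And>j k f g. Pr j f \<Longrightarrow> Pr k g \<Longrightarrow> Pr (j + k) (\<lambda>x. f x * g x)"
    and mono: "\<And>j k f. Pr j f \<Longrightarrow> j \<le> k \<Longrightarrow> Pr k f"
  shows "Pr k f"
proof -
  have pow: "Pr m (\<lambda>x. (x \<bullet> b) ^ m)" if "b \<in> Basis" for m b
  proof (induction m)
    case 0 show ?case using const[of 1] by simp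
  next
    case (Suc m)
    then show ?case using mult[OF coord[OF that] Suc] by simp
  qed
  have prd: "Pr (\<Sum>b\<in>B. \<alpha> b) (\<lambda>x. \<Prod>b\<in>B. (x \<bullet> b) ^ \<alpha> b)" if "finite B" "B \<subseteq> Basis" for B \<alpha>
    using that
  proof (induction B rule: finite_induct)
    case empty show ?case using const[of 1] by simp
  next
    case (insert b B)
    then show ?case using mult[OF pow[of b "\<alpha> b"], of "sum \<alpha> B"] by simp
  qed
  obtain c where c: "\<And>x. f x = (\<Sum>\<alpha> \<in> {\<alpha> \<in> Basis \<rightarrow>\<^sub>E {..k}. (\<Sum>b\<in>Basis. \<alpha> b) \<le> k}. c \<alpha> * (\<Prod>b\<in>Basis. (x \<bullet> b) ^ \<alpha> b))"
    using f unfolding poly_space_def by auto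
  have "Pr k (\<lambda>x. \<Sum>\<alpha> \<in> J. c \<alpha> * (\<Prod>b\<in>Basis. (x \<bullet> b) ^ \<alpha> b))"
    if "J \<subseteq> {\<alpha> \<in> Basis \<rightarrow>\<^sub>E {..k}. (\<Sum>b\<in>Basis. \<alpha> b) \<le> k}" for J
    using finite_subset[OF that finite_multi_indices] that
  proof (induction J rule: finite_induct)
    case empty show ?case using mono[OF const[of 0]] by simp
  next
    case (insert \<alpha> J)
    have "Pr (0 + (\<Sum>b\<in>Basis. \<alpha> b)) (\<lambda>x. c \<alpha> * (\<Prod>b\<in>Basis. (x \<bullet> b) ^ \<alpha> b))"
      by (rule mult[OF const prd]) auto
    then have "Pr k (\<lambda>x. c \<alpha> * (\<Prod>b\<in>Basis. (x \<bullet> b) ^ \<alpha> b))"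
      by (rule mono) (use insert in auto)
    then show ?case using add insert by simp
  qed
  moreover have "f = (\<lambda>x. \<Sum>\<alpha> \<in> {\<alpha> \<in> Basis \<rightarrow>\<^sub>E {..k}. (\<Sum>b\<in>Basis. \<alpha> b) \<le> k}. c \<alpha> * (\<Prod>b\<in>Basis. (x \<bullet> b) ^ \<alpha> b))"
    using c by auto
  ultimately show ?thesis by blast
qed

lemma poly_space_affine:
  assumes "f \<in> poly_space k" "linear L"
  shows "(\<lambda>x. f (a + L x)) \<in> poly_space k"
  using assms(1)
proof (induction rule: poly_space_induct)
  case (coord b)
  define M where "M c = L c \<bullet> b" for c
  have e: "(a + L x) \<bullet> b = a \<bullet> b + (\<Sum>c\<in>Basis. M c * (x \<bullet> c))" for x
  proof -
    have "L (\<Sum>c\<in>Basis. (x \<bullet> c) *\<^sub>R c) \<bullet> b = (\<Sum>c\<in>Basis. M c * (x \<bullet> c))"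
      using assms(2) by (simp add: M_def linear_sum linear_scale inner_sum_left mult.commute)
    then show ?thesis by (simp only: euclidean_representation inner_add_left)
  qed
  show ?case unfolding e
    by (intro poly_space_add poly_space_const poly_space_sum poly_space_scale poly_space_coord order_refl)
next
  case (mono j k f)
  then show ?case by (rule poly_space_mono)
qed (auto intro: poly_space_const poly_space_add poly_space_mult)

text \<open>The components stay in \<open>poly_space k\<close>, without lowering the degree, so that
  one estimate applies with the same constant to a function and to its gradient.\<close>

lemma poly_space_gradient:
  fixes f :: "'a::euclidean_space \<Rightarrow> real"
  assumes "f \<in> poly_space k"
  shows "(f has_derivative (\<lambda>h. h \<bullet> grad UNIV f x)) (at x within S)"
    and "b \<in> Basis \<Longrightarrow> (\<lambda>x. grad UNIV f x \<bullet> b) \<in> poly_space k"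
proof -
  \<comment> \<open>\<open>grad\<close> rests on a choice of derivative, so the induction carries an
    explicit gradient field \<open>g\<close>; uniqueness of the derivative identifies it with
    \<open>grad UNIV f\<close> at the end. Membership of \<open>f\<close> is kept for the product
    rule.\<close>
  have "f \<in> poly_space k \<and> (\<exists>g. (\<forall>b\<in>Basis. (\<lambda>x. g x \<bullet> b) \<in> poly_space k) \<and> (\<forall>x. (f has_derivative (\<lambda>h. h \<bullet> g x)) (at x)))"
    using assms
  proof (induction rule: poly_space_induct)
    case (const c)
    show ?case by (intro conjI exI[of _ "\<lambda>_. 0"]) (auto simp: poly_space_0 poly_space_const)
  next
    case (coord b)
    show ?case using coord
      by (intro conjI exI[of _ "\<lambda>_. b"]) (auto simp: poly_space_const poly_space_coord intro!: derivative_eq_intros)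
  next
    case (add k f g)
    then obtain p q where "\<forall>b\<in>Basis. (\<lambda>x. p x \<bullet> b) \<in> poly_space k" "\<forall>x. (f has_derivative (\<lambda>h. h \<bullet> p x)) (at x)"
      "\<forall>b\<in>Basis. (\<lambda>x. q x \<bullet> b) \<in> poly_space k" "\<forall>x. (g has_derivative (\<lambda>h. h \<bullet> q x)) (at x)" by auto
    with add show ?case
      by (intro conjI exI[of _ "\<lambda>x. p x + q x"]) (auto simp: inner_add_left inner_add_right intro!: poly_space_add derivative_eq_intros)
  next
    case (mult j k f g)
    from mult obtain p q where p: "\<And>b. b \<in> Basis \<Longrightarrow> (\<lambda>x. p x \<bullet> b) \<in> poly_space j" "\<forall>x. (f has_derivative (\<lambda>h. h \<bullet> p x)) (at x)"
      and q: "\<And>b. b \<in> Basis \<Longrightarrow> (\<lambda>x. q x \<bullet> b) \<in> poly_space k" "\<forall>x. (g has_derivative (\<lambda>h. h \<bullet> q x)) (at x)" by blast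
    have "(\<lambda>x. (f x *\<^sub>R q x + g x *\<^sub>R p x) \<bullet> b) \<in> poly_space (j + k)" if b: "b \<in> Basis" for b
    proof -
      have "(\<lambda>x. f x * (q x \<bullet> b)) \<in> poly_space (j + k)" "(\<lambda>x. (p x \<bullet> b) * g x) \<in> poly_space (j + k)"
        using mult p(1)[OF b] q(1)[OF b] by (auto intro: poly_space_mult)
      from poly_space_add[OF this] show ?thesis by (simp add: inner_add_left mult.commute)
    qed
    moreover have "((\<lambda>x. f x * g x) has_derivative (\<lambda>h. h \<bullet> (f x *\<^sub>R q x + g x *\<^sub>R p x))) (at x)" for x
      using has_derivative_mult[OF p(2)[rule_format, of x] q(2)[rule_format, of x]]
      by (simp add: inner_add_right mult.commute)
    moreover have "(\<lambda>x. f x * g x) \<in> poly_space (j + k)" using mult poly_space_mult by blast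
    ultimately show ?case by (intro conjI exI[of _ "\<lambda>x. f x *\<^sub>R q x + g x *\<^sub>R p x"]) auto
  next
    case (mono j k f)
    from mono obtain g where g: "\<And>b. b \<in> Basis \<Longrightarrow> (\<lambda>x. g x \<bullet> b) \<in> poly_space j" "\<forall>x. (f has_derivative (\<lambda>h. h \<bullet> g x)) (at x)" by blast
    show ?case
      using g(2) poly_space_mono[OF g(1) mono(2)] poly_space_mono[OF _ mono(2)] mono(1) by blast
  qed
  then obtain g where g: "\<And>b. b \<in> Basis \<Longrightarrow> (\<lambda>x. g x \<bullet> b) \<in> poly_space k"
    "\<And>x. (f has_derivative (\<lambda>h. h \<bullet> g x)) (at x)" by auto
  have "frechet_derivative f (at x) = (\<lambda>h. h \<bullet> g x)" for x
    using frechet_derivative_at[OF g(2)] by simp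
  then have "grad UNIV f x = g x" for x
    by (simp add: grad_def euclidean_representation inner_commute[of _ "g x"])
  then show "(f has_derivative (\<lambda>h. h \<bullet> grad UNIV f x)) (at x within S)"
    and "b \<in> Basis \<Longrightarrow> (\<lambda>x. grad UNIV f x \<bullet> b) \<in> poly_space k"
    using g by (auto intro: has_derivative_at_withinI)
qed

lemma poly_space_continuous_on: "f \<in> poly_space k \<Longrightarrow> continuous_on S f"
  by (meson poly_space_gradient(1) has_derivative_continuous continuous_at_imp_continuous_on)

lemma poly_space_on_line:
  assumes "f \<in> poly_space k"
  shows "\<exists>q :: real poly. \<forall>t. f (a + t *\<^sub>R b) = poly q t"
  using assms
proof (induction rule: poly_space_induct)
  case (const c)
  show ?case by (rule exI[of _ "[:c:]"]) simp
next
  case (coord c)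
  show ?case by (rule exI[of _ "[:a \<bullet> c, b \<bullet> c:]"]) (simp add: inner_add_left)
next
  case (add k f g)
  then obtain p q where "\<forall>t. f (a + t *\<^sub>R b) = poly p t" "\<forall>t. g (a + t *\<^sub>R b) = poly q t" by auto
  then show ?case by (intro exI[of _ "p + q"]) simp
next
  case (mult j k f g)
  then obtain p q where "\<forall>t. f (a + t *\<^sub>R b) = poly p t" "\<forall>t. g (a + t *\<^sub>R b) = poly q t" by auto
  then show ?case by (intro exI[of _ "p * q"]) simp
qed

text \<open>On the line through \<open>c\<close> and \<open>y\<close> the function is a univariate
  polynomial with infinitely many roots.\<close>

lemma poly_space_eq_0:
  assumes f: "f \<in> poly_space k" and z: "\<And>x. x \<in> ball c r \<Longrightarrow> f x = 0" and r: "r > 0"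
  shows "f y = 0"
proof -
  obtain q :: "real poly" where q: "\<And>t. f (c + t *\<^sub>R (y - c)) = poly q t"
    using poly_space_on_line[OF f] by metis
  define \<epsilon> where "\<epsilon> = r / (norm (y - c) + 1)"
  have e: "\<epsilon> > 0" using r by (simp add: \<epsilon>_def add_nonneg_pos)
  have "poly q t = 0" if "t \<in> {0<..<\<epsilon>}" for t
  proof -
    have "norm (t *\<^sub>R (y - c)) < r"
    proof -
      have "t * norm (y - c) \<le> t * (norm (y - c) + 1)" using that by simp
      also have "\<dots> < \<epsilon> * (norm (y - c) + 1)" using that by (intro mult_strict_right_mono) (auto simp: add_nonneg_pos)
      also have "\<dots> = r" by (simp add: \<epsilon>_def add_nonneg_eq_0_iff)
      finally show ?thesis using that by simp
    qed
    then show ?thesis using z[of "c + t *\<^sub>R (y - c)"] q[of t] by (simp add: dist_norm)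
  qed
  then have "infinite {t. poly q t = 0}"
    using infinite_Ioo[OF e] by (metis (mono_tags, lifting) finite_subset mem_Collect_eq subsetI)
  then have "q = 0" using poly_roots_finite by blast
  then show ?thesis using q[of 1] by simp
qed

section \<open>Local estimates for polynomials\<close>

text \<open>In the interior of \<open>S\<close> the gradient does not see the restriction to
  \<open>S\<close>. This links \<open>grad\<close> on the active domain with the gradient of the
  polynomial on one element.\<close>

lemma grad_eqI:
  assumes "(f has_derivative (\<lambda>h. h \<bullet> g)) (at x)" "x \<in> interior S"
  shows "grad S f x = g"
proof -
  have "at x within S = at x" using assms(2) by (rule at_within_interior)
  then have "frechet_derivative f (at x within S) = (\<lambda>h. h \<bullet> g)"
    using frechet_derivative_at[OF assms(1)] by (simp only:)
  then have "grad S f x = (\<Sum>b\<in>Basis. (b \<bullet> g) *\<^sub>R b)"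
    by (simp add: grad_def)
  also have "\<dots> = (\<Sum>b\<in>Basis. (g \<bullet> b) *\<^sub>R b)"
    by (intro sum.cong refl) (simp only: inner_commute)
  also have "\<dots> = g" by (rule euclidean_representation)
  finally show ?thesis .
qed

lemma grad_poly_lincomb:
  assumes "f \<in> poly_space k" "g \<in> poly_space k"
  shows "grad UNIV (\<lambda>x. a * f x + b * g x) x = a *\<^sub>R grad UNIV f x + b *\<^sub>R grad UNIV g x"
  by (rule grad_eqI)
    (auto intro!: derivative_eq_intros poly_space_gradient(1)[OF assms(1)] poly_space_gradient(1)[OF assms(2)]
      simp: inner_add_right)

lemma set_integrable_lebesgue_compact:
  fixes f :: "'a::euclidean_space \<Rightarrow> real"
  assumes "compact S" "continuous_on S f"
  shows "set_integrable lebesgue S f"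
  using borel_integrable_compact[OF assms] unfolding set_integrable_def
  by (simp add: integrable_completion borel_measurable_integrable)

lemma set_lebesgue_integral_ball_affine:
  fixes f :: "'a::euclidean_space \<Rightarrow> real"
  assumes "continuous_on UNIV f" "h > 0"
  shows "(LINT y:cball c (r * h)|lebesgue. f y) = h ^ DIM('a) * (LINT y:cball 0 r|lebesgue. f (c + h *\<^sub>R y))"
proof -
  let ?g = "\<lambda>y. indicator (cball c (r * h)) y *\<^sub>R f y"
  have m: "f \<in> borel_measurable borel" using assms by (simp add: borel_measurable_continuous_onI)
  have mg: "?g \<in> borel_measurable borel"
    by (intro borel_measurable_scaleR borel_measurable_indicator m) simp
  have aff: "(\<lambda>y. c + h *\<^sub>R y) \<in> borel_measurable borel" by measurable
  have i: "indicator (cball c (r * h)) (c + h *\<^sub>R y) = (indicator (cball 0 r) y :: real)" for y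
    using assms(2) by (auto simp: indicator_def dist_norm mult.commute)
  have "(LINT y:cball c (r * h)|lebesgue. f y) = (LINT y|lborel. ?g y)"
    unfolding set_lebesgue_integral_def by (rule integral_completion) (use mg in simp)
  also have "\<dots> = (LINT y|density (distr lborel borel (\<lambda>y. c + h *\<^sub>R y)) (\<lambda>_. ennreal (h ^ DIM('a))). ?g y)"
    using assms(2) lborel_affine[of h c] by simp
  also have "\<dots> = (LINT y|distr lborel borel (\<lambda>y. c + h *\<^sub>R y). h ^ DIM('a) *\<^sub>R ?g y)"
    by (rule integral_density) (use mg assms(2) in auto)
  also have "\<dots> = (LINT y|lborel. h ^ DIM('a) *\<^sub>R ?g (c + h *\<^sub>R y))"
    by (rule integral_distr) (use mg aff in simp_all)
  also have "\<dots> = h ^ DIM('a) * (LINT y|lborel. ?g (c + h *\<^sub>R y))"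
    by simp
  also have "(LINT y|lborel. ?g (c + h *\<^sub>R y)) = (LINT y:cball 0 r|lebesgue. f (c + h *\<^sub>R y))"
    unfolding set_lebesgue_integral_def i[symmetric]
    by (rule integral_completion[symmetric]) (use measurable_compose[OF aff mg] in simp)
  finally show ?thesis .
qed

lemma set_integral_mono_set:
  fixes f :: "'a \<Rightarrow> real"
  assumes "set_integrable M T f" "S \<subseteq> T" "\<And>x. x \<in> T \<Longrightarrow> 0 \<le> f x"
  shows "(LINT x:S|M. f x) \<le> (LINT x:T|M. f x)"
  unfolding set_lebesgue_integral_def
  by (rule integral_mono') (use assms in \<open>auto simp: set_integrable_def indicator_def\<close>)

lemma continuous_l2_zero_imp_zero:
  fixes f :: "'a::euclidean_space \<Rightarrow> real"
  assumes f: "continuous_on UNIV f" and z: "(LINT y:cball c r|lebesgue. f y * f y) = 0" and x: "x \<in> ball c r"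
  shows "f x = 0"
proof (rule ccontr)
  assume "f x \<noteq> 0"
  let ?U = "{y. f y \<noteq> 0} \<inter> ball c r"
  have "open ?U"
    using open_Collect_neq[OF f continuous_on_const] by blast
  moreover have "x \<in> ?U" using x \<open>f x \<noteq> 0\<close> by simp
  ultimately have "\<not> negligible ?U" using open_not_negligible by blast
  have "set_integrable lebesgue (cball c r) (\<lambda>y. f y * f y)"
    by (intro set_integrable_lebesgue_compact continuous_intros continuous_on_subset[OF f]) auto
  then have "AE y in lebesgue. indicator (cball c r) y *\<^sub>R (f y * f y) = 0"
    using z unfolding set_lebesgue_integral_def set_integrable_def
    by (subst (asm) integral_nonneg_eq_0_iff_AE) auto
  then have "AE y in lebesgue. y \<notin> ?U"
    by eventually_elim (auto simp: indicator_def)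
  then have "?U \<in> null_sets lebesgue"
    using \<open>open ?U\<close> by (subst AE_iff_null_sets) auto
  then show False using \<open>\<not> negligible ?U\<close> by (simp add: negligible_iff_null_sets)
qed

text \<open>The monomials serve as the finite generating family. The index set \<open>S\<close> may
  be infinite, such as all points of a ball, which yields supremum estimates.\<close>

lemma poly_functionals_bounded:
  fixes l :: "'s \<Rightarrow> ('a::euclidean_space \<Rightarrow> real) \<Rightarrow> real" and Q
  assumes Ql: "\<And>u v w a b. u \<in> poly_space k \<Longrightarrow> v \<in> poly_space k \<Longrightarrow> w \<in> poly_space k \<Longrightarrow>
      Q (\<lambda>x. a * u x + b * v x) w = a * Q u w + b * Q v w"
    and Qs: "\<And>u v. u \<in> poly_space k \<Longrightarrow> v \<in> poly_space k \<Longrightarrow> Q u v = Q v u"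
    and Qp: "\<And>u. u \<in> poly_space k \<Longrightarrow> 0 \<le> Q u u"
    and l: "\<And>s u v a b. s \<in> S \<Longrightarrow> u \<in> poly_space k \<Longrightarrow> v \<in> poly_space k \<Longrightarrow>
      l s (\<lambda>x. a * u x + b * v x) = a * l s u + b * l s v"
    and lb: "\<And>u. u \<in> poly_space k \<Longrightarrow> \<exists>B. \<forall>s\<in>S. \<bar>l s u :: real\<bar> \<le> B"
    and null: "\<And>s u. s \<in> S \<Longrightarrow> u \<in> poly_space k \<Longrightarrow> Q u u = 0 \<Longrightarrow> l s u = 0"
  shows "\<exists>C\<ge>0. \<forall>f\<in>poly_space k. \<forall>s\<in>S. (l s f)\<^sup>2 \<le> C * Q f f"
proof -
  let ?I = "{\<alpha> \<in> Basis \<rightarrow>\<^sub>E {..k}. (\<Sum>b\<in>Basis. \<alpha> b) \<le> k}"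
  let ?m = "\<lambda>\<alpha> (x::'a). \<Prod>b\<in>Basis. (x \<bullet> b) ^ \<alpha> b"
  have "\<exists>C\<ge>0. \<forall>c. \<forall>s\<in>S. (l s (\<lambda>x. \<Sum>\<alpha>\<in>?I. c \<alpha> * ?m \<alpha> x))\<^sup>2
      \<le> C * Q (\<lambda>x. \<Sum>\<alpha>\<in>?I. c \<alpha> * ?m \<alpha> x) (\<lambda>x. \<Sum>\<alpha>\<in>?I. c \<alpha> * ?m \<alpha> x)"
    by (rule psd_form_bounds_functionals[where V="poly_space k"])
      ((rule finite_multi_indices poly_space_0 | (rule monomial_in_poly_space, simp)
        | (rule poly_space_lincomb Ql Qs Qp l lb null; assumption))+)
  then obtain C where C: "C \<ge> 0" "\<And>c s. s \<in> S \<Longrightarrow> (l s (\<lambda>x. \<Sum>\<alpha>\<in>?I. c \<alpha> * ?m \<alpha> x))\<^sup>2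
      \<le> C * Q (\<lambda>x. \<Sum>\<alpha>\<in>?I. c \<alpha> * ?m \<alpha> x) (\<lambda>x. \<Sum>\<alpha>\<in>?I. c \<alpha> * ?m \<alpha> x)"
    by blast
  have "(l s f)\<^sup>2 \<le> C * Q f f" if f: "f \<in> poly_space k" and s: "s \<in> S" for f s
  proof -
    obtain c where "f = (\<lambda>x. \<Sum>\<alpha>\<in>?I. c \<alpha> * ?m \<alpha> x)"
      using f unfolding poly_space_def by auto
    then show ?thesis using C(2)[OF s, of c] by simp
  qed
  then show ?thesis using C(1) by blast
qed

text \<open>The form is definite on polynomials: a vanishing integral of the square forces the
  function to be zero on the ball, hence everywhere. So the null condition is met by every family of
  linear functionals.\<close>

lemma poly_functionals_bounded_l2:
  fixes l :: "'s \<Rightarrow> ('a::euclidean_space \<Rightarrow> real) \<Rightarrow> real"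
  assumes l: "\<And>s u v a b. s \<in> S \<Longrightarrow> u \<in> poly_space k \<Longrightarrow> v \<in> poly_space k \<Longrightarrow>
      l s (\<lambda>x. a * u x + b * v x) = a * l s u + b * l s v"
    and lb: "\<And>u. u \<in> poly_space k \<Longrightarrow> \<exists>B. \<forall>s\<in>S. \<bar>l s u :: real\<bar> \<le> B"
    and \<rho>: "\<rho> > 0"
  shows "\<exists>C\<ge>0. \<forall>f\<in>poly_space k. \<forall>s\<in>S. (l s f)\<^sup>2 \<le> C * (LINT y:cball 0 \<rho>|lebesgue. (f y)\<^sup>2)"
proof -
  let ?Q = "l2 lebesgue (cball (0::'a) \<rho>)"
  have int: "set_integrable lebesgue (cball 0 \<rho>) (\<lambda>x. u x * v x)"
    if "u \<in> poly_space k" "v \<in> poly_space k" for u v :: "'a \<Rightarrow> real"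
    by (intro set_integrable_lebesgue_compact compact_cball continuous_on_mult
        poly_space_continuous_on[OF that(1)] poly_space_continuous_on[OF that(2)])
  have "\<exists>C\<ge>0. \<forall>f\<in>poly_space k. \<forall>s\<in>S. (l s f)\<^sup>2 \<le> C * ?Q f f"
  proof (rule poly_functionals_bounded[where Q="?Q" and l=l])
    fix u v w :: "'a \<Rightarrow> real" and a b :: real
    assume uvw: "u \<in> poly_space k" "v \<in> poly_space k" "w \<in> poly_space k"
    have "?Q (\<lambda>x. a * u x + b * v x) w = (LINT x:cball 0 \<rho>|lebesgue. a * (u x * w x) + b * (v x * w x))"
      unfolding l2_def by (simp add: algebra_simps)
    also have "\<dots> = a * ?Q u w + b * ?Q v w"
      unfolding l2_def using int[OF uvw(1,3)] int[OF uvw(2,3)] by (subst set_integral_add) auto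
    finally show "?Q (\<lambda>x. a * u x + b * v x) w = a * ?Q u w + b * ?Q v w" .
  next
    fix s u assume su: "s \<in> S" "u \<in> poly_space k" "?Q u u = 0"
    have z: "u x = 0" if "x \<in> ball 0 \<rho>" for x
      by (rule continuous_l2_zero_imp_zero[OF poly_space_continuous_on[OF su(2)] _ that])
        (use su(3) in \<open>simp add: l2_def\<close>)
    have "u x = 0" for x by (rule poly_space_eq_0[OF su(2) _ \<rho>]) (rule z)
    then have "u = (\<lambda>x. 0 * u x + 0 * u x)" by auto
    then show "l s u = 0" using l[OF su(1,2,2), of 0 0] by simp
  next
    show "?Q u v = ?Q v u" for u v by (simp add: l2_def mult.commute)
    show "0 \<le> ?Q u u" for u by (simp add: l2_def set_lebesgue_integral_def integral_nonneg_AE)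
  qed (fact l, fact lb)
  then show ?thesis by (simp add: l2_def power2_eq_square)
qed

text \<open>The supremum is over the ball of radius \<open>h\<close>, while the integral need only
  see the smaller ball: a polynomial of bounded degree can be extrapolated from one to the other.
  Scaling to \<open>h = 1\<close> leaves a constant that depends on \<open>\<rho>\<close>,
  \<open>k\<close> and the dimension only.\<close>

lemma poly_sup_le_l2:
  assumes "\<rho> > 0"
  shows "\<exists>C\<ge>0. \<forall>f\<in>poly_space k. \<forall>c h T. \<forall>x\<in>cball (c::'a::euclidean_space) h. h > 0 \<longrightarrow> compact T \<longrightarrow>
    cball c (\<rho> * h) \<subseteq> T \<longrightarrow> (f x)\<^sup>2 * h ^ DIM('a) \<le> C * (LINT y:T|lebesgue. (f y)\<^sup>2)"
proof -
  have "\<exists>B. \<forall>s\<in>cball (0::'a) 1. \<bar>u s\<bar> \<le> B" if "u \<in> poly_space k" for u :: "'a \<Rightarrow> real"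
    using compact_imp_bounded[OF compact_continuous_image[OF poly_space_continuous_on[OF that] compact_cball[of 0 1]]]
    unfolding bounded_iff by auto
  then obtain C where C: "C \<ge> 0" "\<And>f s. f \<in> poly_space k \<Longrightarrow> s \<in> cball (0::'a) 1 \<Longrightarrow>
      (f s)\<^sup>2 \<le> C * (LINT y:cball 0 \<rho>|lebesgue. (f y)\<^sup>2)"
    using poly_functionals_bounded_l2[of "cball 0 1" k "\<lambda>s f. f s", OF refl _ assms] by blast
  have "(f x)\<^sup>2 * h ^ DIM('a) \<le> C * (LINT y:T|lebesgue. (f y)\<^sup>2)"
    if f: "f \<in> poly_space k" and x: "x \<in> cball c h" and h: "h > 0" and T: "compact T" "cball c (\<rho> * h) \<subseteq> T"
    for f and c x :: 'a and h T
  proof -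
    define g where "g y = f (c + h *\<^sub>R y)" for y
    have g: "g \<in> poly_space k" unfolding g_def by (rule poly_space_affine[OF f]) (simp add: linear_scale_self)
    have fc: "continuous_on S f" for S by (rule poly_space_continuous_on[OF f])
    have "(x - c) /\<^sub>R h \<in> cball 0 1" using x h by (simp add: dist_norm norm_minus_commute divide_simps)
    from C(2)[OF g this] have "(f x)\<^sup>2 \<le> C * (LINT y:cball 0 \<rho>|lebesgue. (f (c + h *\<^sub>R y))\<^sup>2)"
      using h by (simp add: g_def)
    then have "(f x)\<^sup>2 * h ^ DIM('a) \<le> C * (h ^ DIM('a) * (LINT y:cball 0 \<rho>|lebesgue. (f (c + h *\<^sub>R y))\<^sup>2))"
      using h by (simp add: mult.commute mult.left_commute)
    also have "h ^ DIM('a) * (LINT y:cball 0 \<rho>|lebesgue. (f (c + h *\<^sub>R y))\<^sup>2) = (LINT y:cball c (\<rho> * h)|lebesgue. (f y)\<^sup>2)"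
      by (rule set_lebesgue_integral_ball_affine[symmetric, where f="\<lambda>y. (f y)\<^sup>2"]) (auto intro!: continuous_intros fc h)
    also have "\<dots> \<le> (LINT y:T|lebesgue. (f y)\<^sup>2)"
      by (rule set_integral_mono_set)
        (use T in \<open>auto intro!: set_integrable_lebesgue_compact continuous_intros fc\<close>)
    finally show ?thesis using C(1) by (simp add: mult_left_mono)
  qed
  then show ?thesis using C(1) by blast
qed

text \<open>The functionals are all gradient components at all points of the unit ball, hence the
  product index set. Scaling multiplies the gradient by \<open>h\<close>, the factor on the
  left.\<close>

lemma poly_gradient_inverse_estimate:
  assumes "\<rho> > 0"
  shows "\<exists>C\<ge>0. \<forall>f\<in>poly_space k. \<forall>c h M. \<forall>x\<in>cball (c::'a::euclidean_space) h. h > 0 \<longrightarrow>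
    (\<forall>y\<in>cball c (\<rho> * h). \<bar>f y\<bar> \<le> M) \<longrightarrow> norm (grad UNIV f x) * h \<le> C * M"
proof -
  let ?S = "cball (0::'a) 1 \<times> (Basis :: 'a set)"
  let ?l = "\<lambda>(x, b) f. grad UNIV f x \<bullet> b"
  have "\<exists>B. \<forall>s\<in>?S. \<bar>?l s u\<bar> \<le> B" if u: "u \<in> poly_space k" for u :: "'a \<Rightarrow> real"
  proof -
    have "continuous_on (cball 0 1) (\<lambda>x. \<Sum>b\<in>Basis. \<bar>grad UNIV u x \<bullet> b\<bar>)"
      by (intro continuous_on_sum continuous_on_rabs poly_space_continuous_on[OF poly_space_gradient(2)[OF u]])
    from compact_imp_bounded[OF compact_continuous_image[OF this compact_cball]]
    obtain B where B: "\<And>x. x \<in> cball 0 1 \<Longrightarrow> norm (\<Sum>b\<in>Basis. \<bar>grad UNIV u x \<bullet> b\<bar>) \<le> B"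
      unfolding bounded_iff by blast
    have "\<bar>grad UNIV u x \<bullet> b\<bar> \<le> B" if "x \<in> cball 0 1" "b \<in> Basis" for x b
      using member_le_sum[OF that(2), of "\<lambda>b. \<bar>grad UNIV u x \<bullet> b\<bar>"] B[OF that(1)] by auto
    then show ?thesis by (intro exI[of _ B]) fastforce
  qed
  then have "\<exists>C\<ge>0. \<forall>f\<in>poly_space k. \<forall>s\<in>?S. (?l s f)\<^sup>2 \<le> C * (LINT y:cball 0 \<rho>|lebesgue. (f y)\<^sup>2)"
    by (intro poly_functionals_bounded_l2 assms) (auto simp: grad_poly_lincomb inner_add_left)
  then obtain C where C: "C \<ge> 0" "\<And>f x b. f \<in> poly_space k \<Longrightarrow> x \<in> cball 0 1 \<Longrightarrow> b \<in> Basis \<Longrightarrow>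
      (grad UNIV f x \<bullet> b)\<^sup>2 \<le> C * (LINT y:cball (0::'a) \<rho>|lebesgue. (f y)\<^sup>2)"
    by auto
  \<comment> \<open>The square integral is at most \<open>M\<^sup>2\<close> times the volume of the
    ball, whence the root; \<open>DIM('a)\<close> comes from bounding the Euclidean norm by the sum
    of the components.\<close>
  define D where "D = DIM('a) * sqrt (C * measure lebesgue (cball (0::'a) \<rho>))"
  have "norm (grad UNIV f x) * h \<le> D * M"
    if f: "f \<in> poly_space k" and x: "x \<in> cball c h" and h: "h > 0" and M: "\<And>y. y \<in> cball c (\<rho> * h) \<Longrightarrow> \<bar>f y\<bar> \<le> M"
    for f and c x :: 'a and h M
  proof -
    define g where "g y = f (c + h *\<^sub>R y)" for y
    have g: "g \<in> poly_space k" unfolding g_def by (rule poly_space_affine[OF f]) (simp add: linear_scale_self)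
    have gg: "grad UNIV g y = h *\<^sub>R grad UNIV f (c + h *\<^sub>R y)" for y
    proof (rule grad_eqI)
      have "((\<lambda>y. c + h *\<^sub>R y) has_derivative (\<lambda>k. h *\<^sub>R k)) (at y)"
        by (auto intro!: derivative_eq_intros)
      from has_derivative_compose[OF this poly_space_gradient(1)[OF f]]
      show "(g has_derivative (\<lambda>k. k \<bullet> (h *\<^sub>R grad UNIV f (c + h *\<^sub>R y)))) (at y)"
        by (simp add: g_def[abs_def])
    qed simp
    have "M \<ge> 0" using M[of c] assms h by force
    have gM: "(g y)\<^sup>2 \<le> M\<^sup>2" if "y \<in> cball 0 \<rho>" for y
    proof -
      have "\<bar>g y\<bar> \<le> M" unfolding g_def
        using that h by (intro M) (simp add: dist_norm mult.commute)
      then show ?thesis by (metis abs_ge_zero power2_abs power_mono)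
    qed
    have "(LINT y:cball 0 \<rho>|lebesgue. (g y)\<^sup>2) \<le> (LINT y:cball (0::'a) \<rho>|lebesgue. M\<^sup>2)"
      by (rule set_integral_mono)
        (auto intro!: set_integrable_lebesgue_compact continuous_intros poly_space_continuous_on[OF g] gM)
    also have "\<dots> = M\<^sup>2 * measure lebesgue (cball (0::'a) \<rho>)"
      unfolding set_lebesgue_integral_def by simp
    finally have I: "(LINT y:cball 0 \<rho>|lebesgue. (g y)\<^sup>2) \<le> M\<^sup>2 * measure lebesgue (cball (0::'a) \<rho>)" .
    define y where "y = (x - c) /\<^sub>R h"
    have y: "y \<in> cball 0 1" "x = c + h *\<^sub>R y"
      using x h by (auto simp: y_def dist_norm norm_minus_commute divide_simps)
    have "\<bar>(h *\<^sub>R grad UNIV f x) \<bullet> b\<bar> \<le> sqrt (C * measure lebesgue (cball (0::'a) \<rho>)) * M" if b: "b \<in> Basis" for b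
    proof -
      define a where "a = (h *\<^sub>R grad UNIV f x) \<bullet> b"
      define m where "m = measure lebesgue (cball (0::'a) \<rho>)"
      have "m \<ge> 0" by (simp add: m_def)
      have "a\<^sup>2 \<le> C * (LINT y:cball 0 \<rho>|lebesgue. (g y)\<^sup>2)"
        using C(2)[OF g y(1) b] unfolding gg y(2)[symmetric] a_def .
      also have "\<dots> \<le> C * (M\<^sup>2 * m)"
        using mult_left_mono[OF I C(1)] by (simp add: m_def)
      also have "\<dots> = (sqrt (C * m) * M)\<^sup>2"
        using C(1) \<open>m \<ge> 0\<close> by (simp add: power_mult_distrib)
      finally have "\<bar>a\<bar> \<le> \<bar>sqrt (C * m) * M\<bar>" by (simp only: abs_le_square_iff)
      then show ?thesis using C(1) \<open>M \<ge> 0\<close> \<open>m \<ge> 0\<close> by (simp add: a_def m_def abs_mult)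
    qed
    then have "(\<Sum>b\<in>Basis. \<bar>(h *\<^sub>R grad UNIV f x) \<bullet> b\<bar>) \<le> D * M"
      using sum_bounded_above[of Basis "\<lambda>b. \<bar>(h *\<^sub>R grad UNIV f x) \<bullet> b\<bar>"] by (simp add: D_def mult.assoc)
    then show ?thesis using norm_le_l1[of "h *\<^sub>R grad UNIV f x"] h by (simp add: mult.commute)
  qed
  moreover have "D \<ge> 0" using C(1) by (simp add: D_def)
  ultimately show ?thesis by blast
qed

text \<open>A Poincare inequality for point values. The gradient components are polynomials, so
  their supremum is controlled by their square integral, and the mean value inequality gives the
  oscillation. The final factor 4 stems from the diameter \<open>2 * h\<close> of the ball.\<close>

lemma poly_oscillation_le_gradient:
  assumes "\<rho> > 0"
  shows "\<exists>C\<ge>0. \<forall>f\<in>poly_space k. \<forall>c h T. \<forall>x\<in>cball (c::'a::euclidean_space) h. \<forall>y\<in>cball c h.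
    h > 0 \<longrightarrow> compact T \<longrightarrow> cball c (\<rho> * h) \<subseteq> T \<longrightarrow>
    (f x - f y)\<^sup>2 * h ^ DIM('a) \<le> C * h\<^sup>2 * (LINT y:T|lebesgue. grad UNIV f y \<bullet> grad UNIV f y)"
proof -
  obtain C where C: "C \<ge> 0" "\<And>f c h T x. f \<in> poly_space k \<Longrightarrow> x \<in> cball (c::'a) h \<Longrightarrow> h > 0 \<Longrightarrow> compact T \<Longrightarrow>
    cball c (\<rho> * h) \<subseteq> T \<Longrightarrow> (f x)\<^sup>2 * h ^ DIM('a) \<le> C * (LINT y:T|lebesgue. (f y)\<^sup>2)"
    using poly_sup_le_l2[OF assms, of k] by blast
  have "(f x - f y)\<^sup>2 * h ^ DIM('a) \<le> 4 * C * h\<^sup>2 * (LINT y:T|lebesgue. grad UNIV f y \<bullet> grad UNIV f y)"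
    if f: "f \<in> poly_space k" and xy: "x \<in> cball c h" "y \<in> cball c h" and h: "h > 0"
      and T: "compact T" "cball c (\<rho> * h) \<subseteq> T" for f and c x y :: 'a and h T
  proof -
    let ?I = "LINT y:T|lebesgue. grad UNIV f y \<bullet> grad UNIV f y"
    have "?I = (LINT y:T|lebesgue. (\<Sum>b\<in>Basis. (grad UNIV f y \<bullet> b)\<^sup>2))"
      by (subst euclidean_inner) (simp add: power2_eq_square)
    also have "\<dots> = (\<Sum>b\<in>Basis. (LINT y:T|lebesgue. (grad UNIV f y \<bullet> b)\<^sup>2))"
      unfolding set_lebesgue_integral_def scaleR_sum_right
      by (rule Bochner_Integration.integral_sum, fold set_integrable_def)
        (intro set_integrable_lebesgue_compact T continuous_on_power
          poly_space_continuous_on[OF poly_space_gradient(2)[OF f]])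
    finally have I: "?I = \<dots>" .
    have G: "(norm (grad UNIV f z))\<^sup>2 * h ^ DIM('a) \<le> C * ?I" if z: "z \<in> cball c h" for z
    proof -
      have "(norm (grad UNIV f z))\<^sup>2 * h ^ DIM('a) = (\<Sum>b\<in>Basis. (grad UNIV f z \<bullet> b)\<^sup>2 * h ^ DIM('a))"
        unfolding power2_norm_eq_inner by (subst euclidean_inner) (simp add: sum_distrib_right power2_eq_square)
      also have "\<dots> \<le> (\<Sum>b\<in>Basis. C * (LINT y:T|lebesgue. (grad UNIV f y \<bullet> b)\<^sup>2))"
        by (intro sum_mono C(2)[OF poly_space_gradient(2)[OF f] z h T])
      finally show ?thesis by (simp add: I sum_distrib_left)
    qed
    define B where "B = sqrt (C * ?I / h ^ DIM('a))"
    have nB: "norm (grad UNIV f z) \<le> B" if "z \<in> cball c h" for z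
      unfolding B_def using G[OF that] h by (intro real_le_rsqrt) (simp add: field_simps)
    have I0: "?I \<ge> 0" by (simp add: set_lebesgue_integral_def integral_nonneg_AE)
    have "norm (f x - f y) \<le> B * norm (x - y)"
    proof (rule differentiable_bound[OF convex_cball])
      show "(f has_derivative (\<lambda>k. k \<bullet> grad UNIV f z)) (at z within cball c h)" for z
        by (rule poly_space_gradient(1)[OF f])
      show "onorm (\<lambda>k. k \<bullet> grad UNIV f z) \<le> B" if "z \<in> cball c h" for z
      proof (rule onorm_le)
        fix k show "norm (k \<bullet> grad UNIV f z) \<le> B * norm k"
          using Cauchy_Schwarz_ineq2[of k "grad UNIV f z"] mult_right_mono[OF nB[OF that], of "norm k"]
          by (simp add: mult.commute)
      qed
    qed (use xy in auto)
    also have "\<dots> \<le> B * (2 * h)"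
      using xy norm_triangle_ineq4[of "x - c" "y - c"] C(1) I0 h
      by (intro mult_left_mono) (auto simp: dist_norm norm_minus_commute B_def)
    finally have "(f x - f y)\<^sup>2 \<le> (B * (2 * h))\<^sup>2"
      by (metis abs_ge_zero power2_abs power_mono real_norm_def)
    also have "\<dots> = 4 * h\<^sup>2 * (C * ?I / h ^ DIM('a))"
      using C(1) I0 h by (simp add: B_def power_mult_distrib)
    finally show ?thesis using h by (simp add: field_simps)
  qed
  then show ?thesis using C(1) by (intro exI[of _ "4 * C"]) auto
qed

section \<open>Unisolvence of the Lagrange nodes\<close>

lemma poly_space_0_const: "f \<in> poly_space 0 \<Longrightarrow> f x = f y"
proof -
  have "k = 0 \<Longrightarrow> \<exists>c. f = (\<lambda>x. c)" if "f \<in> poly_space k" for k and f :: "'a \<Rightarrow> real"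
    using that by (induction rule: poly_space_induct) auto
  then show "f \<in> poly_space 0 \<Longrightarrow> f x = f y" by blast
qed

text \<open>Division by the coordinate along \<open>b\<close>, with the restriction to its zero
  hyperplane as remainder. For \<open>k = 0\<close> the degree \<open>k - 1\<close> is again 0, so
  the vanishing of the quotient has to be stated separately.\<close>

lemma poly_space_split_coord:
  fixes f :: "'a::euclidean_space \<Rightarrow> real"
  assumes "f \<in> poly_space k" and b: "b \<in> Basis"
  shows "\<exists>g\<in>poly_space (k - 1). (k = 0 \<longrightarrow> g = (\<lambda>x. 0)) \<and> (\<forall>x. f x = f (x - (x \<bullet> b) *\<^sub>R b) + (x \<bullet> b) * g x)"
proof -
  let ?p = "\<lambda>x. x - (x \<bullet> b) *\<^sub>R b"
  have lin: "linear ?p" by (auto intro!: linearI simp: inner_add_left algebra_simps)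
  have pp: "(\<lambda>x. f (?p x)) \<in> poly_space k" if "f \<in> poly_space k" for f k
    using poly_space_affine[OF that lin, of 0] by simp
  have I: "f \<in> poly_space k \<and> (\<exists>g\<in>poly_space (k - 1). (k = 0 \<longrightarrow> g = (\<lambda>x. 0)) \<and> (\<forall>x. f x = f (?p x) + (x \<bullet> b) * g x))"
    if "f \<in> poly_space k" "g \<in> poly_space (k - 1)" "k = 0 \<Longrightarrow> g = (\<lambda>x. 0)" "\<And>x. f x = f (?p x) + (x \<bullet> b) * g x"
    for f g k using that by blast
  have "f \<in> poly_space k \<and> (\<exists>g\<in>poly_space (k - 1). (k = 0 \<longrightarrow> g = (\<lambda>x. 0)) \<and> (\<forall>x. f x = f (?p x) + (x \<bullet> b) * g x))"
    using assms(1)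
  proof (induction rule: poly_space_induct)
    case (const c)
    show ?case by (auto simp: poly_space_const intro!: bexI[of _ "\<lambda>x. 0"] poly_space_0)
  next
    case (coord c)
    show ?case using coord
      by (intro I[of _ 1 "\<lambda>x. b \<bullet> c"]) (simp_all add: poly_space_const poly_space_coord inner_diff_left)
  next
    case (add k f1 f2)
    then obtain g1 g2 where g: "g1 \<in> poly_space (k - 1)" "k = 0 \<longrightarrow> g1 = (\<lambda>x. 0)" "\<And>x. f1 x = f1 (?p x) + (x \<bullet> b) * g1 x"
      "g2 \<in> poly_space (k - 1)" "k = 0 \<longrightarrow> g2 = (\<lambda>x. 0)" "\<And>x. f2 x = f2 (?p x) + (x \<bullet> b) * g2 x"
      by blast
    have e: "f1 x + f2 x = f1 (?p x) + f2 (?p x) + (x \<bullet> b) * (g1 x + g2 x)" for x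
      using g(3)[of x] g(6)[of x] by (simp add: distrib_left)
    show ?case
    proof (rule I)
      show "(\<lambda>x. f1 x + f2 x) \<in> poly_space k" using add by (blast intro: poly_space_add)
      show "(\<lambda>x. g1 x + g2 x) \<in> poly_space (k - 1)" by (rule poly_space_add[OF g(1,4)])
      show "(\<lambda>x. g1 x + g2 x) = (\<lambda>x. 0)" if "k = 0" using g(2,5) that by simp
    qed (rule e)
  next
    case (mult j k f1 f2)
    then obtain g1 g2 where g: "g1 \<in> poly_space (j - 1)" "j = 0 \<longrightarrow> g1 = (\<lambda>x. 0)" "\<And>x. f1 x = f1 (?p x) + (x \<bullet> b) * g1 x"
      "g2 \<in> poly_space (k - 1)" "k = 0 \<longrightarrow> g2 = (\<lambda>x. 0)" "\<And>x. f2 x = f2 (?p x) + (x \<bullet> b) * g2 x"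
      by blast
    \<comment> \<open>Product rule for difference quotients: one factor changes at a time.\<close>
    define q where "q x = g1 x * f2 x + f1 (?p x) * g2 x" for x
    have e: "f1 x * f2 x = f1 (?p x) * f2 (?p x) + (x \<bullet> b) * q x" for x
    proof -
      have "f1 x * f2 x = (f1 (?p x) + (x \<bullet> b) * g1 x) * f2 x" using g(3)[of x] by simp
      also have "\<dots> = f1 (?p x) * (f2 (?p x) + (x \<bullet> b) * g2 x) + (x \<bullet> b) * g1 x * f2 x"
        using g(6)[of x] by (simp add: distrib_right)
      finally show ?thesis by (simp add: q_def algebra_simps)
    qed
    \<comment> \<open>The degree count \<open>j - 1 + k = j + k - 1\<close> can fail for
      \<open>j = 0\<close>, where \<open>g1\<close> vanishes instead.\<close>
    have "(\<lambda>x. g1 x * f2 x) \<in> poly_space (j + k - 1)"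
    proof (cases "j = 0")
      case True then show ?thesis using g(2) by (simp add: poly_space_0)
    next
      case False
      then show ?thesis using poly_space_mult[OF g(1), of f2 k] mult by simp
    qed
    moreover have "(\<lambda>x. f1 (?p x) * g2 x) \<in> poly_space (j + k - 1)"
    proof (cases "k = 0")
      case True then show ?thesis using g(5) by (simp add: poly_space_0)
    next
      case False
      then show ?thesis using poly_space_mult[OF pp g(4), of f1 j] mult by simp
    qed
    ultimately have q: "q \<in> poly_space (j + k - 1)"
      unfolding q_def[abs_def] by (rule poly_space_add)
    show ?case
    proof (rule I)
      show "(\<lambda>x. f1 x * f2 x) \<in> poly_space (j + k)" using mult by (blast intro: poly_space_mult)
      show "q = (\<lambda>x. 0)" if "j + k = 0" using g(2,5) that by (simp add: q_def[abs_def])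
    qed (rule q, rule e)
  next
    case (mono j k f)
    then obtain g where g: "g \<in> poly_space (j - 1)" "j = 0 \<longrightarrow> g = (\<lambda>x. 0)" "\<And>x. f x = f (?p x) + (x \<bullet> b) * g x"
      by blast
    have "g \<in> poly_space (k - 1)" by (rule poly_space_mono[OF g(1)]) (use mono in auto)
    moreover have "f \<in> poly_space k" using mono by (blast intro: poly_space_mono)
    moreover have "g = (\<lambda>x. 0)" if "k = 0" using g(2) mono(2) that by simp
    ultimately show ?case using g(3) by (intro I)
  qed
  then show ?thesis by blast
qed

text \<open>Induction on the number of variables and the degree: \<open>f\<close> vanishes on \<open>x\<^sub>b = 0\<close>, and the quotient
  of \<open>f\<close> by \<open>x\<^sub>b\<close>, shifted by \<open>b\<close>, vanishes on the smaller lattice.\<close>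

lemma poly_space_lattice_unisolvent:
  fixes f :: "'a::euclidean_space \<Rightarrow> real"
  assumes "finite B" "B \<subseteq> Basis" "f \<in> poly_space k"
    and "\<And>x. f x = f (\<Sum>b\<in>B. (x \<bullet> b) *\<^sub>R b)"
    and "\<And>a. (\<Sum>b\<in>B. a b) \<le> k \<Longrightarrow> f (\<Sum>b\<in>B. real (a b) *\<^sub>R b) = 0"
  shows "f x = 0"
  using assms
proof (induction B arbitrary: f k x rule: finite_induct)
  case empty
  then show ?case using empty(3)[of x] empty(4)[of "\<lambda>_. 0"] by simp
next
  case (insert b B)
  have b: "b \<in> Basis" and B: "B \<subseteq> Basis" using insert by auto
  let ?\<pi> = "\<lambda>x. \<Sum>c\<in>insert b B. (x \<bullet> c) *\<^sub>R c"
  have pc: "(\<Sum>c\<in>C. r c *\<^sub>R c) \<bullet> d = (if d \<in> C then r d else 0)" if "C \<subseteq> Basis" "d \<in> Basis" for C d and r :: "'a \<Rightarrow> real"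
  proof -
    have "finite C" using that finite_subset finite_Basis by blast
    have "(\<Sum>c\<in>C. r c *\<^sub>R c) \<bullet> d = (\<Sum>c\<in>C. if c = d then r c else 0)"
      unfolding inner_sum_left by (intro sum.cong refl) (use that in \<open>auto simp: inner_Basis subset_iff\<close>)
    then show ?thesis using \<open>finite C\<close> by (simp add: sum.delta)
  qed
  have lin\<pi>: "linear ?\<pi>"
    by (auto intro!: linearI simp: inner_add_left sum.distrib scaleR_sum_right scaleR_add_left simp del: sum.insert)
  have idem: "?\<pi> (?\<pi> x) = ?\<pi> x" for x
    by (intro sum.cong refl) (use insert pc[of "insert b B"] in \<open>auto simp del: sum.insert\<close>)
  from insert(5,6,7) show ?case
  proof (induction k arbitrary: f x)
    case 0
    have "f x = f (\<Sum>c\<in>insert b B. real 0 *\<^sub>R c)" by (rule poly_space_0_const[OF 0(1)])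
    also have "\<dots> = 0" using 0(3)[of "\<lambda>_. 0"] by simp
    finally show ?case .
  next
    case (Suc k)
    let ?p = "\<lambda>x. x - (x \<bullet> b) *\<^sub>R b"
    have lin: "linear ?p" by (auto intro!: linearI simp: inner_add_left algebra_simps)
    have p\<pi>: "?\<pi> (?p x) = (\<Sum>c\<in>B. (x \<bullet> c) *\<^sub>R c)" for x
    proof -
      have "(?p x \<bullet> c) = x \<bullet> c" if "c \<in> B" for c
        using that insert(2) b B by (auto simp: inner_diff_left inner_Basis subset_iff)
      moreover have "?p x \<bullet> b = 0" using b by (simp add: inner_diff_left)
      ultimately show ?thesis using insert(1,2) by simp
    qed
    have f0: "f (?p x) = 0" for x
    proof (rule insert(3)[OF B, of "\<lambda>x. f (?p x)" "Suc k"])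
      show "(\<lambda>x. f (?p x)) \<in> poly_space (Suc k)" using poly_space_affine[OF Suc(2) lin, of 0] by simp
      show "f (?p x) = f (?p (\<Sum>c\<in>B. (x \<bullet> c) *\<^sub>R c))" for x
      proof -
        have "(\<Sum>c\<in>B. (x \<bullet> c) *\<^sub>R c) \<bullet> b = 0" using pc[OF B b] insert(2) by auto
        then show ?thesis using Suc(3)[of "?p x"] p\<pi>[of x] by simp
      qed
      show "f (?p (\<Sum>c\<in>B. real (a c) *\<^sub>R c)) = 0" if "(\<Sum>c\<in>B. a c) \<le> Suc k" for a
      proof -
        have "(\<Sum>c\<in>B. real (a c) *\<^sub>R c) \<bullet> b = 0" using pc[OF B b] insert(2) by auto
        moreover have "(\<Sum>c\<in>insert b B. real ((a(b := 0)) c) *\<^sub>R c) = (\<Sum>c\<in>B. real (a c) *\<^sub>R c)"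
          using insert(1,2) by (auto intro!: sum.cong)
        moreover have "(\<Sum>c\<in>insert b B. (a(b := 0)) c) \<le> Suc k"
          using insert(1,2) that by (subst sum.insert) (auto intro!: order_trans[OF eq_refl that] sum.cong)
        ultimately show ?thesis using Suc(4)[of "a(b := 0)"] by simp
      qed
    qed
    obtain g where g: "g \<in> poly_space k" "\<And>x. f x = (x \<bullet> b) * g x"
      using poly_space_split_coord[OF Suc(2) b] f0 by auto
    have \<pi>b: "?\<pi> x \<bullet> b = x \<bullet> b" for x using pc[of "insert b B" b] insert(4) b by (auto simp del: sum.insert)
    \<comment> \<open>The quotient \<open>g\<close> may still depend on coordinates outside
      \<open>insert b B\<close>; composing it with the projection removes this.\<close>
    have fg: "f x = (x \<bullet> b) * g (?\<pi> x)" for x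
      using Suc(3)[of x] g(2)[of "?\<pi> x"] \<pi>b[of x] by simp
    \<comment> \<open>A point of the smaller lattice, shifted by \<open>b\<close>, stays in the
      larger lattice and has a positive coordinate along \<open>b\<close>; there the factor
      \<open>x \<bullet> b\<close> can be cancelled from \<open>f x = 0\<close>.\<close>
    define h where "h x = g (?\<pi> (x + b))" for x
    have hz: "h x = 0" for x
    proof (rule Suc.IH)
      show "h \<in> poly_space k"
        unfolding h_def[abs_def] linear_add[OF lin\<pi>]
        using poly_space_affine[OF g(1) lin\<pi>, of "?\<pi> b"] by (simp add: add.commute del: sum.insert)
      show "h x = h (?\<pi> x)" for x
        unfolding h_def linear_add[OF lin\<pi>] idem ..
      show "h (\<Sum>c\<in>insert b B. real (a c) *\<^sub>R c) = 0" if "(\<Sum>c\<in>insert b B. a c) \<le> k" for a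
      proof -
        define y where "y = (\<Sum>c\<in>insert b B. real ((a(b := Suc (a b))) c) *\<^sub>R c)"
        have y: "y = (\<Sum>c\<in>insert b B. real (a c) *\<^sub>R c) + b"
        proof -
          have "(\<Sum>c\<in>B. real ((a(b := Suc (a b))) c) *\<^sub>R c) = (\<Sum>c\<in>B. real (a c) *\<^sub>R c)"
            using insert(2) by (intro sum.cong) auto
          then show ?thesis unfolding y_def using insert(1,2) by (simp add: algebra_simps)
        qed
        have "(\<Sum>c\<in>B. (a(b := Suc (a b))) c) = (\<Sum>c\<in>B. a c)" using insert(2) by (intro sum.cong) auto
        then have "(\<Sum>c\<in>insert b B. (a(b := Suc (a b))) c) \<le> Suc k"
          using that insert(1,2) by simp
        from Suc(4)[OF this] have "f y = 0" by (simp add: y_def del: sum.insert)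
        moreover have "y \<bullet> b = real (Suc (a b))"
          unfolding y_def using pc[of "insert b B" b] insert(4) b by (auto simp del: sum.insert)
        ultimately have "g (?\<pi> y) = 0" using fg[of y] by simp
        then show ?thesis by (simp add: h_def y del: sum.insert)
      qed
    qed
    show ?case using hz[of "x - b"] fg[of x] by (simp add: h_def del: sum.insert)
  qed
qed

text \<open>The quadratic form is the sum of the squared nodal values. Unisolvence says that it is
  definite, and this is all the general principle asks for.\<close>

lemma poly_reference_simplex_bound:
  assumes k: "k \<ge> 1"
  shows "\<exists>C\<ge>0. \<forall>f\<in>poly_space k. \<forall>M. \<forall>x\<in>cball (0::'a::euclidean_space) 1.
    (\<forall>a. (\<Sum>b\<in>Basis. a b) \<le> k \<longrightarrow> \<bar>f (\<Sum>b\<in>Basis. (real (a b) / real k) *\<^sub>R b)\<bar> \<le> M) \<longrightarrow> \<bar>f x\<bar> \<le> C * M"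
proof -
  let ?I = "{\<alpha> \<in> (Basis :: 'a set) \<rightarrow>\<^sub>E {..k}. (\<Sum>b\<in>Basis. \<alpha> b) \<le> k}"
  let ?n = "\<lambda>a. \<Sum>b\<in>(Basis :: 'a set). (real (a b) / real k) *\<^sub>R b"
  let ?Q = "\<lambda>u v. \<Sum>a\<in>?I. (u (?n a) * v (?n a) :: real)"
  have "\<exists>C\<ge>0. \<forall>f\<in>poly_space k. \<forall>s\<in>cball (0::'a) 1. (f s)\<^sup>2 \<le> C * ?Q f f"
  proof (rule poly_functionals_bounded[where Q="?Q" and l="\<lambda>s f. f s"])
    show "\<exists>B. \<forall>s\<in>cball 0 1. \<bar>u s\<bar> \<le> B" if "u \<in> poly_space k" for u :: "'a \<Rightarrow> real"
      using compact_imp_bounded[OF compact_continuous_image[OF poly_space_continuous_on[OF that] compact_cball[of 0 1]]]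
      unfolding bounded_iff by auto
    fix s u assume su: "u \<in> poly_space k" "?Q u u = 0"
    then have z: "u (?n a) = 0" if "a \<in> ?I" for a
      using that sum_nonneg_eq_0_iff[OF finite_multi_indices, where f="\<lambda>a. u (?n a) * u (?n a)"] by auto
    define g where "g x = u (0 + (1 / real k) *\<^sub>R x)" for x
    have "g \<in> poly_space k"
      unfolding g_def[abs_def] by (rule poly_space_affine[OF su(1)]) (simp add: linear_scale_self)
    then have "g (real k *\<^sub>R s) = 0"
    proof (rule poly_space_lattice_unisolvent[OF finite_Basis order_refl])
      show "g x = g (\<Sum>b\<in>Basis. (x \<bullet> b) *\<^sub>R b)" for x by (simp only: euclidean_representation)
    show "g (\<Sum>b\<in>Basis. real (a b) *\<^sub>R b) = 0" if a: "(\<Sum>b\<in>Basis. a b) \<le> k" for a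
    proof -
      have "a b \<le> k" if "b \<in> Basis" for b
        using member_le_sum[OF that, of a] a by simp
      then have "restrict a Basis \<in> ?I" using a by auto
      from z[OF this] show ?thesis
        by (simp add: g_def scaleR_sum_right)
    qed
    qed
    then show "u s = 0" using k by (simp add: g_def)
  qed (auto simp: sum_distrib_left sum.distrib algebra_simps sum_nonneg)
  then obtain C where C: "C \<ge> 0" "\<And>f s. f \<in> poly_space k \<Longrightarrow> s \<in> cball (0::'a) 1 \<Longrightarrow> (f s)\<^sup>2 \<le> C * ?Q f f"
    by blast
  define D where "D = sqrt (C * card ?I)"
  have "\<bar>f x\<bar> \<le> D * M" if f: "f \<in> poly_space k" and x: "x \<in> cball 0 1"
    and M: "\<And>a. (\<Sum>b\<in>Basis. a b) \<le> k \<Longrightarrow> \<bar>f (?n a)\<bar> \<le> M" for f x M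
  proof -
    have "M \<ge> 0" using M[of "\<lambda>_. 0"] by simp
    have "?Q f f \<le> (\<Sum>a\<in>?I. M\<^sup>2)"
    proof (rule sum_mono)
      fix a assume "a \<in> ?I"
      then have "\<bar>f (?n a)\<bar> \<le> M" by (intro M) auto
      then show "f (?n a) * f (?n a) \<le> M\<^sup>2"
        using power_mono[of "\<bar>f (?n a)\<bar>" M 2] by (simp add: power2_eq_square)
    qed
    then have "C * ?Q f f \<le> C * (card ?I * M\<^sup>2)" using C(1) by (intro mult_left_mono) simp_all
    also have "\<dots> = (D * M)\<^sup>2" using C(1) by (simp add: D_def power_mult_distrib)
    finally have "(f x)\<^sup>2 \<le> (D * M)\<^sup>2" using C(2)[OF f x] by simp
    then have "\<bar>f x\<bar> \<le> \<bar>D * M\<bar>" by (simp only: abs_le_square_iff)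
    then show ?thesis using C(1) \<open>M \<ge> 0\<close> by (simp add: D_def abs_mult)
  qed
  moreover have "D \<ge> 0" using C(1) by (simp add: D_def)
  ultimately show ?thesis by (intro exI[of _ D]) blast
qed

section \<open>Simplices\<close>

abbreviation vertices :: "'a::euclidean_space set \<Rightarrow> 'a set" where
  "vertices T \<equiv> {v. v extreme_point_of T}"

lemma simplex_vertices:
  assumes "int DIM('a) simplex (T :: 'a::euclidean_space set)"
  shows "finite (vertices T)" "card (vertices T) = DIM('a) + 1" "\<not> affine_dependent (vertices T)"
    "T = convex hull (vertices T)"
proof -
  obtain V where V: "\<not> affine_dependent V" "int (card V) = int DIM('a) + 1" "T = convex hull V"
    using assms unfolding simplex_def by auto
  then have "vertices T = V" by (auto simp: extreme_point_of_convex_hull_affine_independent)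
  then show "finite (vertices T)" "card (vertices T) = DIM('a) + 1" "\<not> affine_dependent (vertices T)"
    "T = convex hull (vertices T)"
    using V aff_independent_finite by auto
qed

text \<open>The barycentric coordinate of the vertex \<open>v\<close>, taken as an affine function
  on the whole space rather than on \<open>T\<close>. It is determined by its values at the
  vertices.\<close>

definition bary :: "'a::euclidean_space set \<Rightarrow> 'a \<Rightarrow> 'a \<Rightarrow> real" where
  "bary T v = (SOME L. (\<exists>c g. L = (\<lambda>x. c + g \<bullet> x)) \<and> (\<forall>w. w extreme_point_of T \<longrightarrow> L w = (if w = v then 1 else 0)))"

lemma
  assumes T: "int DIM('a) simplex (T :: 'a::euclidean_space set)" and v: "v extreme_point_of T"
  shows bary_affine: "\<exists>c g. bary T v = (\<lambda>x. c + g \<bullet> x)"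
    and bary_vertex: "w extreme_point_of T \<Longrightarrow> bary T v w = (if w = v then 1 else 0)"
proof -
  let ?D = "(\<lambda>x. - v + x) ` (vertices T - {v})"
  \<comment> \<open>The edges leaving \<open>v\<close> are linearly independent, so some linear
    function equals -1 on all of them; normalised to 1 at \<open>v\<close> it becomes the
    coordinate.\<close>
  have "independent ?D"
    using affine_dependent_iff_dependent2[of v "vertices T"] simplex_vertices(3)[OF T] v by auto
  then obtain f where f: "linear f" "\<And>x. x \<in> ?D \<Longrightarrow> f x = (-1 :: real)"
    using linear_independent_extend[of ?D "\<lambda>_. -1"] by auto
  define g where "g = (\<Sum>b\<in>Basis. f b *\<^sub>R b)"
  have fg: "f x = g \<bullet> x" for x
  proof -
    have "f (\<Sum>b\<in>Basis. (x \<bullet> b) *\<^sub>R b) = (\<Sum>b\<in>Basis. (x \<bullet> b) * f b)"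
      using f(1) by (simp add: linear_sum linear_scale)
    also have "\<dots> = (\<Sum>b\<in>Basis. (f b *\<^sub>R b) \<bullet> x)"
      by (intro sum.cong refl) (simp add: inner_commute)
    also have "\<dots> = g \<bullet> x" by (simp add: g_def inner_sum_left)
    finally have "f (\<Sum>b\<in>Basis. (x \<bullet> b) *\<^sub>R b) = g \<bullet> x" .
    then show ?thesis by (simp add: euclidean_representation)
  qed
  have "(1 - g \<bullet> v) + g \<bullet> w = (if w = v then 1 else 0)" if "w extreme_point_of T" for w
    using f(2)[of "- v + w"] that by (auto simp: fg inner_diff_right image_iff algebra_simps inner_add_right)
  then have "\<exists>L. (\<exists>c g. L = (\<lambda>x. c + g \<bullet> x)) \<and> (\<forall>w. w extreme_point_of T \<longrightarrow> L w = (if w = v then 1 else 0))"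
    by (intro exI[of _ "\<lambda>x. (1 - g \<bullet> v) + g \<bullet> x"]) auto
  from someI_ex[OF this] show "\<exists>c g. bary T v = (\<lambda>x. c + g \<bullet> x)"
    "w extreme_point_of T \<Longrightarrow> bary T v w = (if w = v then 1 else 0)"
    unfolding bary_def by auto
qed

lemma affine_fun_convex_comb:
  fixes g :: "'a::euclidean_space"
  assumes "(\<Sum>v\<in>V. u v) = 1"
  shows "c + g \<bullet> (\<Sum>v\<in>V. u v *\<^sub>R v) = (\<Sum>v\<in>V. u v * (c + g \<bullet> v))"
  using assms by (simp add: distrib_left sum.distrib inner_sum_right sum_distrib_right[symmetric])

lemma bary_convex_comb:
  assumes T: "int DIM('a) simplex (T :: 'a::euclidean_space set)" and v: "v extreme_point_of T"
    and V: "V \<subseteq> vertices T" and u: "(\<Sum>w\<in>V. u w) = 1"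
  shows "bary T v (\<Sum>w\<in>V. u w *\<^sub>R w) = (if v \<in> V then u v else 0)"
proof -
  obtain c g where cg: "bary T v = (\<lambda>x. c + g \<bullet> x)" using bary_affine[OF T v] by blast
  have "finite V" using V simplex_vertices(1)[OF T] finite_subset by blast
  have "bary T v (\<Sum>w\<in>V. u w *\<^sub>R w) = (\<Sum>w\<in>V. u w * bary T v w)"
    unfolding cg by (rule affine_fun_convex_comb[OF u])
  also have "\<dots> = (\<Sum>w\<in>V. if w = v then u w else 0)"
    by (intro sum.cong refl) (use V bary_vertex[OF T v] in auto)
  finally show ?thesis using \<open>finite V\<close> by (simp add: sum.delta)
qed

lemma simplex_convex_comb:
  assumes T: "int DIM('a) simplex (T :: 'a::euclidean_space set)" and x: "x \<in> T"
  obtains u where "\<And>w. w \<in> vertices T \<Longrightarrow> 0 \<le> u w" "(\<Sum>w\<in>vertices T. u w) = 1"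
    "x = (\<Sum>w\<in>vertices T. u w *\<^sub>R w)"
proof -
  have "x \<in> convex hull (vertices T)" using x by (subst (asm) simplex_vertices(4)[OF T])
  then show ?thesis
    unfolding convex_hull_finite[OF simplex_vertices(1)[OF T]] using that by blast
qed

text \<open>The third claim is the pigeonhole principle for \<open>DIM('a) + 1\<close> numbers with
  sum 1. It later selects the vertex whose star contains the paths to the boundary.\<close>

lemma bary_bounds:
  assumes T: "int DIM('a) simplex (T :: 'a::euclidean_space set)" and x: "x \<in> T"
  shows "v extreme_point_of T \<Longrightarrow> 0 \<le> bary T v x" "v extreme_point_of T \<Longrightarrow> bary T v x \<le> 1"
    and "\<exists>v. v extreme_point_of T \<and> bary T v x \<ge> 1 / (DIM('a) + 1)"
proof -
  obtain u where u: "\<And>w. w \<in> vertices T \<Longrightarrow> 0 \<le> u w" "(\<Sum>w\<in>vertices T. u w) = 1"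
    "x = (\<Sum>w\<in>vertices T. u w *\<^sub>R w)"
    using simplex_convex_comb[OF T x] by blast
  have b: "bary T v x = u v" if "v extreme_point_of T" for v
    using bary_convex_comb[OF T that order_refl u(2)] that u(3) by simp
  show "v extreme_point_of T \<Longrightarrow> 0 \<le> bary T v x" using b u(1) by simp
  show "v extreme_point_of T \<Longrightarrow> bary T v x \<le> 1"
    using b member_le_sum[of v "vertices T" u] u simplex_vertices(1)[OF T] by auto
  show "\<exists>v. v extreme_point_of T \<and> bary T v x \<ge> 1 / (DIM('a) + 1)"
  proof (rule ccontr)
    assume "\<not> ?thesis"
    then have "\<And>v. v \<in> vertices T \<Longrightarrow> u v < 1 / (DIM('a) + 1)" using b by force
    then have "(\<Sum>w\<in>vertices T. u w) < (\<Sum>w\<in>vertices T. 1 / (real (DIM('a) + 1)))"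
      using simplex_vertices(1,2)[OF T] by (intro sum_strict_mono) (auto simp del: Collect_empty_eq)
    then show False using u(2) simplex_vertices(2)[OF T] by simp
  qed
qed

text \<open>Across a ball of radius \<open>r\<close> an affine function with gradient
  \<open>g\<close> varies by \<open>2 * r * norm g\<close>, whereas on \<open>T\<close> the
  coordinate varies by at most 1. The bound on \<open>g\<close> then serves arbitrary
  \<open>x\<close> and \<open>y\<close>.\<close>

lemma bary_lipschitz:
  assumes T: "int DIM('a) simplex (T :: 'a::euclidean_space set)" and v: "v extreme_point_of T"
    and c: "cball c r \<subseteq> T" and r: "r > 0"
  shows "\<bar>bary T v x - bary T v y\<bar> * (2 * r) \<le> norm (x - y)"
proof -
  obtain a g where ag: "bary T v = (\<lambda>x. a + g \<bullet> x)" using bary_affine[OF T v] by blast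
  have g1: "norm g * (2 * r) \<le> 1"
  proof (cases "g = 0")
    case False
    define e where "e = (r / norm g) *\<^sub>R g"
    have "norm e = r" using False r by (simp add: e_def)
    then have "c + e \<in> T" "c - e \<in> T" using c by (auto simp: dist_norm subset_iff)
    then have "(a + g \<bullet> (c + e)) - (a + g \<bullet> (c - e)) \<le> 1 - 0"
      using bary_bounds(1,2)[OF T _ v] unfolding ag by (intro diff_mono) auto
    then have "2 * (g \<bullet> e) \<le> 1" by (simp add: inner_add_right inner_diff_right)
    moreover have "g \<bullet> e = r * norm g" using False by (simp add: e_def power2_norm_eq_inner[symmetric] power2_eq_square)
    ultimately show ?thesis by (simp add: mult_ac)
  qed simp
  have "\<bar>bary T v x - bary T v y\<bar> \<le> norm g * norm (x - y)"
    unfolding ag using Cauchy_Schwarz_ineq2[of g "x - y"] by (simp add: inner_diff_right)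
  then have "\<bar>bary T v x - bary T v y\<bar> * (2 * r) \<le> (norm g * norm (x - y)) * (2 * r)"
    using r by (intro mult_right_mono) auto
  also have "\<dots> = (norm g * (2 * r)) * norm (x - y)" by simp
  also have "\<dots> \<le> 1 * norm (x - y)" by (rule mult_right_mono[OF g1]) simp
  finally show ?thesis by simp
qed

section \<open>Lagrange nodes of a simplex\<close>

lemma vertex_in_lagrange_nodes:
  assumes T: "int DIM('a) simplex (T :: 'a::euclidean_space set)" and k: "k \<ge> 1" and v: "v extreme_point_of T"
  shows "v \<in> lagrange_nodes k T"
proof -
  have "(\<Sum>w\<in>vertices T. (real (if w = v then k else 0) / real k) *\<^sub>R w) = (\<Sum>w\<in>vertices T. if w = v then w else 0)"
    using k by (intro sum.cong) auto
  also have "\<dots> = v" using v simplex_vertices(1)[OF T] by (simp add: sum.delta)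
  finally show ?thesis unfolding lagrange_nodes_def using v simplex_vertices(1)[OF T]
    by (auto intro!: exI[of _ "\<lambda>w. if w = v then k else 0"] simp: sum.delta)
qed

lemma lagrange_nodes_subset:
  assumes T: "int DIM('a) simplex (T :: 'a::euclidean_space set)" and k: "k \<ge> 1"
  shows "lagrange_nodes k T \<subseteq> T"
proof
  fix x assume "x \<in> lagrange_nodes k T"
  then obtain a :: "'a \<Rightarrow> nat" where a: "x = (\<Sum>w\<in>vertices T. (real (a w) / real k) *\<^sub>R w)" "(\<Sum>w\<in>vertices T. a w) = k"
    unfolding lagrange_nodes_def by auto
  have "(\<Sum>w\<in>vertices T. real (a w) / real k) = 1"
    using a(2) k by (simp add: sum_divide_distrib[symmetric] flip: of_nat_sum)
  then have "x \<in> convex hull (vertices T)"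
    unfolding a(1) convex_hull_finite[OF simplex_vertices(1)[OF T]]
    by (intro CollectI exI[of _ "\<lambda>w. real (a w) / real k"]) auto
  then show "x \<in> T" using simplex_vertices(4)[OF T] by simp
qed

lemma card_lagrange_nodes:
  assumes T: "int DIM('a) simplex (T :: 'a::euclidean_space set)"
  shows "finite (lagrange_nodes k T)" "card (lagrange_nodes k T) \<le> (k + 1) ^ (DIM('a) + 1)"
proof -
  let ?P = "vertices T \<rightarrow>\<^sub>E {..k}"
  have fin: "finite ?P" by (intro finite_PiE simplex_vertices(1)[OF T]) auto
  have sub: "lagrange_nodes k T \<subseteq> (\<lambda>a. \<Sum>v\<in>vertices T. (real (a v) / real k) *\<^sub>R v) ` ?P"
  proof
    fix x assume "x \<in> lagrange_nodes k T"
    then obtain a :: "'a \<Rightarrow> nat" where a: "x = (\<Sum>w\<in>vertices T. (real (a w) / real k) *\<^sub>R w)" "(\<Sum>w\<in>vertices T. a w) = k"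
      unfolding lagrange_nodes_def by auto
    have "a w \<le> k" if "w \<in> vertices T" for w
      using member_le_sum[OF that, of a] a(2) simplex_vertices(1)[OF T] by auto
    then have "restrict a (vertices T) \<in> ?P" by auto
    moreover have "x = (\<Sum>w\<in>vertices T. (real (restrict a (vertices T) w) / real k) *\<^sub>R w)"
      unfolding a(1) by (intro sum.cong) auto
    ultimately show "x \<in> (\<lambda>a. \<Sum>v\<in>vertices T. (real (a v) / real k) *\<^sub>R v) ` ?P" by blast
  qed
  show "finite (lagrange_nodes k T)" using sub fin finite_subset by blast
  have "card (lagrange_nodes k T) \<le> card ?P" using surj_card_le[OF fin sub] .
  also have "\<dots> = (k + 1) ^ (DIM('a) + 1)"
    using simplex_vertices(1,2)[OF T] by (simp add: card_PiE)
  finally show "card (lagrange_nodes k T) \<le> (k + 1) ^ (DIM('a) + 1)" .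
qed

text \<open>The affine map from the reference simplex carries lattice nodes to the Lagrange nodes of
  \<open>T\<close>, so the constant does not depend on the shape of \<open>T\<close>. With
  \<open>M = 0\<close> the estimate is unisolvence on \<open>T\<close>.\<close>

lemma lagrange_nodes_bound:
  assumes k: "k \<ge> 1"
  shows "\<exists>C\<ge>0. \<forall>f\<in>poly_space k. \<forall>T::'a::euclidean_space set. \<forall>M. int DIM('a) simplex T \<longrightarrow>
    (\<forall>\<eta>\<in>lagrange_nodes k T. \<bar>f \<eta>\<bar> \<le> M) \<longrightarrow> (\<forall>x\<in>T. \<bar>f x\<bar> \<le> C * M)"
proof -
  obtain C where C: "C \<ge> 0" "\<And>f M x. f \<in> poly_space k \<Longrightarrow> x \<in> cball (0::'a) 1 \<Longrightarrow>
    (\<And>a. (\<Sum>b\<in>Basis. a b) \<le> k \<Longrightarrow> \<bar>f (\<Sum>b\<in>Basis. (real (a b) / real k) *\<^sub>R b)\<bar> \<le> M) \<Longrightarrow> \<bar>f x\<bar> \<le> C * M"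
    using poly_reference_simplex_bound[OF k, where 'a='a] by blast
  have "\<bar>f x\<bar> \<le> C * M" if f: "f \<in> poly_space k" and T: "int DIM('a) simplex (T :: 'a set)" and x: "x \<in> T"
    and M: "\<And>\<eta>. \<eta> \<in> lagrange_nodes k T \<Longrightarrow> \<bar>f \<eta>\<bar> \<le> M" for f T M x
  proof -
    have fV: "finite (vertices T)" "card (vertices T) = DIM('a) + 1" by (rule simplex_vertices[OF T])+
    then obtain v where v: "v \<in> vertices T" by (metis card.empty all_not_in_conv add_is_0 zero_neq_one)
    have "card (Basis :: 'a set) = card (vertices T - {v})" using fV v by simp
    then obtain s where s: "bij_betw s (Basis :: 'a set) (vertices T - {v})"
      using finite_same_card_bij[of Basis "vertices T - {v}"] fV by auto
    define t where "t = inv_into Basis s"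
    have ts: "t (s b) = b" if "b \<in> Basis" for b
      unfolding t_def using s that by (auto simp: bij_betw_def)
    have sv: "s b \<noteq> v" "s b \<in> vertices T" if "b \<in> Basis" for b
      using s that bij_betwE by blast+
    have sumV: "(\<Sum>w\<in>vertices T. h w) = h v + (\<Sum>b\<in>Basis. h (s b))" for h :: "'a \<Rightarrow> 'c::comm_monoid_add"
      using sum.remove[OF fV(1) v, of h] sum.reindex_bij_betw[OF s, of h] by simp
    define A where "A y = v + (\<Sum>b\<in>Basis. (y \<bullet> b) *\<^sub>R (s b - v))" for y
    have "linear (\<lambda>y. \<Sum>b\<in>Basis. (y \<bullet> b) *\<^sub>R (s b - v))"
      by (auto intro!: linearI simp: inner_add_left sum.distrib scaleR_sum_right scaleR_add_left)
    then have g: "(\<lambda>y. f (A y)) \<in> poly_space k"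
      unfolding A_def by (rule poly_space_affine[OF f])
    have AV: "A (\<Sum>b\<in>Basis. r b *\<^sub>R b) = (1 - (\<Sum>b\<in>Basis. r b)) *\<^sub>R v + (\<Sum>b\<in>Basis. r b *\<^sub>R s b)" for r
      unfolding A_def by (simp add: scaleR_diff_right sum_subtractf scaleR_sum_left[symmetric] scaleR_diff_left)
    obtain u where u: "\<And>w. w \<in> vertices T \<Longrightarrow> 0 \<le> u w" "(\<Sum>w\<in>vertices T. u w) = 1"
      "x = (\<Sum>w\<in>vertices T. u w *\<^sub>R w)"
      using simplex_convex_comb[OF T x] by blast
    define y where "y = (\<Sum>b\<in>Basis. u (s b) *\<^sub>R b)"
    have "A y = x"
      unfolding y_def AV u(3) sumV using u(2) sumV[of u] by simp
    moreover have "y \<in> cball 0 1"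
    proof -
      have "norm y \<le> (\<Sum>b\<in>Basis. norm (u (s b) *\<^sub>R b))" unfolding y_def by (rule norm_sum)
      also have "\<dots> = (\<Sum>b\<in>Basis. u (s b))" by (intro sum.cong refl) (use u(1) sv in auto)
      also have "\<dots> \<le> 1" using u(2) sumV[of u] u(1)[OF v] by simp
      finally show ?thesis by simp
    qed
    moreover have "\<bar>f (A (\<Sum>b\<in>Basis. (real (a b) / real k) *\<^sub>R b))\<bar> \<le> M" if a: "(\<Sum>b\<in>Basis. a b) \<le> k" for a
    proof (rule M)
      \<comment> \<open>The vertex \<open>v\<close>, the image of the origin, receives the weight
        left over, so that the coefficients add up to \<open>k\<close>.\<close>
      define a' where "a' w = (if w = v then k - (\<Sum>b\<in>Basis. a b) else a (t w))" for w
      have a': "a' v = k - (\<Sum>b\<in>Basis. a b)" "\<And>b. b \<in> Basis \<Longrightarrow> a' (s b) = a b"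
        using ts sv by (auto simp: a'_def)
      have "(\<Sum>w\<in>vertices T. a' w) = k" unfolding sumV using a' a by simp
      moreover have "A (\<Sum>b\<in>Basis. (real (a b) / real k) *\<^sub>R b) = (\<Sum>w\<in>vertices T. (real (a' w) / real k) *\<^sub>R w)"
      proof -
        have "real (a' v) / real k = 1 - (\<Sum>b\<in>Basis. real (a b) / real k)"
          using a k by (simp add: a'(1) of_nat_diff sum_divide_distrib[symmetric] field_simps)
        then show ?thesis unfolding AV sumV using a'(2) by simp
      qed
      ultimately show "A (\<Sum>b\<in>Basis. (real (a b) / real k) *\<^sub>R b) \<in> lagrange_nodes k T"
        unfolding lagrange_nodes_def by blast
    qed
    ultimately show ?thesis using C(2)[OF g, of y M] by simp
  qed
  then show ?thesis using C(1) by (intro exI[of _ C]) blast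
qed

text \<open>Comparison of volumes. It bounds both the number of elements at a vertex and the number
  of separated points on the boundary.\<close>

lemma disjoint_balls_card:
  fixes c :: "'i \<Rightarrow> 'a::euclidean_space"
  assumes I: "finite I" and r: "r \<ge> 0"
    and sub: "\<And>i. i \<in> I \<Longrightarrow> ball (c i) r \<subseteq> ball z R"
    and dis: "\<And>i j. i \<in> I \<Longrightarrow> j \<in> I \<Longrightarrow> i \<noteq> j \<Longrightarrow> ball (c i) r \<inter> ball (c j) r = {}"
    and R: "R \<ge> 0"
  shows "real (card I) * r ^ DIM('a) \<le> R ^ DIM('a)"
proof -
  define m where "m = measure lborel (ball (0::'a) 1)"
  have m: "m > 0" using content_ball_pos[of 1 "0::'a"] by (simp add: m_def)
  have fin: "emeasure lborel (ball (x::'a) s) \<noteq> top" for x s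
    using emeasure_lborel_ball_finite[of x s] by simp
  have ball: "measure lborel (ball (x::'a) s) = s ^ DIM('a) * m" if "s \<ge> 0" for x s
    using content_ball_conv_unit_ball[OF that, of x] by (simp add: m_def)
  have "(\<Sum>i\<in>I. measure lebesgue (ball (c i) r)) = measure lebesgue (\<Union>i\<in>I. ball (c i) r)"
    using I dis fin by (subst measure_finite_Union) (auto simp: disjoint_family_on_def)
  also have "\<dots> \<le> measure lebesgue (ball z R)"
    by (rule measure_mono_fmeasurable) (use sub in \<open>auto simp: I\<close>)
  finally have "real (card I) * r ^ DIM('a) * m \<le> R ^ DIM('a) * m"
    using r R by (simp add: ball mult.assoc)
  then show ?thesis using m by simp
qed

section \<open>Hausdorff measure\<close>

text \<open>\<open>measure_of\<close> yields the null measure if its set function is not a measure,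
  so the value is recorded for both cases.\<close>

lemma emeasure_hausdorff_measure:
  fixes S :: "'a::euclidean_space set"
  assumes "S \<in> sets borel"
  shows "S \<in> sets (hausdorff_measure n)"
    and "measure_space UNIV (sets borel) (hausdorff_outer n :: 'a set \<Rightarrow> ennreal) \<Longrightarrow>
      emeasure (hausdorff_measure n) S = hausdorff_outer n S"
    and "\<not> measure_space UNIV (sets borel) (hausdorff_outer n :: 'a set \<Rightarrow> ennreal) \<Longrightarrow>
      emeasure (hausdorff_measure n) S = 0"
proof -
  let ?M = "measure_of UNIV (sets borel) (hausdorff_outer n) :: 'a measure"
  have sig: "sigma_sets UNIV (sets borel) = (sets borel :: 'a set set)"
    using sets.sigma_sets_eq[of "borel :: 'a measure"] by simp
  have S: "S \<in> sets ?M" using assms by (simp add: sig)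
  then show "S \<in> sets (hausdorff_measure n)" by (simp add: hausdorff_measure_def)
  have e: "emeasure (hausdorff_measure n) S = emeasure ?M S"
    using S by (simp add: hausdorff_measure_def)
  show "measure_space UNIV (sets borel) (hausdorff_outer n :: 'a set \<Rightarrow> ennreal) \<Longrightarrow>
      emeasure (hausdorff_measure n) S = hausdorff_outer n S"
    unfolding e emeasure_measure_of_conv sig using assms by simp
  show "\<not> measure_space UNIV (sets borel) (hausdorff_outer n :: 'a set \<Rightarrow> ennreal) \<Longrightarrow>
      emeasure (hausdorff_measure n) S = 0"
    unfolding e emeasure_measure_of_conv sig by simp
qed

lemma emeasure_ball_unit:
  "s \<ge> 0 \<Longrightarrow> emeasure lebesgue (ball (x::'a::euclidean_space) s) = ennreal (s ^ DIM('a) * measure lborel (ball (0::'a) 1))"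
  using emeasure_lborel_ball_finite[of x s] content_ball_conv_unit_ball[of s x]
  by (simp add: emeasure_eq_ennreal_measure less_top)

text \<open>Surface measure is compared with volume, in both directions, by sweeping sets along a fixed
  direction \<open>\<nu>\<close>. This needs no rotation and no Lebesgue measure on hyperplanes.\<close>

lemma emeasure_thickened_le:
  fixes A :: "'a::euclidean_space set"
  assumes A: "bounded A" "diameter A < t" and \<nu>: "norm \<nu> = 1"
  shows "emeasure lebesgue {p + s *\<^sub>R \<nu> | p s. p \<in> closure A \<and> s \<in> {-t..t}}
     \<le> ennreal (6 * t * 2 ^ DIM('a) * measure lborel (ball (0::'a) 1) * diameter A ^ (DIM('a) - 1))"
    (is "emeasure lebesgue ?K \<le> _")
proof (cases "A = {}")
  case True then show ?thesis by simp
next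
  case False
  then obtain c where c: "c \<in> A" by blast
  define \<omega> where "\<omega> = measure lborel (ball (0::'a) 1)"
  have \<omega>: "\<omega> \<ge> 0" by (simp add: \<omega>_def)
  have d0: "diameter A \<ge> 0" using A(1) by (rule diameter_ge_0)
  have n: "DIM('a) = Suc (DIM('a) - 1)" using DIM_positive[where 'a='a] by simp
  \<comment> \<open>A radius \<open>\<delta>\<close> above the diameter keeps the covering balls
    nondegenerate when \<open>A\<close> is a single point; it tends to the diameter at the
    end.\<close>
  have bound: "emeasure lebesgue ?K \<le> ennreal (6 * t * 2 ^ DIM('a) * \<omega> * \<delta> ^ (DIM('a) - 1))"
    if \<delta>: "diameter A < \<delta>" "\<delta> \<le> t" for \<delta>
  proof -
    have \<delta>0: "\<delta> > 0" using d0 \<delta> by simp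
    \<comment> \<open>Number of layers of thickness \<open>\<delta>\<close> on either side. As
      \<open>m\<close> is at least 1, the count \<open>2 * m + 1\<close> is at most
      \<open>3 * m\<close>, which gives the 6.\<close>
    define m where "m = \<lceil>t / \<delta>\<rceil>"
    have m: "1 \<le> m" "real_of_int m \<le> 2 * t / \<delta>"
    proof -
      have "1 \<le> t / \<delta>" using \<delta> \<delta>0 by simp
      then show "1 \<le> m" "real_of_int m \<le> 2 * t / \<delta>" unfolding m_def by linarith+
    qed
    let ?B = "\<lambda>j::int. ball (c + (of_int j * \<delta>) *\<^sub>R \<nu>) (2 * \<delta>)"
    have eb: "emeasure lebesgue (ball (x::'a) (2 * \<delta>)) = ennreal ((2 * \<delta>) ^ DIM('a) * \<omega>)" for x
      unfolding \<omega>_def by (rule emeasure_ball_unit) (use \<delta>0 in simp)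
    have "?K \<subseteq> (\<Union>j\<in>{-m..m}. ?B j)"
    proof
      fix y assume "y \<in> ?K"
      then obtain p s where y: "y = p + s *\<^sub>R \<nu>" "p \<in> closure A" "s \<in> {-t..t}" by auto
      define j where "j = \<lfloor>s / \<delta>\<rfloor>"
      have j1: "of_int j * \<delta> \<le> s" "s < (of_int j + 1) * \<delta>"
        using \<delta>0 by (simp_all add: j_def pos_le_divide_eq[symmetric] pos_divide_less_eq[symmetric])
      have "- (t / \<delta>) \<le> s / \<delta>" "s / \<delta> \<le> t / \<delta>" using y(3) \<delta>0 by (auto simp: divide_simps)
      then have j2: "j \<in> {-m..m}" unfolding j_def m_def by (auto simp: le_floor_iff) linarith+
      have "dist p c \<le> diameter A"
        using diameter_bounded_bound[of "closure A" p c] A(1) y(2) c closure_subset by (auto simp: diameter_closure)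
      moreover have "norm ((s - of_int j * \<delta>) *\<^sub>R \<nu>) \<le> \<delta>"
        unfolding norm_scaleR \<nu> using j1 by (simp add: algebra_simps)
      moreover have e: "y - (c + (of_int j * \<delta>) *\<^sub>R \<nu>) = (p - c) + (s - of_int j * \<delta>) *\<^sub>R \<nu>"
        by (simp add: y algebra_simps)
      ultimately have "norm (y - (c + (of_int j * \<delta>) *\<^sub>R \<nu>)) < 2 * \<delta>"
        using norm_triangle_ineq[of "p - c" "(s - of_int j * \<delta>) *\<^sub>R \<nu>"] \<delta> unfolding e dist_norm by linarith
      then have "y \<in> ?B j" by (simp add: dist_norm norm_minus_commute)
      then show "y \<in> (\<Union>j\<in>{-m..m}. ?B j)" using j2 by blast
    qed
    then have "emeasure lebesgue ?K \<le> emeasure lebesgue (\<Union>j\<in>{-m..m}. ?B j)"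
      by (rule emeasure_mono) (auto intro!: sets.finite_UN)
    also have "\<dots> \<le> (\<Sum>j\<in>{-m..m}. emeasure lebesgue (?B j))"
      by (rule emeasure_subadditive_finite) auto
    also have "\<dots> = (\<Sum>j\<in>{-m..m}. ennreal ((2 * \<delta>) ^ DIM('a) * \<omega>))"
      by (simp only: eb)
    also have "\<dots> = ennreal ((2 * of_int m + 1) * ((2 * \<delta>) ^ DIM('a) * \<omega>))"
      using m(1) \<delta>0 \<omega> by (subst sum_ennreal) (auto simp: of_nat_nat)
    also have "\<dots> \<le> ennreal (6 * t * 2 ^ DIM('a) * \<omega> * \<delta> ^ (DIM('a) - 1))"
    proof (rule ennreal_leI)
      have P: "(2 * \<delta>) ^ DIM('a) = 2 ^ DIM('a) * (\<delta> * \<delta> ^ (DIM('a) - 1))"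
        using n by (metis power_Suc power_mult_distrib)
      have "2 * of_int m + 1 \<le> 6 * t / \<delta>" using m by simp
      then have "(2 * of_int m + 1) * ((2 * \<delta>) ^ DIM('a) * \<omega>) \<le> 6 * t / \<delta> * ((2 * \<delta>) ^ DIM('a) * \<omega>)"
        using \<omega> \<delta>0 by (intro mult_right_mono) auto
      also have "\<dots> = 6 * t * 2 ^ DIM('a) * \<omega> * \<delta> ^ (DIM('a) - 1)"
        unfolding P using \<delta>0 by simp
      finally show "(2 * of_int m + 1) * ((2 * \<delta>) ^ DIM('a) * \<omega>) \<le> \<dots>" .
    qed
    finally show ?thesis .
  qed
  have "\<forall>\<^sub>F \<delta> in at_right (diameter A). emeasure lebesgue ?K \<le> ennreal (6 * t * 2 ^ DIM('a) * \<omega> * \<delta> ^ (DIM('a) - 1))"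
    unfolding eventually_at_right_field using A(2) bound by (intro exI[of _ t]) auto
  moreover have "((\<lambda>\<delta>. ennreal (6 * t * 2 ^ DIM('a) * \<omega> * \<delta> ^ (DIM('a) - 1))) \<longlongrightarrow>
      ennreal (6 * t * 2 ^ DIM('a) * \<omega> * diameter A ^ (DIM('a) - 1))) (at_right (diameter A))"
    by (intro tendsto_ennrealI tendsto_intros)
  ultimately show ?thesis unfolding \<omega>_def by (intro tendsto_lowerbound) auto
qed

text \<open>Sweeping a cover of \<open>S\<close> along \<open>\<nu>\<close> covers the ball. A
  covering set of diameter \<open>a\<close> sweeps out a volume of order
  \<open>t * a ^ (DIM('a) - 1)\<close>, so up to a constant no Hausdorff sum is smaller than the
  volume of the ball divided by \<open>t\<close>.\<close>

lemma hausdorff_outer_ge_shadow: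
  assumes "2 \<le> DIM('a::euclidean_space)"
  shows "\<exists>c>0. \<forall>S (x::'a) \<rho> t \<nu>. 0 < \<rho> \<longrightarrow> 0 < t \<longrightarrow> norm \<nu> = 1 \<longrightarrow>
    (\<forall>y\<in>ball x \<rho>. \<exists>p\<in>S. \<exists>s\<in>{-t..t}. y = p + s *\<^sub>R \<nu>) \<longrightarrow>
    ennreal (c * \<rho> ^ DIM('a) / t) \<le> hausdorff_outer (DIM('a) - 1) S"
proof -
  define \<omega> where "\<omega> = measure lborel (ball (0::'a) 1)"
  have \<omega>: "\<omega> > 0" using content_ball_pos[of 1 "0::'a"] by (simp add: \<omega>_def)
  define w where "w = unit_ball_vol (real (DIM('a) - 1))"
  have w: "w > 0" by (simp add: w_def)
  \<comment> \<open>Quotient of the swept volume, per unit of \<open>t\<close>, and the Hausdorff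
    weight of one covering set.\<close>
  define K where "K = 6 * 2 ^ DIM('a) * \<omega> * 2 ^ (DIM('a) - 1) / w"
  have K: "K > 0" using \<omega> w by (simp add: K_def)
  have "ennreal (\<omega> / K * \<rho> ^ DIM('a) / t) \<le> hausdorff_outer (DIM('a) - 1) S"
    if \<rho>: "0 < \<rho>" and t: "0 < t" and \<nu>: "norm \<nu> = 1"
      and cov: "\<And>y. y \<in> ball x \<rho> \<Longrightarrow> \<exists>p\<in>S. \<exists>s\<in>{-t..t}. y = p + s *\<^sub>R \<nu>" for S and x :: 'a and \<rho> t \<nu>
  proof -
    \<comment> \<open>The outer measure is a supremum over scales, so one scale is enough;
      \<open>t / 2\<close> makes the diameters strictly smaller than \<open>t\<close>.\<close>
    have "ennreal (\<omega> / K * \<rho> ^ DIM('a) / t) \<le> hausdorff_pre (DIM('a) - 1) (t / 2) S"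
      unfolding hausdorff_pre_def w_def[symmetric]
    proof (rule INF_greatest)
      fix C :: "nat \<Rightarrow> 'a set"
      assume "C \<in> {C. S \<subseteq> (\<Union>i. C i) \<and> (\<forall>i. bounded (C i) \<and> diameter (C i) \<le> t / 2)}"
      then have C: "S \<subseteq> (\<Union>i. C i)" "\<And>i. bounded (C i)" "\<And>i. diameter (C i) \<le> t / 2" by auto
      let ?K = "\<lambda>i. {p + s *\<^sub>R \<nu> | p s. p \<in> closure (C i) \<and> s \<in> {-t..t}}"
      let ?T = "\<lambda>i. w * (diameter (C i) / 2) ^ (DIM('a) - 1)"
      have cK: "?K i \<in> sets lebesgue" for i
      proof -
        have "?K i = {x + y | x y. x \<in> closure (C i) \<and> y \<in> (\<lambda>s. s *\<^sub>R \<nu>) ` {-t..t}}" by blast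
        moreover have "compact \<dots>"
          by (intro compact_sums compact_continuous_image continuous_intros) (auto simp: C(2))
        ultimately show ?thesis by (simp add: fmeasurableD lmeasurable_compact)
      qed
      have "ennreal (\<omega> * \<rho> ^ DIM('a)) = emeasure lebesgue (ball x \<rho>)"
        using emeasure_ball_unit[of \<rho> x] \<rho> by (simp add: \<omega>_def mult.commute)
      also have "\<dots> \<le> emeasure lebesgue (\<Union>i. ?K i)"
      proof (rule emeasure_mono)
        show "ball x \<rho> \<subseteq> (\<Union>i. ?K i)"
        proof
          fix y assume "y \<in> ball x \<rho>"
          then obtain p s where ps: "p \<in> S" "s \<in> {-t..t}" "y = p + s *\<^sub>R \<nu>" using cov by blast
          then obtain i where "p \<in> C i" using C(1) by blast
          then have "p \<in> closure (C i)" using closure_subset by blast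
          then show "y \<in> (\<Union>i. ?K i)" using ps by blast
        qed
        show "(\<Union>i. ?K i) \<in> sets lebesgue" using cK by blast
      qed
      also have "\<dots> \<le> (\<Sum>i. emeasure lebesgue (?K i))"
        by (rule emeasure_subadditive_countably) (use cK in auto)
      also have "\<dots> \<le> (\<Sum>i. ennreal (K * t) * ennreal (?T i))"
      proof (rule suminf_le)
        fix i
        have "emeasure lebesgue (?K i) \<le> ennreal (6 * t * 2 ^ DIM('a) * \<omega> * diameter (C i) ^ (DIM('a) - 1))"
          unfolding \<omega>_def by (rule emeasure_thickened_le[OF C(2) _ \<nu>]) (use C(3)[of i] t in linarith)
        also have "6 * t * 2 ^ DIM('a) * \<omega> * diameter (C i) ^ (DIM('a) - 1) = (K * t) * ?T i"
          using w by (simp add: K_def power_divide)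
        also have "ennreal \<dots> = ennreal (K * t) * ennreal (?T i)"
          using K t w diameter_ge_0[OF C(2)[of i]] by (intro ennreal_mult) auto
        finally show "emeasure lebesgue (?K i) \<le> ennreal (K * t) * ennreal (?T i)" .
      qed auto
      also have "\<dots> = ennreal (K * t) * (\<Sum>i. ennreal (?T i))" by (rule ennreal_suminf_cmult)
      finally have *: "ennreal (\<omega> * \<rho> ^ DIM('a)) \<le> ennreal (K * t) * (\<Sum>i. ennreal (?T i))" .
      show "ennreal (\<omega> / K * \<rho> ^ DIM('a) / t) \<le> (\<Sum>i. ennreal (?T i))"
      proof (cases "\<Sum>i. ennreal (?T i)")
        case (real s)
        then have "\<omega> * \<rho> ^ DIM('a) \<le> K * t * s"
          using * K t by (simp add: ennreal_mult[symmetric])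
        then have "\<omega> / K * \<rho> ^ DIM('a) / t \<le> s" using K t by (simp add: field_simps)
        then show ?thesis using real by (simp add: ennreal_leI)
      qed simp
    qed
    also have "\<dots> \<le> hausdorff_outer (DIM('a) - 1) S"
      unfolding hausdorff_outer_def by (rule SUP_upper) (use t in auto)
    finally show ?thesis .
  qed
  moreover have "\<omega> / K > 0" using \<omega> K by simp
  ultimately show ?thesis by (intro exI[of _ "\<omega> / K"]) blast
qed

text \<open>Over each point a stack of about \<open>h / \<delta>\<close> balls of radius proportional to \<open>\<delta>\<close> is placed in direction
  \<open>\<nu>\<close>; comparing volumes then gives the exponent \<open>DIM('a) - 1\<close>.\<close>

lemma separated_points_card:
  fixes P :: "'a::euclidean_space set"
  assumes P: "finite P" "P \<subseteq> ball z h" and \<nu>: "norm \<nu> = 1" and \<kappa>: "0 \<le> \<kappa>" "\<kappa> < 1" and \<delta>: "0 < \<delta>" "\<delta> \<le> h"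
    and cone: "\<And>p q. p \<in> P \<Longrightarrow> q \<in> P \<Longrightarrow> \<bar>(p - q) \<bullet> \<nu>\<bar> \<le> \<kappa> * norm (p - q)"
    and sep: "\<And>p q. p \<in> P \<Longrightarrow> q \<in> P \<Longrightarrow> p \<noteq> q \<Longrightarrow> \<delta> \<le> norm (p - q)"
  shows "real (card P) * \<delta> ^ (DIM('a) - 1) \<le> 4 * 3 ^ DIM('a) * (2 / (1 - \<kappa>)) ^ (DIM('a) - 1) * h ^ (DIM('a) - 1)"
proof -
  \<comment> \<open>By the cone condition, the projections along \<open>\<nu>\<close> of points at
    least \<open>\<delta>\<close> apart are at least
    \<open>(1 - \<kappa>) * \<delta> = 2 * r\<close> apart, so balls of radius \<open>r\<close> in
    different stacks are disjoint.\<close>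
  define r where "r = (1 - \<kappa>) * \<delta> / 2"
  have r: "0 < r" "2 * r \<le> \<delta>" using \<kappa> \<delta> by (auto simp: r_def algebra_simps)
  have h: "h > 0" using \<delta> by simp
  define m where "m = nat \<lfloor>h / (2 * r)\<rfloor>"
  have q1: "1 \<le> h / (2 * r)" using r \<delta> by simp
  have m: "h / (4 * r) \<le> real m" "real m \<le> h / (2 * r)"
  proof -
    have "real m = of_int \<lfloor>h / (2 * r)\<rfloor>" using q1 by (simp add: m_def)
    moreover have "h / (4 * r) = (h / (2 * r)) / 2" by simp
    moreover have "1 \<le> \<lfloor>h / (2 * r)\<rfloor>" using q1 by simp
    ultimately have "h / (4 * r) \<le> real m \<and> real m \<le> h / (2 * r)" by linarith
    then show "h / (4 * r) \<le> real m" "real m \<le> h / (2 * r)" by blast+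
  qed
  define \<pi> where "\<pi> p = p - (p \<bullet> \<nu>) *\<^sub>R \<nu>" for p
  have \<nu>\<nu>: "\<nu> \<bullet> \<nu> = 1" using \<nu> by (simp add: norm_eq_1)
  have \<pi>_diff: "\<pi> p - \<pi> q = (p - q) - ((p - q) \<bullet> \<nu>) *\<^sub>R \<nu>" for p q by (simp add: \<pi>_def inner_diff_left algebra_simps)
  have orth: "norm u \<le> norm (u + s *\<^sub>R \<nu>)" "\<bar>s\<bar> \<le> norm (u + s *\<^sub>R \<nu>)" if "u \<bullet> \<nu> = 0" for u s
  proof -
    have e: "(norm (u + s *\<^sub>R \<nu>))\<^sup>2 = (norm u)\<^sup>2 + s\<^sup>2"
      using that \<nu>\<nu> unfolding power2_norm_eq_inner
      by (simp add: inner_add_left inner_add_right inner_commute power2_eq_square)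
    show "norm u \<le> norm (u + s *\<^sub>R \<nu>)" by (rule power2_le_imp_le) (auto simp: e)
    show "\<bar>s\<bar> \<le> norm (u + s *\<^sub>R \<nu>)" by (rule power2_le_imp_le) (auto simp: e)
  qed
  have \<pi>\<nu>: "(\<pi> p - \<pi> q) \<bullet> \<nu> = 0" for p q by (simp add: \<pi>_diff inner_diff_left \<nu>\<nu>)
  \<comment> \<open>All stacks start on the hyperplane through \<open>z\<close> orthogonal to
    \<open>\<nu>\<close>, whatever the height of \<open>p\<close>.\<close>
  define c where "c = (\<lambda>(p, j::nat). \<pi> p + (z \<bullet> \<nu>) *\<^sub>R \<nu> + (2 * r * real j) *\<^sub>R \<nu>)"
  have cdiff: "c (p, i) - c (q, j) = (\<pi> p - \<pi> q) + (2 * r * (real i - real j)) *\<^sub>R \<nu>" for p q i j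
    by (simp add: c_def algebra_simps)
  have far: "2 * r \<le> norm (c x - c y)" if xy: "x \<in> P \<times> {..<m}" "y \<in> P \<times> {..<m}" "x \<noteq> y" for x y
  proof -
    obtain p i q j where x: "x = (p, i)" "y = (q, j)" by (cases x, cases y)
    show ?thesis
    proof (cases "p = q")
      case True
      then have "\<bar>real i - real j\<bar> \<ge> 1" using xy x by auto
      then have "2 * r * 1 \<le> 2 * r * \<bar>real i - real j\<bar>" using r by (intro mult_left_mono) auto
      also have "\<dots> = \<bar>2 * r * (real i - real j)\<bar>" using r by (simp add: abs_mult)
      also have "\<dots> \<le> norm (c x - c y)" unfolding x cdiff by (rule orth(2)[OF \<pi>\<nu>])
      finally show ?thesis by simp
    next
      case False
      have pq: "p \<in> P" "q \<in> P" using xy x by auto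
      have "2 * r = (1 - \<kappa>) * \<delta>" by (simp add: r_def)
      also have "\<dots> \<le> (1 - \<kappa>) * norm (p - q)" using sep[OF pq False] \<kappa> by (intro mult_left_mono) auto
      also have "\<dots> \<le> norm (p - q) - norm (((p - q) \<bullet> \<nu>) *\<^sub>R \<nu>)"
        unfolding norm_scaleR \<nu> using cone[OF pq] by (simp add: algebra_simps)
      also have "\<dots> \<le> norm (\<pi> p - \<pi> q)" unfolding \<pi>_diff by (rule norm_triangle_ineq2)
      also have "\<dots> \<le> norm (c x - c y)" unfolding x cdiff by (rule orth(1)[OF \<pi>\<nu>])
      finally show ?thesis .
    qed
  qed
  have "real (card (P \<times> {..<m})) * r ^ DIM('a) \<le> (3 * h) ^ DIM('a)"
  proof (rule disjoint_balls_card)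
    show "ball (c x) r \<inter> ball (c y) r = {}" if "x \<in> P \<times> {..<m}" "y \<in> P \<times> {..<m}" "x \<noteq> y" for x y
      by (rule disjoint_ballI) (use far[OF that] in \<open>simp add: dist_norm\<close>)
    show "ball (c x) r \<subseteq> ball z (3 * h)" if x: "x \<in> P \<times> {..<m}" for x
    proof -
      obtain p i where xp: "x = (p, i)" "p \<in> P" "i < m" using x by auto
      have "norm (\<pi> p - \<pi> z) \<le> norm (p - z)"
        using orth(1)[OF \<pi>\<nu>, of p z "(p - z) \<bullet> \<nu>"] by (simp add: \<pi>_diff)
      moreover have "norm (p - z) < h" using P(2) xp(2) by (auto simp: dist_norm norm_minus_commute)
      moreover have "norm ((2 * r * real i) *\<^sub>R \<nu>) \<le> h"
      proof -
        have "real i \<le> h / (2 * r)" using m(2) xp(3) by linarith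
        then show ?thesis using r \<nu> by (simp add: field_simps)
      qed
      moreover have "c x - z = (\<pi> p - \<pi> z) + (2 * r * real i) *\<^sub>R \<nu>"
        by (simp add: xp c_def \<pi>_def)
      ultimately have "norm (c x - z) < 2 * h"
        using norm_triangle_ineq[of "\<pi> p - \<pi> z" "(2 * r * real i) *\<^sub>R \<nu>"] by simp
      then have "dist (c x) z + r \<le> 3 * h" using r \<delta> by (simp add: dist_norm)
      then show ?thesis by (simp add: ball_subset_ball_iff dist_commute)
    qed
  qed (use P r h in auto)
  then have 1: "real (card P) * real m * r ^ DIM('a) \<le> (3 * h) ^ DIM('a)"
    by (simp add: card_cartesian_product)
  have n: "DIM('a) = Suc (DIM('a) - 1)" using DIM_positive[where 'a='a] by simp
  have "real (card P) * (h / (4 * r)) * r ^ DIM('a) \<le> real (card P) * real m * r ^ DIM('a)"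
    using m(1) r by (intro mult_right_mono mult_left_mono) auto
  with 1 have "real (card P) * (h / (4 * r)) * r ^ DIM('a) \<le> (3 * h) ^ DIM('a)" by simp
  then have "real (card P) * (h / (4 * r)) * (r * r ^ (DIM('a) - 1)) \<le> 3 ^ DIM('a) * (h * h ^ (DIM('a) - 1))"
    using n by (metis power_Suc power_mult_distrib)
  then have "h * (real (card P) * r ^ (DIM('a) - 1)) \<le> h * (4 * 3 ^ DIM('a) * h ^ (DIM('a) - 1))"
    using r by (simp add: field_simps)
  then have 2: "real (card P) * r ^ (DIM('a) - 1) \<le> 4 * 3 ^ DIM('a) * h ^ (DIM('a) - 1)"
    using h by simp
  have "\<delta> = (2 / (1 - \<kappa>)) * r" using \<kappa> by (simp add: r_def)
  then have "real (card P) * \<delta> ^ (DIM('a) - 1) = (2 / (1 - \<kappa>)) ^ (DIM('a) - 1) * (real (card P) * r ^ (DIM('a) - 1))"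
    by (metis mult.left_commute power_mult_distrib)
  also have "\<dots> \<le> (2 / (1 - \<kappa>)) ^ (DIM('a) - 1) * (4 * 3 ^ DIM('a) * h ^ (DIM('a) - 1))"
    using 2 \<kappa> by (intro mult_left_mono) auto
  finally show ?thesis by (simp add: mult_ac)
qed

text \<open>A largest \<open>\<delta>\<close>-separated subset of \<open>S\<close> is also a
  \<open>\<delta>\<close>-net, and its cardinality is of order
  \<open>(h / \<delta>) ^ (DIM('a) - 1)\<close>. The balls of radius \<open>\<delta>\<close> around
  it form covers with bounded Hausdorff sums at every scale, without any parametrisation of
  \<open>S\<close>.\<close>

lemma hausdorff_outer_graph_le:
  assumes dim: "2 \<le> DIM('a::euclidean_space)" and \<kappa>: "0 \<le> \<kappa>" "\<kappa> < 1"
  shows "\<exists>C\<ge>0. \<forall>S (z::'a) h \<nu>. 0 < h \<longrightarrow> norm \<nu> = 1 \<longrightarrow> S \<subseteq> ball z h \<longrightarrow>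
    (\<forall>p\<in>S. \<forall>q\<in>S. \<bar>(p - q) \<bullet> \<nu>\<bar> \<le> \<kappa> * norm (p - q)) \<longrightarrow>
    hausdorff_outer (DIM('a) - 1) S \<le> ennreal (C * h ^ (DIM('a) - 1))"
proof -
  define n where "n = DIM('a) - 1"
  have n: "n \<noteq> 0" using dim by (simp add: n_def)
  define w where "w = unit_ball_vol (real n)"
  have w: "w \<ge> 0" by (simp add: w_def)
  define B where "B = 4 * 3 ^ DIM('a) * (2 / (1 - \<kappa>)) ^ n"
  have "hausdorff_outer n S \<le> ennreal (w * B * h ^ n)"
    if h: "0 < h" and \<nu>: "norm \<nu> = 1" and S: "S \<subseteq> ball z h"
      and cone: "\<And>p q. p \<in> S \<Longrightarrow> q \<in> S \<Longrightarrow> \<bar>(p - q) \<bullet> \<nu>\<bar> \<le> \<kappa> * norm (p - q)" for S and z :: 'a and h \<nu>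
    unfolding hausdorff_outer_def
  proof (rule SUP_least)
    fix \<delta>0 :: real assume "\<delta>0 \<in> {0<..}"
    \<comment> \<open>Half of the prescribed scale, since the balls have diameter
      \<open>2 * \<delta>\<close>; the minimum with \<open>h\<close> is required by the counting
      lemma.\<close>
    define \<delta> where "\<delta> = min h (\<delta>0 / 2)"
    have \<delta>: "0 < \<delta>" "\<delta> \<le> h" "2 * \<delta> \<le> \<delta>0" using h \<open>\<delta>0 \<in> {0<..}\<close> by (auto simp: \<delta>_def)
    define G where "G = {P. finite P \<and> P \<subseteq> S \<and> (\<forall>p\<in>P. \<forall>q\<in>P. p \<noteq> q \<longrightarrow> \<delta> \<le> norm (p - q))}"
    have card: "real (card P) * \<delta> ^ n \<le> B * h ^ n" if "P \<in> G" for P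
      unfolding n_def B_def
      by (rule separated_points_card[of P z h \<nu>]) (use that S cone \<nu> \<kappa> \<delta> in \<open>auto simp: G_def\<close>)
    have "\<exists>P\<in>G. \<forall>Q\<in>G. card Q \<le> card P"
    proof -
      have "{} \<in> G" by (simp add: G_def)
      moreover have "card Q \<le> nat \<lceil>B * h ^ n / \<delta> ^ n\<rceil>" if "Q \<in> G" for Q
      proof -
        have "real (card Q) \<le> B * h ^ n / \<delta> ^ n" using card[OF that] \<delta>(1) by (simp add: pos_le_divide_eq)
        then show ?thesis by linarith
      qed
      ultimately show ?thesis
        using ex_has_greatest_nat[of "\<lambda>P. P \<in> G" "{}" card "Suc (nat \<lceil>B * h ^ n / \<delta> ^ n\<rceil>)"]
        by (auto simp: less_Suc_eq_le)
    qed
    then obtain P where P: "P \<in> G" and max: "\<And>Q. Q \<in> G \<Longrightarrow> card Q \<le> card P" by blast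
    have fP: "finite P" "P \<subseteq> S" using P by (auto simp: G_def)
    have cov: "S \<subseteq> (\<Union>p\<in>P. cball p \<delta>)"
    proof
      fix s assume s: "s \<in> S"
      show "s \<in> (\<Union>p\<in>P. cball p \<delta>)"
      proof (rule ccontr)
        assume "\<not> ?thesis"
        then have far: "\<And>p. p \<in> P \<Longrightarrow> \<delta> < norm (p - s)" by (auto simp: dist_norm not_le)
        then have "s \<notin> P" using \<delta>(1) by force
        have "insert s P \<in> G" using P s far by (force simp: G_def norm_minus_commute intro: less_imp_le)
        from max[OF this] show False using \<open>s \<notin> P\<close> fP by simp
      qed
    qed
    obtain f where f: "bij_betw f {0..<card P} P" using ex_bij_betw_nat_finite[OF fP(1)] by blast
    \<comment> \<open>Padding the finite cover with empty sets costs nothing because the exponent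
      \<open>n\<close> is positive, so that \<open>0 ^ n = 0\<close>.\<close>
    define C where "C i = (if i < card P then cball (f i) \<delta> else {})" for i
    have "hausdorff_pre n \<delta>0 S \<le> (\<Sum>i. ennreal (unit_ball_vol (real n) * (diameter (C i) / 2) ^ n))"
      unfolding hausdorff_pre_def
    proof (rule INF_lower)
      have "S \<subseteq> (\<Union>i. C i)"
      proof
        fix s assume "s \<in> S"
        then obtain p where p: "p \<in> P" "s \<in> cball p \<delta>" using cov by blast
        then obtain i where "i < card P" "f i = p" using f by (force simp: bij_betw_def)
        then show "s \<in> (\<Union>i. C i)" using p by (auto simp: C_def intro!: exI[of _ i])
      qed
      then show "C \<in> {C. S \<subseteq> (\<Union>i. C i) \<and> (\<forall>i. bounded (C i) \<and> diameter (C i) \<le> \<delta>0)}"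
        using \<delta> by (auto simp: C_def diameter_cball)
    qed
    also have "\<dots> = (\<Sum>i<card P. ennreal (unit_ball_vol (real n) * (diameter (C i) / 2) ^ n))"
      by (rule suminf_finite) (use n in \<open>auto simp: C_def\<close>)
    also have "\<dots> = (\<Sum>i<card P. ennreal (w * \<delta> ^ n))"
      using \<delta>(1) by (intro sum.cong refl) (simp add: C_def w_def diameter_cball)
    also have "\<dots> = ennreal (real (card P) * (w * \<delta> ^ n))"
      using w \<delta>(1) by (subst sum_ennreal) auto
    also have "\<dots> \<le> ennreal (w * B * h ^ n)"
    proof (rule ennreal_leI)
      have "w * (real (card P) * \<delta> ^ n) \<le> w * (B * h ^ n)" by (rule mult_left_mono[OF card[OF P] w])
      then show "real (card P) * (w * \<delta> ^ n) \<le> w * B * h ^ n" by (simp add: mult_ac)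
    qed
    finally show "hausdorff_pre n \<delta>0 S \<le> ennreal (w * B * h ^ n)" .
  qed
  moreover have "w * B \<ge> 0" using w \<kappa> by (simp add: B_def)
  ultimately show ?thesis unfolding n_def by (intro exI[of _ "w * B"]) (simp add: n_def)
qed

section \<open>Lipschitz domains\<close>

text \<open>Inside \<open>U\<close>, the cone around \<open>\<nu>\<close> whose half-angle has
  cosine \<open>\<kappa>\<close>, placed at any point of \<open>\<Omega>\<close>, stays in
  \<open>\<Omega>\<close>. This keeps only what is used of the graph representation and passes to
  smaller \<open>U\<close> and larger \<open>\<kappa>\<close>, so that one \<open>\<kappa>\<close>
  can serve the whole boundary.\<close>

definition cone_property :: "'a::euclidean_space set \<Rightarrow> 'a set \<Rightarrow> 'a \<Rightarrow> real \<Rightarrow> bool" where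
  "cone_property \<Omega> U \<nu> \<kappa> \<longleftrightarrow> norm \<nu> = 1 \<and>
     (\<forall>x\<in>\<Omega> \<inter> U. \<forall>y\<in>U. \<kappa> * norm (y - x) \<le> (y - x) \<bullet> \<nu> \<longrightarrow> y \<in> \<Omega>)"

lemma cone_property_mono:
  assumes "cone_property \<Omega> U \<nu> \<kappa>" "U' \<subseteq> U" "\<kappa> \<le> \<kappa>'"
  shows "cone_property \<Omega> U' \<nu> \<kappa>'"
proof -
  have "\<kappa> * norm (y - x) \<le> (y - x) \<bullet> \<nu>" if "\<kappa>' * norm (y - x) \<le> (y - x) \<bullet> \<nu>" for x y
    using mult_right_mono[OF assms(3), of "norm (y - x)"] that by simp
  then show ?thesis using assms(1,2) unfolding cone_property_def by blast
qed

lemma lipschitz_graph_cone_property: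
  assumes \<nu>: "norm \<nu> = 1" and g: "L-lipschitz_on {z. z \<bullet> \<nu> = 0} g"
    and \<Omega>: "\<Omega> \<inter> U = {y \<in> U. g (y - (y \<bullet> \<nu>) *\<^sub>R \<nu>) < y \<bullet> \<nu>}"
  shows "\<exists>\<kappa>. 0 \<le> \<kappa> \<and> \<kappa> < 1 \<and> cone_property \<Omega> U \<nu> \<kappa>"
proof -
  \<comment> \<open>For \<open>v\<close> with component \<open>a \<ge> 0\<close> along
    \<open>\<nu>\<close> and orthogonal part \<open>u\<close>, this value makes
    \<open>\<kappa> * norm v \<le> a\<close> equivalent to
    \<open>L * norm u \<le> a\<close>.\<close>
  define \<kappa> where "\<kappa> = sqrt (L\<^sup>2 / (1 + L\<^sup>2))"
  have L: "0 \<le> L" using g by (rule lipschitz_on_nonneg)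
  have L1: "1 + L\<^sup>2 > 0" by (simp add: add_pos_nonneg)
  have \<kappa>: "0 \<le> \<kappa>" "\<kappa> < 1" "\<kappa>\<^sup>2 * (1 + L\<^sup>2) = L\<^sup>2"
    using L1 by (auto simp: \<kappa>_def real_less_lsqrt)
  have \<nu>\<nu>: "\<nu> \<bullet> \<nu> = 1" using \<nu> by (simp add: norm_eq_1)
  have "y \<in> \<Omega>" if x: "x \<in> \<Omega> \<inter> U" and y: "y \<in> U" and c: "\<kappa> * norm (y - x) \<le> (y - x) \<bullet> \<nu>" for x y
  proof -
    define v where "v = y - x"
    define a where "a = v \<bullet> \<nu>"
    define u where "u = v - a *\<^sub>R \<nu>"
    have a0: "0 \<le> a" using c \<kappa>(1) by (metis a_def mult_nonneg_nonneg norm_ge_zero order_trans v_def)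
    have nu: "(norm u)\<^sup>2 = (norm v)\<^sup>2 - a\<^sup>2"
      unfolding power2_norm_eq_inner using \<nu>\<nu>
      by (simp add: u_def a_def inner_diff_left inner_diff_right inner_commute power2_eq_square)
    have "(\<kappa> * norm v)\<^sup>2 \<le> a\<^sup>2" using c \<kappa>(1) by (intro power_mono) (auto simp: a_def v_def)
    then have "\<kappa>\<^sup>2 * (1 + L\<^sup>2) * (norm v)\<^sup>2 \<le> a\<^sup>2 * (1 + L\<^sup>2)"
      using L1 by (simp add: power_mult_distrib mult.commute mult.left_commute)
    then have "(L * norm u)\<^sup>2 \<le> a\<^sup>2"
      unfolding \<kappa>(3) by (simp add: power_mult_distrib nu algebra_simps)
    then have Lu: "L * norm u \<le> a" using a0 by (rule power2_le_imp_le)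
    define x' y' where "x' = x - (x \<bullet> \<nu>) *\<^sub>R \<nu>" and "y' = y - (y \<bullet> \<nu>) *\<^sub>R \<nu>"
    have orth: "x' \<bullet> \<nu> = 0" "y' \<bullet> \<nu> = 0" using \<nu>\<nu> by (auto simp: x'_def y'_def inner_diff_left)
    have "y' - x' = u" by (simp add: x'_def y'_def u_def a_def v_def inner_diff_left algebra_simps)
    then have "g y' \<le> g x' + L * norm u"
      using lipschitz_onD[OF g, of y' x'] orth by (auto simp: dist_real_def dist_norm)
    also have "\<dots> < x \<bullet> \<nu> + a" using x \<Omega> Lu by (auto simp: x'_def)
    also have "\<dots> = y \<bullet> \<nu>" by (simp add: a_def v_def inner_diff_left)
    finally show ?thesis using \<Omega> y by (auto simp: y'_def)
  qed
  then show ?thesis using \<kappa> \<nu> unfolding cone_property_def by blast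
qed

text \<open>Compactness of the boundary. Two forms are needed: finitely many charts, for adding up
  upper bounds of the surface measure, and a cone at each boundary point with common
  \<open>\<kappa>\<close> and radius, for local lower bounds.\<close>

lemma lipschitz_domain_uniform_cone:
  assumes \<Omega>: "lipschitz_domain \<Omega>" and b: "bounded (\<Omega> :: 'a::euclidean_space set)"
  obtains Z R \<nu> \<kappa> r where "finite Z" "frontier \<Omega> \<subseteq> (\<Union>a\<in>Z. ball a (R a))" "0 \<le> \<kappa>" "\<kappa> < 1" "0 < r"
    "\<And>a. a \<in> Z \<Longrightarrow> 0 < R a \<and> cone_property \<Omega> (ball a (R a)) (\<nu> a) \<kappa>"
    "\<And>z. z \<in> frontier \<Omega> \<Longrightarrow> \<exists>n. cone_property \<Omega> (ball z r) n \<kappa>"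
proof -
  have "\<exists>r>0. \<exists>\<nu> \<kappa>. 0 \<le> \<kappa> \<and> \<kappa> < 1 \<and> cone_property \<Omega> (ball z r) \<nu> \<kappa>" if "z \<in> frontier \<Omega>" for z
  proof -
    have "\<exists>r>0. \<exists>\<nu> L g. norm \<nu> = 1 \<and> L-lipschitz_on {z. z \<bullet> \<nu> = 0} g \<and>
        \<Omega> \<inter> ball z r = {y \<in> ball z r. g (y - (y \<bullet> \<nu>) *\<^sub>R \<nu>) < y \<bullet> \<nu>}"
      using \<Omega> that unfolding lipschitz_domain_def by (elim conjE) (rule bspec)
    then obtain r \<nu> L g where r: "r > 0" and *: "norm \<nu> = 1" "L-lipschitz_on {z. z \<bullet> \<nu> = 0} g"
      "\<Omega> \<inter> ball z r = {y \<in> ball z r. g (y - (y \<bullet> \<nu>) *\<^sub>R \<nu>) < y \<bullet> \<nu>}"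
      by (elim exE conjE)
    show ?thesis using r lipschitz_graph_cone_property[OF *] by blast
  qed
  then obtain r \<nu> \<kappa> where r: "\<And>z. z \<in> frontier \<Omega> \<Longrightarrow> 0 < r z"
    and \<kappa>: "\<And>z. z \<in> frontier \<Omega> \<Longrightarrow> 0 \<le> \<kappa> z \<and> \<kappa> z < (1::real)"
    and cone: "\<And>z. z \<in> frontier \<Omega> \<Longrightarrow> cone_property \<Omega> (ball z (r z)) (\<nu> z) (\<kappa> z)"
    by metis
  \<comment> \<open>Covering by balls of half the radius leaves room, within the full chart, for a
    ball of radius \<open>r0\<close> around each boundary point.\<close>
  define R where "R a = r a / 2" for a
  have "compact (frontier \<Omega>)" using b by (simp add: compact_frontier_bounded)
  moreover have "frontier \<Omega> \<subseteq> (\<Union>a\<in>frontier \<Omega>. ball a (R a))" using r by (force simp: R_def)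
  ultimately obtain Z where Z: "Z \<subseteq> frontier \<Omega>" "finite Z" "frontier \<Omega> \<subseteq> (\<Union>a\<in>Z. ball a (R a))"
    using compactE_image[of "frontier \<Omega>" "frontier \<Omega>" "\<lambda>a. ball a (R a)"] by blast
  define K where "K = Max (insert 0 (\<kappa> ` Z))"
  define r0 where "r0 = Min (insert 1 (R ` Z))"
  have K: "0 \<le> K" "\<And>a. a \<in> Z \<Longrightarrow> \<kappa> a \<le> K" unfolding K_def using Z(2) by auto
  have K1: "K < 1" unfolding K_def using Z(1,2) \<kappa> by (subst Max_less_iff) auto
  have r0: "0 < r0" unfolding r0_def using Z(1,2) r by (subst Min_gr_iff) (auto simp: R_def)
  have r0R: "\<And>a. a \<in> Z \<Longrightarrow> r0 \<le> R a" unfolding r0_def using Z(2) by auto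
  show ?thesis
  proof (rule that[OF Z(2,3) K(1) K1 r0, of \<nu>])
    show "0 < R a \<and> cone_property \<Omega> (ball a (R a)) (\<nu> a) K" if a: "a \<in> Z" for a
    proof -
      have af: "a \<in> frontier \<Omega>" using a Z(1) by blast
      have "ball a (R a) \<subseteq> ball a (r a)" using r[OF af] by (auto simp: R_def)
      from cone_property_mono[OF cone[OF af] this K(2)[OF a]] show ?thesis using r[OF af] by (simp add: R_def)
    qed
    fix z assume "z \<in> frontier \<Omega>"
    then obtain a where a: "a \<in> Z" "z \<in> ball a (R a)" using Z(3) by blast
    have "ball z r0 \<subseteq> ball a (r a)"
    proof
      fix y assume "y \<in> ball z r0"
      then show "y \<in> ball a (r a)"
        using a(2) r0R[OF a(1)] dist_triangle[of a y z] by (auto simp: R_def)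
    qed
    then show "\<exists>n. cone_property \<Omega> (ball z r0) n K"
      using cone_property_mono[OF cone, of a "ball z r0" K] K(2)[OF a(1)] a(1) Z(1) by blast
  qed
qed

text \<open>If \<open>p\<close> lay strictly inside the cone above \<open>q\<close>, it would also
  lie in the cone above points of \<open>\<Omega>\<close> close to \<open>q\<close> and so in
  \<open>\<Omega>\<close>; but an open set contains none of its frontier. Applied both ways, this
  bounds the slope of the boundary.\<close>

lemma cone_property_frontier:
  assumes c: "cone_property \<Omega> U \<nu> \<kappa>" and op: "open \<Omega>" "open U"
    and p: "p \<in> frontier \<Omega> \<inter> U" and q: "q \<in> frontier \<Omega> \<inter> U"
  shows "\<bar>(p - q) \<bullet> \<nu>\<bar> \<le> \<kappa> * norm (p - q)"
proof -
  have le: "(p - q) \<bullet> \<nu> \<le> \<kappa> * norm (p - q)" if p: "p \<in> frontier \<Omega> \<inter> U" and q: "q \<in> frontier \<Omega> \<inter> U" for p q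
  proof (rule ccontr)
    assume na: "\<not> ?thesis"
    define V where "V = {x. \<kappa> * norm (p - x) < (p - x) \<bullet> \<nu>} \<inter> U"
    have "open V" unfolding V_def
      by (intro open_Int open_Collect_less continuous_intros op(2))
    moreover have "q \<in> V" using na q by (simp add: V_def)
    moreover have "q \<in> closure \<Omega>" using q by (simp add: frontier_def)
    ultimately have "V \<inter> \<Omega> \<noteq> {}" using open_Int_closure_eq_empty[of V \<Omega>] by blast
    then obtain x where x: "x \<in> \<Omega>" "x \<in> U" "\<kappa> * norm (p - x) < (p - x) \<bullet> \<nu>" by (auto simp: V_def)
    then have "p \<in> \<Omega>" using c p unfolding cone_property_def by auto
    then show False using p op(1) by (auto simp: frontier_def interior_open)
  qed
  show ?thesis using le[OF p q] le[OF q p] by (auto simp: abs_le_iff norm_minus_commute inner_diff_left)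
qed

section \<open>Paths that leave the domain near a boundary point\<close>

lemma exit_point:
  fixes a b :: "'a::euclidean_space"
  assumes op: "open \<Omega>" and a: "a \<in> \<Omega>" and b: "b \<notin> \<Omega>"
  shows "\<exists>s. 0 < s \<and> s \<le> 1 \<and> a + s *\<^sub>R (b - a) \<in> frontier \<Omega> \<and> (\<forall>u. 0 \<le> u \<and> u < s \<longrightarrow> a + u *\<^sub>R (b - a) \<in> \<Omega>)"
proof -
  let ?y = "\<lambda>s. a + s *\<^sub>R (b - a)"
  define S where "S = {0..1} \<inter> ?y -` (- \<Omega>)"
  have "closed S" unfolding S_def
    by (intro continuous_closed_preimage continuous_intros) (use op in auto)
  have "1 \<in> S" using b by (simp add: S_def)
  have bb: "bdd_below S" unfolding S_def by (auto intro!: bdd_belowI[of _ 0])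
  define s where "s = Inf S"
  have s: "s \<in> S" unfolding s_def using closed_contains_Inf[OF _ bb \<open>closed S\<close>] \<open>1 \<in> S\<close> by blast
  have lt: "?y u \<in> \<Omega>" if "0 \<le> u" "u < s" for u
  proof (rule ccontr)
    assume "?y u \<notin> \<Omega>"
    then have "u \<in> S" using that s by (auto simp: S_def)
    then show False using cInf_lower[OF _ bb, of u] that by (simp add: s_def)
  qed
  have "s \<noteq> 0" using s a by (auto simp: S_def)
  then have s0: "0 < s" "s \<le> 1" using s by (auto simp: S_def)
  have "?y s \<in> closure \<Omega>"
  proof (rule Lim_in_closed_set[OF closed_closure])
    show "\<forall>\<^sub>F u in at_left s. ?y u \<in> closure \<Omega>"
      unfolding eventually_at_left_field using s0 lt closure_subset
      by (intro exI[of _ 0]) (force intro: less_imp_le)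
    show "(?y \<longlongrightarrow> ?y s) (at_left s)" by (intro tendsto_intros)
  qed auto
  then have "?y s \<in> frontier \<Omega>" using s op by (auto simp: frontier_def interior_open S_def)
  then show ?thesis using s0 lt by blast
qed

text \<open>The point \<open>b\<close> is reached from \<open>x\<close> by going up by
  \<open>t\<close>, with a free perturbation \<open>w\<close>. Going down by \<open>2 * t\<close>
  must leave \<open>\<Omega>\<close>, since otherwise \<open>z\<close> would lie in the cone of the
  end point and thus in \<open>\<Omega>\<close>. The perturbations \<open>x - z\<close> and
  \<open>w\<close> may each have size \<open>\<eta> * t\<close> with
  \<open>4 * \<eta> = 1 - \<kappa>\<close>, the value for which
  \<open>\<kappa> + 2 * \<eta> = 1 - 2 * \<eta>\<close>. The bound \<open>5 * t \<le> r\<close>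
  keeps all points in the chart.\<close>

lemma cone_property_crossing:
  fixes x z w \<nu> :: "'a::euclidean_space"
  assumes c: "cone_property \<Omega> (ball z r) \<nu> \<kappa>" and \<kappa>: "0 \<le> \<kappa>" "\<kappa> < 1" and op: "open \<Omega>"
    and x: "x \<in> \<Omega>" and z: "z \<in> frontier \<Omega>" and t: "0 < t" "5 * t \<le> r"
    and xz: "norm (x - z) \<le> (1 - \<kappa>) / 4 * t" and w: "norm w \<le> (1 - \<kappa>) / 4 * t"
  defines "b \<equiv> x + t *\<^sub>R \<nu> + w"
  shows "\<And>s. 0 \<le> s \<Longrightarrow> s \<le> 1 \<Longrightarrow> x + s *\<^sub>R (b - x) \<in> \<Omega>"
    and "\<exists>s. 0 < s \<and> s \<le> 1 \<and> b - (s * (2 * t)) *\<^sub>R \<nu> \<in> frontier \<Omega> \<and>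
      (\<forall>u. 0 \<le> u \<and> u < s \<longrightarrow> b - (u * (2 * t)) *\<^sub>R \<nu> \<in> \<Omega>)"
proof -
  define \<eta> where "\<eta> = (1 - \<kappa>) / 4"
  have \<eta>: "0 < \<eta>" "\<eta> \<le> 1 / 4" using \<kappa> by (auto simp: \<eta>_def)
  have \<nu>: "norm \<nu> = 1" "\<nu> \<bullet> \<nu> = 1" using c by (auto simp: cone_property_def norm_eq_1)
  have cone: "y \<in> \<Omega>" if "p \<in> \<Omega>" "p \<in> ball z r" "y \<in> ball z r" "\<kappa> * norm (y - p) \<le> (y - p) \<bullet> \<nu>" for p y
    using c that unfolding cone_property_def by blast
  have w\<nu>: "\<bar>w \<bullet> \<nu>\<bar> \<le> \<eta> * t" using Cauchy_Schwarz_ineq2[of w \<nu>] w \<nu> by (simp add: \<eta>_def)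
  have xz': "norm (x - z) \<le> \<eta> * t" and w': "norm w \<le> \<eta> * t" using xz w by (simp_all add: \<eta>_def)
  have \<eta>t: "\<eta> * t \<le> t / 4" using \<eta>(2) t(1) mult_right_mono[of \<eta> "1/4" t] by simp
  have bx: "b - x = t *\<^sub>R \<nu> + w" by (simp add: b_def)
  have nbx: "norm (b - x) \<le> t + \<eta> * t"
    unfolding bx using norm_triangle_ineq[of "t *\<^sub>R \<nu>" w] w' \<nu> t by simp
  have xr: "x \<in> ball z r" unfolding mem_ball dist_norm using xz' \<eta>t t norm_minus_commute[of z x] by linarith
  have key: "\<kappa> * (t + \<eta> * t) \<le> t - \<eta> * t"
  proof -
    have "\<kappa> * (1 + \<eta>) \<le> 1 - \<eta>"
    proof -
      have "\<kappa> * (1 + \<eta>) \<le> \<kappa> + \<eta>" using \<kappa> \<eta> mult_right_mono[of \<kappa> 1 \<eta>] by (simp add: algebra_simps)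
      also have "\<dots> \<le> 1 - \<eta>" using \<kappa> by (simp add: \<eta>_def field_simps)
      finally show ?thesis .
    qed
    from mult_right_mono[OF this, of t] t show ?thesis by (simp add: algebra_simps)
  qed
  have key2: "\<kappa> * (t + 2 * (\<eta> * t)) \<le> t - 2 * (\<eta> * t)"
  proof -
    have "\<kappa> * (1 + 2 * \<eta>) \<le> \<kappa> + 2 * \<eta>" using \<kappa> \<eta> mult_right_mono[of \<kappa> 1 "2 * \<eta>"] by (simp add: algebra_simps)
    also have "\<dots> \<le> 1 - 2 * \<eta>" by (simp add: \<eta>_def field_simps)
    finally have "\<kappa> * (1 + 2 * \<eta>) \<le> 1 - 2 * \<eta>" .
    from mult_right_mono[OF this, of t] t show ?thesis by (simp add: algebra_simps)
  qed
  show up: "x + s *\<^sub>R (b - x) \<in> \<Omega>" if s: "0 \<le> s" "s \<le> 1" for s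
  proof (rule cone[OF x xr])
    have sb: "s * norm (b - x) \<le> 1 * norm (b - x)" using s by (intro mult_right_mono) auto
    have "norm (x + s *\<^sub>R (b - x) - z) \<le> norm (x - z) + s * norm (b - x)"
    proof -
      have e: "x + s *\<^sub>R (b - x) - z = (x - z) + s *\<^sub>R (b - x)" by simp
      show ?thesis unfolding e
        using norm_triangle_ineq[of "x - z" "s *\<^sub>R (b - x)"] s by (simp only: norm_scaleR abs_of_nonneg)
    qed
    then show "x + s *\<^sub>R (b - x) \<in> ball z r"
      unfolding mem_ball dist_norm
      using xz' nbx sb \<eta>t t norm_minus_commute[of z "x + s *\<^sub>R (b - x)"] by linarith
    have "\<kappa> * norm (b - x) \<le> (b - x) \<bullet> \<nu>"
    proof -
      have "\<kappa> * norm (b - x) \<le> \<kappa> * (t + \<eta> * t)" using nbx \<kappa> by (intro mult_left_mono) auto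
      also have "\<dots> \<le> t - \<eta> * t" by (rule key)
      also have "\<dots> \<le> (b - x) \<bullet> \<nu>" using w\<nu> \<nu> unfolding bx by (simp add: inner_add_left)
      finally show ?thesis .
    qed
    then have "s * (\<kappa> * norm (b - x)) \<le> s * ((b - x) \<bullet> \<nu>)" using s by (intro mult_left_mono) auto
    then show "\<kappa> * norm (x + s *\<^sub>R (b - x) - x) \<le> (x + s *\<^sub>R (b - x) - x) \<bullet> \<nu>" using s by (simp add: mult_ac)
  qed
  have bO: "b \<in> \<Omega>" using up[of 1] by simp
  \<comment> \<open>The lowest point of the descent. The cone condition from it towards
    \<open>z\<close> has to absorb both perturbations, hence \<open>key2\<close>.\<close>
  define b' where "b' = b - (2 * t) *\<^sub>R \<nu>"
  have b'z: "z - b' = (z - x) + t *\<^sub>R \<nu> - w" by (simp add: b'_def b_def algebra_simps flip: scaleR_left.add)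
  have "b' \<notin> \<Omega>"
  proof
    assume b': "b' \<in> \<Omega>"
    have n: "norm (z - b') \<le> t + 2 * (\<eta> * t)"
    proof -
      have "norm (z - b') \<le> norm (z - x) + norm (t *\<^sub>R \<nu>) + norm w"
        unfolding b'z using norm_triangle_ineq4[of "z - x + t *\<^sub>R \<nu>" w] norm_triangle_ineq[of "z - x" "t *\<^sub>R \<nu>"] by linarith
      then show ?thesis using xz' w' \<nu> t by (simp add: norm_minus_commute)
    qed
    have zx\<nu>: "\<bar>(z - x) \<bullet> \<nu>\<bar> \<le> \<eta> * t"
      using Cauchy_Schwarz_ineq2[of "z - x" \<nu>] xz' \<nu> by (simp add: norm_minus_commute)
    have "z \<in> \<Omega>"
    proof (rule cone[OF b'])
      show "b' \<in> ball z r" unfolding mem_ball dist_norm using n \<eta>t t by linarith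
      show "z \<in> ball z r" using t by simp
      have "\<kappa> * norm (z - b') \<le> \<kappa> * (t + 2 * (\<eta> * t))" using n \<kappa> by (intro mult_left_mono) auto
      also have "\<dots> \<le> t - 2 * (\<eta> * t)" by (rule key2)
      also have "\<dots> \<le> (z - b') \<bullet> \<nu>"
        using zx\<nu> w\<nu> \<nu> unfolding b'z by (simp add: inner_add_left inner_diff_left)
      finally show "\<kappa> * norm (z - b') \<le> (z - b') \<bullet> \<nu>" .
    qed
    then show False using z op by (auto simp: frontier_def interior_open)
  qed
  from exit_point[OF op bO this]
  show "\<exists>s. 0 < s \<and> s \<le> 1 \<and> b - (s * (2 * t)) *\<^sub>R \<nu> \<in> frontier \<Omega> \<and>
      (\<forall>u. 0 \<le> u \<and> u < s \<longrightarrow> b - (u * (2 * t)) *\<^sub>R \<nu> \<in> \<Omega>)"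
    by (simp add: b'_def)
qed

text \<open>\<open>S\<close> is split by the finitely many charts and not placed in one of them, so
  \<open>h\<close> is not restricted by the chart radii.\<close>

lemma lipschitz_frontier_measure_le:
  assumes dim: "2 \<le> DIM('a::euclidean_space)" and \<Omega>: "lipschitz_domain (\<Omega> :: 'a set)" "bounded \<Omega>"
    and meas: "measure_space UNIV (sets borel) (hausdorff_outer (DIM('a) - 1) :: 'a set \<Rightarrow> ennreal)"
  shows "\<exists>C\<ge>0. \<forall>S z h. 0 < h \<longrightarrow> S \<subseteq> ball z h \<longrightarrow> closed S \<longrightarrow>
    emeasure surface_measure (S \<inter> frontier \<Omega>) \<le> ennreal (C * h ^ (DIM('a) - 1))"
proof -
  have op: "open \<Omega>" using \<Omega>(1) by (simp add: lipschitz_domain_def)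
  obtain Z R \<nu> \<kappa> r where Z: "finite Z" "frontier \<Omega> \<subseteq> (\<Union>a\<in>Z. ball a (R a))" and \<kappa>: "0 \<le> \<kappa>" "\<kappa> < 1"
    and cone: "\<And>a. a \<in> Z \<Longrightarrow> cone_property \<Omega> (ball a (R a)) (\<nu> a) \<kappa>"
    using lipschitz_domain_uniform_cone[OF \<Omega>] by metis
  obtain C where C: "C \<ge> 0" "\<And>S z h \<nu>. 0 < h \<Longrightarrow> norm \<nu> = 1 \<Longrightarrow> S \<subseteq> ball (z::'a) h \<Longrightarrow>
    (\<forall>p\<in>S. \<forall>q\<in>S. \<bar>(p - q) \<bullet> \<nu>\<bar> \<le> \<kappa> * norm (p - q)) \<Longrightarrow>
    hausdorff_outer (DIM('a) - 1) S \<le> ennreal (C * h ^ (DIM('a) - 1))"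
    using hausdorff_outer_graph_le[OF dim \<kappa>] by blast
  have "emeasure surface_measure (S \<inter> frontier \<Omega>) \<le> ennreal (real (card Z) * C * h ^ (DIM('a) - 1))"
    if h: "0 < h" and S: "S \<subseteq> ball z h" "closed S" for S and z :: 'a and h
  proof -
    let ?P = "\<lambda>a. S \<inter> frontier \<Omega> \<inter> ball a (R a)"
    have B: "?P a \<in> sets borel" for a using S(2) by auto
    have "emeasure surface_measure (S \<inter> frontier \<Omega>) \<le> emeasure surface_measure (\<Union>a\<in>Z. ?P a)"
    proof (rule emeasure_mono)
      show "S \<inter> frontier \<Omega> \<subseteq> (\<Union>a\<in>Z. ?P a)" using Z(2) by blast
      show "(\<Union>a\<in>Z. ?P a) \<in> sets surface_measure"
        by (intro emeasure_hausdorff_measure(1) sets.finite_UN Z(1) B)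
    qed
    also have "\<dots> \<le> (\<Sum>a\<in>Z. emeasure surface_measure (?P a))"
      by (rule emeasure_subadditive_finite) (use Z(1) B in \<open>auto intro!: emeasure_hausdorff_measure(1)\<close>)
    also have "\<dots> \<le> (\<Sum>a\<in>Z. ennreal (C * h ^ (DIM('a) - 1)))"
    proof (rule sum_mono)
      fix a assume a: "a \<in> Z"
      show "emeasure surface_measure (?P a) \<le> ennreal (C * h ^ (DIM('a) - 1))"
        unfolding emeasure_hausdorff_measure(2)[OF B meas]
      proof (rule C(2)[OF h])
        show "norm (\<nu> a) = 1" using cone[OF a] by (simp add: cone_property_def)
        show "\<forall>p\<in>?P a. \<forall>q\<in>?P a. \<bar>(p - q) \<bullet> \<nu> a\<bar> \<le> \<kappa> * norm (p - q)"
          by (intro ballI cone_property_frontier[OF cone[OF a] op open_ball]) auto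
      qed (use S in auto)
    qed
    also have "\<dots> = ennreal (real (card Z) * C * h ^ (DIM('a) - 1))"
      using C(1) h by (subst sum_ennreal) (auto simp: mult_ac)
    finally show ?thesis .
  qed
  moreover have "real (card Z) * C \<ge> 0" using C(1) by simp
  ultimately show ?thesis by (intro exI[of _ "real (card Z) * C"]) blast
qed

section \<open>Shape regular meshes\<close>

definition star_size_bound :: "nat \<Rightarrow> real \<Rightarrow> nat" where
  "star_size_bound n \<rho> = nat \<lceil>((1 + \<rho>) / \<rho>) ^ n\<rceil>"

text \<open>Bound for the ratio of diameters along a chain of elements at a vertex joined by edges:
  each step costs at most a factor \<open>2 * \<rho>\<close>, and the exponent bounds the number of
  pairs of elements at the vertex, hence the length of a shortest chain.\<close>

definition star_size_ratio :: "nat \<Rightarrow> real \<Rightarrow> real" where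
  "star_size_ratio n \<rho> = (2 * \<rho>) ^ (star_size_bound n \<rho> * star_size_bound n \<rho>)"

text \<open>Shape regularity in the form in which it is used: an actual ball of radius proportional
  to the diameter. Nothing compares the diameters of different elements.\<close>

locale shape_regular_mesh =
  fixes \<T> :: "'a::euclidean_space set set" and \<rho> :: real
  assumes tri: "triangulation \<T>"
    and simplex: "T \<in> \<T> \<Longrightarrow> int DIM('a) simplex T"
    and \<rho>: "0 < \<rho>"
    and inball: "T \<in> \<T> \<Longrightarrow> \<exists>c. cball c (\<rho> * diameter T) \<subseteq> T"
begin

lemma finite_mesh: "finite \<T>"
  using tri by (simp add: triangulation_def)

lemma compact_elem: "T \<in> \<T> \<Longrightarrow> compact T"
  using simplex compact_simplex by blast

lemma convex_elem: "T \<in> \<T> \<Longrightarrow> convex T"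
  using simplex convex_simplex by blast

lemma dist_le_diameter: "T \<in> \<T> \<Longrightarrow> x \<in> T \<Longrightarrow> y \<in> T \<Longrightarrow> norm (x - y) \<le> diameter T"
  using diameter_bounded_bound[OF compact_imp_bounded[OF compact_elem], of T x y] by (simp add: dist_norm)

lemma vertex_mem: "v \<in> vertices T \<Longrightarrow> v \<in> T"
  by (simp add: extreme_point_of_def)

lemma diameter_pos: assumes T: "T \<in> \<T>" shows "0 < diameter T"
proof -
  have "\<not> card (vertices T) \<le> Suc 0" using simplex_vertices(2)[OF simplex[OF T]] by simp
  then obtain v w where vw: "v \<in> vertices T" "w \<in> vertices T" "v \<noteq> w"
    using card_le_Suc0_iff_eq[OF simplex_vertices(1)[OF simplex[OF T]]] by blast
  then have "0 < norm (v - w)" by simp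
  also have "\<dots> \<le> diameter T" by (rule dist_le_diameter[OF T vertex_mem[OF vw(1)] vertex_mem[OF vw(2)]])
  finally show ?thesis .
qed

lemma \<rho>_le: assumes T: "T \<in> \<T>" shows "2 * \<rho> \<le> 1"
proof -
  obtain c where c: "cball c (\<rho> * diameter T) \<subseteq> T" using inball[OF T] by blast
  obtain e :: 'a where e: "norm e = 1" using vector_choose_size[of 1] by auto
  have h: "0 < diameter T" by (rule diameter_pos[OF T])
  have "c + (\<rho> * diameter T) *\<^sub>R e \<in> T" "c - (\<rho> * diameter T) *\<^sub>R e \<in> T"
    using c h \<rho> e by (auto simp: subset_iff dist_norm)
  from dist_le_diameter[OF T this] have "norm ((2 * \<rho> * diameter T) *\<^sub>R e) \<le> diameter T"
    by (simp add: algebra_simps flip: scaleR_left.add)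
  then show ?thesis using e h \<rho> by simp
qed

text \<open>Along the edge from \<open>v\<close> to \<open>w\<close> the coordinate of
  \<open>v\<close> falls from 1 to 0, and its slope is bounded through the inscribed ball.\<close>

lemma vertex_dist:
  assumes T: "T \<in> \<T>" and vw: "v \<in> vertices T" "w \<in> vertices T" "v \<noteq> w"
  shows "2 * \<rho> * diameter T \<le> norm (v - w)"
proof -
  obtain c where c: "cball c (\<rho> * diameter T) \<subseteq> T" using inball[OF T] by blast
  have "\<bar>bary T v v - bary T v w\<bar> * (2 * (\<rho> * diameter T)) \<le> norm (v - w)"
    by (rule bary_lipschitz[OF simplex[OF T] _ c]) (use vw \<rho> diameter_pos[OF T] in auto)
  then show ?thesis using bary_vertex[OF simplex[OF T], of v v] bary_vertex[OF simplex[OF T], of v w] vw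
    by simp
qed

text \<open>Conformity in coordinates: the intersection is a face of both elements, hence the hull
  of common vertices, and \<open>y\<close> has one representation valid in both. The next three
  lemmas read off its coefficients.\<close>

lemma shared_face_comb:
  assumes T: "T1 \<in> \<T>" "T2 \<in> \<T>" and y: "y \<in> T1 \<inter> T2"
  obtains c u where "c \<subseteq> vertices T1 \<inter> vertices T2" "finite c" "(\<Sum>w\<in>c. u w) = 1" "y = (\<Sum>w\<in>c. u w *\<^sub>R w)"
proof -
  have F1: "T1 \<inter> T2 face_of T1" and F2: "T1 \<inter> T2 face_of T2"
    using tri T unfolding triangulation_def by (blast, metis Int_commute)
  note V = simplex_vertices[OF simplex[OF T(1)]]
  obtain c where c: "c \<subseteq> vertices T1" "T1 \<inter> T2 = convex hull c"
    using F1 face_of_convex_hull_affine_independent[OF V(3), of "T1 \<inter> T2"] V(4) by auto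
  have fc: "finite c" using c(1) V(1) finite_subset by blast
  have "c \<subseteq> vertices T2"
  proof
    fix w assume w: "w \<in> c"
    then have "w \<in> T1 \<inter> T2" using c(2) hull_inc by metis
    then show "w \<in> vertices T2"
      using extreme_point_of_face[OF F1, of w] extreme_point_of_face[OF F2, of w] c(1) w by auto
  qed
  moreover obtain u where "(\<Sum>w\<in>c. u w) = 1" "y = (\<Sum>w\<in>c. u w *\<^sub>R w)"
    using y unfolding c(2) convex_hull_finite[OF fc] by blast
  ultimately show ?thesis using that[of c u] c(1) fc by blast
qed

lemma bary_agree:
  assumes T: "T1 \<in> \<T>" "T2 \<in> \<T>" and v: "v \<in> vertices T1" "v \<in> vertices T2" and y: "y \<in> T1 \<inter> T2"
  shows "bary T1 v y = bary T2 v y"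
proof -
  obtain c u where c: "c \<subseteq> vertices T1 \<inter> vertices T2" "(\<Sum>w\<in>c. u w) = 1" "y = (\<Sum>w\<in>c. u w *\<^sub>R w)"
    using shared_face_comb[OF T y] by metis
  show ?thesis
    using bary_convex_comb[OF simplex[OF T(1)] _ _ c(2), of v] bary_convex_comb[OF simplex[OF T(2)] _ _ c(2), of v] c v
    by auto
qed

lemma bary_pos_mem:
  assumes T: "T1 \<in> \<T>" "T2 \<in> \<T>" and v: "v \<in> vertices T1" and y: "y \<in> T1 \<inter> T2" and pos: "0 < bary T1 v y"
  shows "v \<in> vertices T2"
proof -
  obtain c u where c: "c \<subseteq> vertices T1 \<inter> vertices T2" "(\<Sum>w\<in>c. u w) = 1" "y = (\<Sum>w\<in>c. u w *\<^sub>R w)"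
    using shared_face_comb[OF T y] by metis
  then have "v \<in> c" using bary_convex_comb[OF simplex[OF T(1)] _ _ c(2), of v] v pos by (auto split: if_splits)
  then show ?thesis using c by auto
qed

lemma shared_edge:
  assumes T: "T1 \<in> \<T>" "T2 \<in> \<T>" and y: "y \<in> T1 \<inter> T2" and ne: "y \<noteq> v"
  shows "\<exists>w. w \<noteq> v \<and> w \<in> vertices T1 \<and> w \<in> vertices T2"
proof -
  obtain c u where c: "c \<subseteq> vertices T1 \<inter> vertices T2" "(\<Sum>w\<in>c. u w) = 1" "y = (\<Sum>w\<in>c. u w *\<^sub>R w)"
    using shared_face_comb[OF T y] by metis
  have "\<not> c \<subseteq> {v}"
  proof
    assume "c \<subseteq> {v}"
    then consider "c = {}" | "c = {v}" by blast
    then show False using c(2,3) ne by cases auto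
  qed
  then show ?thesis using c(1) by blast
qed

lemma interiors_disjoint:
  assumes T: "T1 \<in> \<T>" "T2 \<in> \<T>" "T1 \<noteq> T2" and b: "ball x r \<subseteq> T1 \<inter> T2"
  shows "r \<le> 0"
proof (rule ccontr)
  assume "\<not> r \<le> 0"
  then have x: "x \<in> interior (T1 \<inter> T2)" using b by (meson centre_in_ball interiorI not_le open_ball)
  have F1: "T1 \<inter> T2 face_of T1" and F2: "T1 \<inter> T2 face_of T2"
    using tri T unfolding triangulation_def by (blast, metis Int_commute)
  have "T1 \<inter> T2 = T1" using face_of_disjoint_interior[OF F1] x interior_subset by (auto simp: interior_Int)
  moreover have "T1 \<inter> T2 = T2" using face_of_disjoint_interior[OF F2] x interior_subset by (auto simp: interior_Int)
  ultimately show False using T(3) by auto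
qed

text \<open>The elements at \<open>v\<close> may differ in size. Shrinking each towards
  \<open>v\<close> to the smallest diameter keeps it inside itself by convexity; then the inscribed
  balls have equal radii, are disjoint, and lie in one ball around \<open>v\<close>.\<close>

lemma star_card: "real (card {T \<in> \<T>. v \<in> T}) * \<rho> ^ DIM('a) \<le> (1 + \<rho>) ^ DIM('a)"
proof (cases "{T \<in> \<T>. v \<in> T} = {}")
  case True
  then show ?thesis using \<rho> by (simp only: card.empty) simp
next
  case False
  let ?S = "{T \<in> \<T>. v \<in> T}"
  have fS: "finite ?S" using finite_mesh by simp
  define \<epsilon> where "\<epsilon> = Min (diameter ` ?S)"
  have \<epsilon>: "0 < \<epsilon>" "\<And>T. T \<in> ?S \<Longrightarrow> \<epsilon> \<le> diameter T"
    unfolding \<epsilon>_def using fS False diameter_pos by (auto simp: Min_gr_iff)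
  have "\<exists>c. \<forall>T\<in>\<T>. cball (c T) (\<rho> * diameter T) \<subseteq> T" using inball by metis
  then obtain c where c: "\<And>T. T \<in> \<T> \<Longrightarrow> cball (c T) (\<rho> * diameter T) \<subseteq> T" by blast
  define s where "s T = \<epsilon> / diameter T" for T :: "'a set"
  define p where "p T = v + s T *\<^sub>R (c T - v)" for T
  have s: "0 < s T" "s T \<le> 1" "s T * diameter T = \<epsilon>" if "T \<in> ?S" for T
    using \<epsilon>(1) \<epsilon>(2)[OF that] diameter_pos[of T] that by (auto simp: s_def)
  have inT: "ball (p T) (\<rho> * \<epsilon>) \<subseteq> T" if T: "T \<in> ?S" for T
  proof
    fix y assume y: "y \<in> ball (p T) (\<rho> * \<epsilon>)"
    define q where "q = c T + (y - p T) /\<^sub>R s T"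
    have "norm (y - p T) \<le> s T * (\<rho> * diameter T)"
      using y s(3)[OF T] by (simp add: dist_norm norm_minus_commute mult.left_commute)
    then have "q \<in> cball (c T) (\<rho> * diameter T)"
      using s(1)[OF T] by (simp add: q_def dist_norm pos_divide_le_eq divide_inverse_commute[symmetric] mult.commute)
    then have q: "q \<in> T" using c T by blast
    have "y = (1 - s T) *\<^sub>R v + s T *\<^sub>R q"
      using s(1)[OF T] by (simp add: q_def p_def algebra_simps)
    then show "y \<in> T" using convexD[OF convex_elem[of T], of v q "1 - s T" "s T"] q T s[OF T] by auto
  qed
  have "real (card ?S) * (\<rho> * \<epsilon>) ^ DIM('a) \<le> ((1 + \<rho>) * \<epsilon>) ^ DIM('a)"
  proof (rule disjoint_balls_card[OF fS])
    show "ball (p T) (\<rho> * \<epsilon>) \<subseteq> ball v ((1 + \<rho>) * \<epsilon>)" if T: "T \<in> ?S" for T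
    proof -
      have "c T \<in> T" using c[of T] T \<rho> diameter_pos[of T] by (auto simp: subset_iff)
      then have "norm (c T - v) \<le> diameter T" using dist_le_diameter T by blast
      then have "s T * norm (c T - v) \<le> \<epsilon>" using s[OF T] by (metis less_imp_le mult_left_mono)
      then have "dist (p T) v \<le> \<epsilon>" using s(1)[OF T] by (simp add: p_def dist_norm)
      then show ?thesis by (simp add: ball_subset_ball_iff algebra_simps)
    qed
    show "ball (p T) (\<rho> * \<epsilon>) \<inter> ball (p T') (\<rho> * \<epsilon>) = {}" if T: "T \<in> ?S" "T' \<in> ?S" "T \<noteq> T'" for T T'
    proof (rule ccontr)
      assume "\<not> ?thesis"
      then obtain x where x: "x \<in> ball (p T) (\<rho> * \<epsilon>) \<inter> ball (p T') (\<rho> * \<epsilon>)" by blast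
      have "open (ball (p T) (\<rho> * \<epsilon>) \<inter> ball (p T') (\<rho> * \<epsilon>))" by (intro open_Int open_ball)
      from openE[OF this x]
      obtain r where r: "r > 0" "ball x r \<subseteq> ball (p T) (\<rho> * \<epsilon>) \<inter> ball (p T') (\<rho> * \<epsilon>)" .
      then have "ball x r \<subseteq> T \<inter> T'" using inT[OF T(1)] inT[OF T(2)] by blast
      then show False using interiors_disjoint[of T T' x r] T r(1) by auto
    qed
  qed (use \<rho> \<epsilon> in auto)
  then show ?thesis using \<epsilon>(1) by (simp add: power_mult_distrib)
qed

lemma card_star: "card {T \<in> \<T>. v \<in> T} \<le> star_size_bound DIM('a) \<rho>"
proof -
  have "real (card {T \<in> \<T>. v \<in> T}) \<le> ((1 + \<rho>) / \<rho>) ^ DIM('a)"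
    using star_card[of v] \<rho> by (simp add: power_divide pos_le_divide_eq)
  then show ?thesis unfolding star_size_bound_def by linarith
qed

text \<open>Elements at \<open>v\<close> that share an edge at \<open>v\<close> have comparable diameters. Sharing only \<open>v\<close> would not be
  enough, as the boundary of the mesh may be pinched at \<open>v\<close>.\<close>

definition star_rel :: "'a set \<Rightarrow> 'a \<Rightarrow> ('a set \<times> 'a set) set" where
  "star_rel \<Omega> v = {(T1, T2). T1 \<in> \<T> \<and> T2 \<in> \<T> \<and> T1 \<inter> \<Omega> \<noteq> {} \<and> T2 \<inter> \<Omega> \<noteq> {} \<and>
     v \<in> vertices T1 \<and> v \<in> vertices T2 \<and> (\<exists>w. w \<noteq> v \<and> w \<in> vertices T1 \<and> w \<in> vertices T2)}"

lemma star_component: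
  assumes T: "T \<in> \<T>" "T \<inter> \<Omega> \<noteq> {}" "v \<in> vertices T" and T': "(T, T') \<in> (star_rel \<Omega> v)\<^sup>*"
  shows "T' \<in> \<T>" "T' \<inter> \<Omega> \<noteq> {}" "v \<in> vertices T'"
    and "star_size_ratio DIM('a) \<rho> * diameter T \<le> diameter T'" "star_size_ratio DIM('a) \<rho> * diameter T' \<le> diameter T"
proof -
  let ?R = "star_rel \<Omega> v"
  have "T' \<in> \<T> \<and> T' \<inter> \<Omega> \<noteq> {} \<and> v \<in> vertices T'"
    using T' T by (induction rule: rtrancl_induct) (auto simp: star_rel_def)
  then show T'2: "T' \<in> \<T>" "T' \<inter> \<Omega> \<noteq> {}" "v \<in> vertices T'" by auto
  have step: "2 * \<rho> * diameter T1 \<le> diameter T2" if "(T1, T2) \<in> ?R \<or> (T2, T1) \<in> ?R" for T1 T2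
  proof -
    obtain w where w: "w \<noteq> v" "w \<in> vertices T1" "w \<in> vertices T2" "v \<in> vertices T1" "v \<in> vertices T2" "T1 \<in> \<T>" "T2 \<in> \<T>"
      using \<open>_ \<or> _\<close> unfolding star_rel_def by blast
    have "2 * \<rho> * diameter T1 \<le> norm (v - w)" by (rule vertex_dist) (use w in auto)
    also have "\<dots> \<le> diameter T2" by (rule dist_le_diameter[OF w(7)]) (use w vertex_mem in auto)
    finally show ?thesis .
  qed
  have pow: "(2 * \<rho>) ^ m * diameter A \<le> diameter B \<and> (2 * \<rho>) ^ m * diameter B \<le> diameter A"
    if "(A, B) \<in> ?R ^^ m" for m A B
    using that
  proof (induction m arbitrary: B)
    case (Suc m)
    then obtain D where D: "(A, D) \<in> ?R ^^ m" "(D, B) \<in> ?R" by auto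
    have "2 * \<rho> * ((2 * \<rho>) ^ m * diameter A) \<le> 2 * \<rho> * diameter D"
      using Suc.IH[OF D(1)] \<rho> by (intro mult_left_mono) auto
    moreover have "(2 * \<rho>) ^ m * (2 * \<rho> * diameter B) \<le> (2 * \<rho>) ^ m * diameter D"
      using step[of B D] D(2) \<rho> by (intro mult_left_mono) auto
    ultimately show ?case using step[of D B] D(2) Suc.IH[OF D(1)] by (simp add: mult_ac)
  qed auto
  \<comment> \<open>Reachability needs at most as many steps as there are related pairs, which
    bounds the exponent in \<open>pow\<close> uniformly.\<close>
  let ?S = "{T \<in> \<T>. v \<in> T}"
  have sub: "?R \<subseteq> ?S \<times> ?S" using vertex_mem by (auto simp: star_rel_def)
  have fin: "finite ?R" by (rule finite_subset[OF sub]) (simp add: finite_mesh)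
  have "card ?R \<le> card (?S \<times> ?S)" by (rule card_mono[OF _ sub]) (simp add: finite_mesh)
  also have "\<dots> \<le> star_size_bound DIM('a) \<rho> * star_size_bound DIM('a) \<rho>"
    unfolding card_cartesian_product by (intro mult_mono card_star) auto
  finally have cR: "card ?R \<le> star_size_bound DIM('a) \<rho> * star_size_bound DIM('a) \<rho>" .
  obtain m where m: "m \<le> card ?R" "(T, T') \<in> ?R ^^ m"
    using T' unfolding rtrancl_finite_eq_relpow[OF fin] by blast
  have "star_size_ratio DIM('a) \<rho> \<le> (2 * \<rho>) ^ m"
    unfolding star_size_ratio_def using \<rho> \<rho>_le[OF T(1)] m(1) cR by (intro power_decreasing) auto
  then have "star_size_ratio DIM('a) \<rho> * diameter A \<le> (2 * \<rho>) ^ m * diameter A" if "A \<in> \<T>" for A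
    using diameter_pos[OF that] by (intro mult_right_mono) auto
  then show "star_size_ratio DIM('a) \<rho> * diameter T \<le> diameter T'" "star_size_ratio DIM('a) \<rho> * diameter T' \<le> diameter T"
    using pow[OF m(2)] T(1) T'2(1) by (meson order_trans)+
qed

lemma size_ratio_pos: "0 < star_size_ratio DIM('a) \<rho>"
  using \<rho> by (simp add: star_size_ratio_def)

end

context shape_regular_mesh begin

text \<open>On the part of the star of \<open>v\<close> that can be reached from \<open>T\<close> without passing through \<open>v\<close>, the
  barycentric coordinates of \<open>v\<close> fit together to a Lipschitz function whose zero set separates that
  part from the rest of the mesh.\<close>

lemma segment_stays_in_star:
  assumes op: "open \<Omega>" and cover: "\<Omega> \<subseteq> \<Union>\<T>"
    and T: "T \<in> \<T>" "T \<inter> \<Omega> \<noteq> {}" "v \<in> vertices T" and v: "v \<notin> \<Omega>"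
    and T1: "(T, T1) \<in> (star_rel \<Omega> v)\<^sup>*" and a: "a \<in> T1"
    and seg: "\<And>s. 0 \<le> s \<Longrightarrow> s < 1 \<Longrightarrow> a + s *\<^sub>R (b - a) \<in> \<Omega>"
    and len: "norm (b - a) / (2 * \<rho> * star_size_ratio DIM('a) \<rho> * diameter T) < bary T1 v a"
  shows "\<exists>T2. (T, T2) \<in> (star_rel \<Omega> v)\<^sup>* \<and> b \<in> T2 \<and>
    bary T1 v a - norm (b - a) / (2 * \<rho> * star_size_ratio DIM('a) \<rho> * diameter T) \<le> bary T2 v b"
proof -
  let ?S = "{T'. (T, T') \<in> (star_rel \<Omega> v)\<^sup>*}"
  \<comment> \<open>With the factor \<open>norm (b - a)\<close> split off, this is the Lipschitz
    constant of the coordinate of \<open>v\<close> on every element of \<open>?S\<close>: their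
    inscribed balls have radius at least
    \<open>\<rho> * star_size_ratio DIM('a) \<rho> * diameter T\<close>.\<close>
  define M where "M = 1 / (2 * \<rho> * star_size_ratio DIM('a) \<rho> * diameter T)"
  have M0: "0 < M" using \<rho> size_ratio_pos diameter_pos[OF T(1)] by (simp add: M_def)
  have S\<T>: "?S \<subseteq> \<T>" using star_component(1)[OF T] by blast
  have fS: "finite ?S" using S\<T> finite_mesh finite_subset by blast
  define y where "y s = a + s *\<^sub>R (b - a)" for s :: real
  have cy: "continuous_on X y" for X unfolding y_def by (intro continuous_intros)
  \<comment> \<open>Any element of \<open>?S\<close> containing the point may be chosen, since the
    coordinates agree on intersections.\<close>
  define \<psi> where "\<psi> p = bary (SOME T'. T' \<in> ?S \<and> p \<in> T') v p" for p
  have \<psi>: "\<psi> p = bary T' v p" if "T' \<in> ?S" "p \<in> T'" for T' p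
  proof -
    have *: "(SOME T'. T' \<in> ?S \<and> p \<in> T') \<in> ?S \<and> p \<in> (SOME T'. T' \<in> ?S \<and> p \<in> T')"
      by (rule someI[of "\<lambda>T'. T' \<in> ?S \<and> p \<in> T'" T']) (use that in blast)
    show ?thesis unfolding \<psi>_def
      by (rule bary_agree) (use * that star_component(1,3)[OF T] in auto)
  qed
  have lip: "(M * norm (b - a))-lipschitz_on {s. y s \<in> T'} (\<lambda>s. \<psi> (y s))" if T': "T' \<in> ?S" for T'
  proof (rule lipschitz_onI)
    fix s u assume su: "s \<in> {s. y s \<in> T'}" "u \<in> {s. y s \<in> T'}"
    have T'2: "T' \<in> \<T>" "v \<in> vertices T'" using star_component(1,3)[OF T] T' by auto
    obtain c where c: "cball c (\<rho> * diameter T') \<subseteq> T'" using inball[OF T'2(1)] by blast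
    define \<beta> where "\<beta> = \<bar>bary T' v (y s) - bary T' v (y u)\<bar>"
    have "\<beta> * (2 * (\<rho> * diameter T')) \<le> norm (y s - y u)"
      unfolding \<beta>_def by (rule bary_lipschitz[OF simplex[OF T'2(1)] _ c]) (use T'2 \<rho> diameter_pos in auto)
    moreover have "\<beta> * (2 * \<rho> * (star_size_ratio DIM('a) \<rho> * diameter T)) \<le> \<beta> * (2 * \<rho> * diameter T')"
      using star_component(4)[OF T, of T'] T' \<rho> by (intro mult_left_mono) (auto simp: \<beta>_def)
    ultimately have "\<beta> * (2 * \<rho> * star_size_ratio DIM('a) \<rho> * diameter T) \<le> norm (y s - y u)" by (simp add: mult_ac)
    then have "\<beta> \<le> M * norm (y s - y u)"
      using \<rho> size_ratio_pos diameter_pos[OF T(1)] by (simp add: M_def pos_le_divide_eq)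
    moreover have "y s - y u = (s - u) *\<^sub>R (b - a)" by (simp add: y_def algebra_simps)
    ultimately show "dist (\<psi> (y s)) (\<psi> (y u)) \<le> M * norm (b - a) * dist s u"
      using \<psi>[OF T'] su by (simp add: dist_real_def \<beta>_def mult_ac)
  qed (use M0 in simp)
  \<comment> \<open>Continuity method: \<open>P\<close> is the set of times up to which the segment
    has stayed in the elements reached. Since these are finitely many closed sets, this persists at
    the supremum, which is then shown to be 1.\<close>
  define P where "P = {s \<in> {0..1}. \<forall>u\<in>{0..s}. y u \<in> \<Union>?S}"
  have P0: "0 \<in> P" using a T1 by (auto simp: P_def y_def)
  have bP: "bdd_above P" by (auto simp: P_def intro!: bdd_aboveI[of _ 1])
  define s where "s = Sup P"
  have "P \<noteq> {}" using P0 by blast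
  have s01: "0 \<le> s" "s \<le> 1"
    unfolding s_def using cSup_upper[OF P0 bP] cSup_least[OF \<open>P \<noteq> {}\<close>, of 1] by (auto simp: P_def)
  have cU: "closed (y -` \<Union>?S)"
  proof -
    have "closed (\<Union>?S)" using fS S\<T> compact_elem compact_imp_closed by (intro closed_Union) auto
    then show ?thesis using cy[of UNIV] by (simp add: continuous_closed_vimage continuous_on_eq_continuous_at)
  qed
  have below: "y u \<in> \<Union>?S" if u: "0 \<le> u" "u < s" for u
  proof -
    obtain p where "p \<in> P" "u < p"
      using u(2) less_cSup_iff[OF \<open>P \<noteq> {}\<close> bP, of u] unfolding s_def by blast
    then show ?thesis using u(1) by (auto simp: P_def)
  qed
  have ys: "y s \<in> \<Union>?S"
  proof (cases "s = 0")
    case True then show ?thesis using P0 by (auto simp: P_def)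
  next
    case False
    have "s \<in> closure {0..<s}" using False s01 by (simp add: closure_atLeastLessThan)
    moreover have "{0..<s} \<subseteq> y -` \<Union>?S" using below by auto
    ultimately show ?thesis using closure_minimal[OF _ cU] by blast
  qed
  have onS: "{0..s} \<subseteq> (\<Union>T'\<in>?S. {s. y s \<in> T'})"
  proof
    fix u assume "u \<in> {0..s}"
    then have "y u \<in> \<Union>?S" using below[of u] ys by (cases "u = s") auto
    then show "u \<in> (\<Union>T'\<in>?S. {s. y s \<in> T'})" by auto
  qed
  have "(M * norm (b - a))-lipschitz_on {0..s} (\<lambda>s. \<psi> (y s))"
  proof (rule lipschitz_on_closed_Union[OF lip _ fS _ onS])
    show "closed {s. y s \<in> T'}" if "T' \<in> ?S" for T'
    proof -
      have "closed T'" using that S\<T> compact_elem compact_imp_closed by blast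
      then show ?thesis using cy[of UNIV]
        using continuous_closed_vimage[of T' y] by (simp add: vimage_def continuous_on_eq_continuous_at)
    qed
  qed (use M0 in auto)
  from lipschitz_onD[OF this, of 0 s] have "\<bar>\<psi> (y 0) - \<psi> (y s)\<bar> \<le> M * norm (b - a) * s"
    using s01 by (simp add: dist_real_def)
  also have "\<dots> \<le> M * norm (b - a)" using s01 M0 by (simp add: mult_left_le)
  finally have "\<bar>\<psi> (y 0) - \<psi> (y s)\<bar> \<le> M * norm (b - a)" .
  moreover have "\<psi> (y 0) = bary T1 v a" using \<psi>[of T1 a] T1 a by (simp add: y_def)
  moreover have Mb: "M * norm (b - a) = norm (b - a) / (2 * \<rho> * star_size_ratio DIM('a) \<rho> * diameter T)" by (simp add: M_def)
  ultimately have low: "bary T1 v a - norm (b - a) / (2 * \<rho> * star_size_ratio DIM('a) \<rho> * diameter T) \<le> \<psi> (y s)" by simp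
  have pos: "0 < \<psi> (y s)" using low len by simp
  \<comment> \<open>At an earlier stopping time the point is in \<open>\<Omega>\<close>, so it
    differs from \<open>v\<close>, and its coordinate is positive. Every element containing it then
    shares \<open>v\<close> and a further vertex with a reached element, so it is reached
    too.\<close>
  have "s = 1"
  proof (rule ccontr)
    assume "s \<noteq> 1"
    then have s1: "s < 1" using s01 by simp
    then have yO: "y s \<in> \<Omega>" using seg[of s] s01 by (simp add: y_def)
    then have yv: "y s \<noteq> v" using v by auto
    obtain T' where T': "T' \<in> ?S" "y s \<in> T'" using ys by blast
    have T'2: "T' \<in> \<T>" "v \<in> vertices T'" "T' \<inter> \<Omega> \<noteq> {}" using star_component(1-3)[OF T] T' by auto
    have near: "T'' \<in> ?S" if T'': "T'' \<in> \<T>" "y s \<in> T''" for T''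
    proof -
      have "v \<in> vertices T''"
        by (rule bary_pos_mem[OF T'2(1) T''(1) T'2(2), of "y s"]) (use T'(2) T''(2) pos \<psi>[OF T'] in auto)
      moreover have "\<exists>w. w \<noteq> v \<and> w \<in> vertices T' \<and> w \<in> vertices T''"
        by (rule shared_edge[OF T'2(1) T''(1), of "y s"]) (use T'(2) T''(2) yv in auto)
      ultimately have "(T', T'') \<in> star_rel \<Omega> v"
        using T'2 T'' yO by (auto simp: star_rel_def)
      then show ?thesis using T'(1) by auto
    qed
    \<comment> \<open>A neighbourhood of \<open>y s\<close> that meets only elements containing
      \<open>y s\<close>.\<close>
    define W where "W = \<Omega> - \<Union>{T'' \<in> \<T>. y s \<notin> T''}"
    have "open W" unfolding W_def
      by (intro open_Diff op closed_Union) (use finite_mesh compact_elem compact_imp_closed in auto)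
    moreover have "y s \<in> W" using yO by (auto simp: W_def)
    moreover have "isCont y s" using cy[of UNIV] by (simp add: continuous_on_eq_continuous_at)
    ultimately obtain d where d: "d > 0" "\<And>u. dist u s < d \<Longrightarrow> y u \<in> W"
      unfolding continuous_at_open by (metis (no_types, lifting) open_contains_ball_eq mem_ball dist_commute subsetD)
    have WU: "W \<subseteq> \<Union>?S"
    proof
      fix p assume p: "p \<in> W"
      then obtain T'' where "T'' \<in> \<T>" "p \<in> T''" using cover by (auto simp: W_def)
      then show "p \<in> \<Union>?S" using p near by (auto simp: W_def)
    qed
    define e where "e = min (d / 2) (1 - s)"
    have e: "0 < e" "e < d" "s + e \<le> 1" using d(1) s1 by (auto simp: e_def)
    have "s + e \<in> P"
      unfolding P_def
    proof (intro CollectI conjI ballI)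
      fix u assume u: "u \<in> {0..s + e}"
      show "y u \<in> \<Union>?S"
      proof (cases "u < s")
        case True then show ?thesis using below u by auto
      next
        case False
        then have "dist u s < d" using u e by (simp add: dist_real_def)
        then show ?thesis using d(2) WU by blast
      qed
    qed (use s01 e in auto)
    then have "s + e \<le> s" unfolding s_def by (rule cSup_upper[OF _ bP])
    then show False using e by simp
  qed
  then have "y s = b" by (simp add: y_def)
  then obtain T2 where T2: "T2 \<in> ?S" "b \<in> T2" using ys by auto
  then show ?thesis using low \<psi>[OF T2] \<open>y s = b\<close> by auto
qed

end

section \<open>Boundary measure near a cut element\<close>

text \<open>The maximum with 1 keeps the constant positive for every \<open>\<sigma>\<close>. The
  factor 2 avoids the question whether the supremum in \<open>inradius\<close> is attained.\<close>

lemma shape_regular_imp_mesh: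
  fixes \<T> :: "'a::euclidean_space set set"
  assumes tri: "triangulation \<T>" and sim: "\<And>T. T \<in> \<T> \<Longrightarrow> int DIM('a) simplex T"
    and reg: "shape_regular \<sigma> \<T>"
  shows "shape_regular_mesh \<T> (1 / (2 * max \<sigma> 1))"
proof
  show "triangulation \<T>" by (rule tri)
  show "int DIM('a) simplex T" if "T \<in> \<T>" for T using sim that .
  show "0 < 1 / (2 * max \<sigma> 1)" by simp
  fix T assume T: "T \<in> \<T>"
  note V = simplex_vertices[OF sim[OF T]]
  have bT: "bounded T" using sim[OF T] compact_simplex compact_imp_bounded by blast
  let ?I = "{r. \<exists>x. cball x r \<subseteq> T}"
  obtain e :: 'a where e: "norm e = 1" using norm_Basis[OF SOME_Basis] by blast
  \<comment> \<open>Balls of negative radius are empty, so negative numbers belong to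
    \<open>?I\<close> and are treated separately.\<close>
  have le: "r \<le> diameter T" if r: "r \<in> ?I" for r
  proof (cases "r \<ge> 0")
    case True
    obtain x where "cball x r \<subseteq> T" using r by blast
    then have "x \<in> T" "x + r *\<^sub>R e \<in> T" using True e by (auto simp: subset_iff dist_norm)
    from diameter_bounded_bound[OF bT this] show ?thesis using True e by (simp add: dist_norm)
  next
    case False
    then show ?thesis using diameter_ge_0[OF bT] by simp
  qed
  then have bdd: "bdd_above ?I" by (auto intro!: bdd_aboveI)
  have "\<not> card (vertices T) \<le> Suc 0" using V(2) by simp
  then obtain v w where vw: "v \<in> vertices T" "w \<in> vertices T" "v \<noteq> w"
    using card_le_Suc0_iff_eq[OF V(1)] by blast
  then have vwT: "v \<in> T" "w \<in> T" by (auto simp: extreme_point_of_def)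
  have d: "0 < diameter T"
    using diameter_bounded_bound[OF bT vwT] vw(3) zero_less_dist_iff[of v w] by linarith
  have "0 \<in> ?I" using vwT(1) by (auto intro!: exI[of _ v])
  then have i0: "0 \<le> inradius T" unfolding inradius_def by (rule cSup_upper[OF _ bdd])
  have "diameter T \<le> \<sigma> * inradius T" using reg T by (auto simp: shape_regular_def)
  also have "\<dots> \<le> max \<sigma> 1 * inradius T" using i0 by (intro mult_right_mono) auto
  finally have di: "diameter T \<le> max \<sigma> 1 * inradius T" .
  then have "inradius T \<noteq> 0" using d by auto
  then have "inradius T / 2 < Sup ?I" using i0 by (simp add: inradius_def)
  then obtain r where r: "r \<in> ?I" "inradius T / 2 < r"
    using less_cSup_iff[OF _ bdd] \<open>0 \<in> ?I\<close> by blast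
  then obtain x where x: "cball x r \<subseteq> T" by blast
  have "1 / (2 * max \<sigma> 1) * diameter T \<le> inradius T / 2"
    using di by (simp add: pos_divide_le_eq mult_ac)
  then have "cball x (1 / (2 * max \<sigma> 1) * diameter T) \<subseteq> cball x r" using r(2) by (auto intro: order_trans)
  then show "\<exists>c. cball c (1 / (2 * max \<sigma> 1) * diameter T) \<subseteq> T" using x by blast
qed

lemma exists_large_summand:
  fixes f :: "'i \<Rightarrow> ennreal"
  assumes "finite I" "card I \<le> N" "ennreal q \<le> (\<Sum>i\<in>I. f i)" "0 < q"
  shows "\<exists>i\<in>I. ennreal (q / N) \<le> f i"
proof -
  have ne: "I \<noteq> {}" using assms(3,4) by auto
  then have N: "0 < N" using assms(1,2) by (metis card_gt_0_iff le_zero_eq not_gr_zero)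
  have "Max (f ` I) \<in> f ` I" by (rule Max_in) (use assms(1) ne in auto)
  from imageE[OF this] obtain j where j: "Max (f ` I) = f j" "j \<in> I" .
  have le: "f i \<le> f j" if "i \<in> I" for i
    unfolding j(1)[symmetric] using assms(1) that by (intro Max_ge) auto
  have "(\<Sum>i\<in>I. f i) \<le> of_nat (card I) * f j"
    by (rule sum_bounded_above[OF le])
  also have "\<dots> \<le> of_nat N * f j" using assms(2) by (intro mult_right_mono) auto
  finally have "ennreal (real N) * ennreal (q / N) \<le> ennreal (real N) * f j"
    using assms(3,4) N by (simp add: ennreal_mult[symmetric] ennreal_of_nat_eq_real_of_nat)
  then have "ennreal (q / N) \<le> f j" using N by (subst (asm) ennreal_mult_le_mult_iff) auto
  then show ?thesis using j(2) by blast
qed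

text \<open>The key geometric fact. An element that meets the domain but has no vertex in it shares a
  vertex with an element of comparable size in which the boundary has large measure: starting near the
  boundary, go up a cone to a ball inside the domain and then straight down. All these paths end on the
  boundary, they are too short to leave the star of a suitable vertex, and their end points cast a
  large shadow.\<close>

lemma boundary_rich_neighbour:
  assumes dim: "2 \<le> DIM('a::euclidean_space)" and \<Omega>: "lipschitz_domain (\<Omega> :: 'a set)" "bounded \<Omega>"
    and meas: "measure_space UNIV (sets borel) (hausdorff_outer (DIM('a) - 1) :: 'a set \<Rightarrow> ennreal)"
    and \<rho>: "0 < \<rho>" and D: "0 < D"
  shows "\<exists>c>0. \<forall>\<T> T. shape_regular_mesh \<T> \<rho> \<longrightarrow> (\<forall>T\<in>\<T>. diameter T \<le> D) \<longrightarrow> \<Omega> \<subseteq> \<Union>\<T> \<longrightarrow>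
    T \<in> \<T> \<longrightarrow> T \<inter> \<Omega> \<noteq> {} \<longrightarrow> vertices T \<inter> \<Omega> = {} \<longrightarrow>
    (\<exists>T'\<in>\<T>. \<exists>v. T' \<inter> \<Omega> \<noteq> {} \<and> v \<in> vertices T \<and> v \<in> vertices T' \<and>
      star_size_ratio DIM('a) \<rho> * diameter T \<le> diameter T' \<and>
      ennreal (c * diameter T' ^ (DIM('a) - 1)) \<le> emeasure surface_measure (T' \<inter> frontier \<Omega>))"
proof -
  have op: "open \<Omega>" using \<Omega>(1) by (simp add: lipschitz_domain_def)
  obtain r \<kappa> where \<kappa>: "0 \<le> \<kappa>" "\<kappa> < 1" and r: "0 < r"
    and cone: "\<And>z. z \<in> frontier \<Omega> \<Longrightarrow> \<exists>n. cone_property \<Omega> (ball z r) n \<kappa>"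
    using lipschitz_domain_uniform_cone[OF \<Omega>] by metis
  obtain cH where cH: "cH > 0" "\<And>S x \<delta> t \<nu>. 0 < \<delta> \<Longrightarrow> 0 < t \<Longrightarrow> norm \<nu> = 1 \<Longrightarrow>
    \<forall>y\<in>ball (x::'a) \<delta>. \<exists>p\<in>S. \<exists>s\<in>{-t..t}. y = p + s *\<^sub>R \<nu> \<Longrightarrow>
    ennreal (cH * \<delta> ^ DIM('a) / t) \<le> hausdorff_outer (DIM('a) - 1) S"
    using hausdorff_outer_ge_shadow[OF dim] by blast
  define n where "n = DIM('a)"
  define m where "m = n - 1"
  have nm: "n = Suc m" using dim by (simp add: n_def m_def)
  define \<theta> where "\<theta> = star_size_ratio n \<rho>"
  define N where "N = star_size_bound n \<rho>"
  have \<theta>: "0 < \<theta>" using \<rho> by (simp add: \<theta>_def star_size_ratio_def)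
  define \<eta> where "\<eta> = (1 - \<kappa>) / 4"
  have \<eta>: "0 < \<eta>" "\<eta> \<le> 1 / 4" using \<kappa> by (auto simp: \<eta>_def)
  \<comment> \<open>Path length in units of \<open>h\<close>. The first bound makes the paths short
    against a coordinate of size \<open>1 / (n + 1)\<close>, the second gives
    \<open>5 * t \<le> r\<close> from \<open>h \<le> D\<close>.\<close>
  define \<tau> where "\<tau> = min (\<rho> * \<theta> / (4 * (real n + 1))) (r / (5 * D))"
  have \<tau>: "0 < \<tau>" "\<tau> \<le> \<rho> * \<theta> / (4 * (real n + 1))" "\<tau> \<le> r / (5 * D)" using \<rho> \<theta> r D by (auto simp: \<tau>_def)
  \<comment> \<open>The shadow bound is
    \<open>cH * (\<eta> * t) ^ n / t = cH * \<eta> ^ n * t ^ m\<close>; here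
    \<open>t = \<tau> * h\<close> is at least \<open>\<tau> * \<theta> * diameter T'\<close>, and
    one of at most \<open>N + 1\<close> elements carries its share.\<close>
  define c where "c = cH * \<eta> ^ n * (\<tau> * \<theta>) ^ m / (real N + 1)"
  have c0: "0 < c" using cH(1) \<eta> \<tau> \<theta> by (simp add: c_def)
  have main: "\<exists>T'\<in>\<T>. \<exists>v. T' \<inter> \<Omega> \<noteq> {} \<and> v \<in> vertices T \<and> v \<in> vertices T' \<and> \<theta> * diameter T \<le> diameter T' \<and>
      ennreal (c * diameter T' ^ m) \<le> emeasure surface_measure (T' \<inter> frontier \<Omega>)"
    if mesh: "shape_regular_mesh \<T> \<rho>" and diam: "\<And>T. T \<in> \<T> \<Longrightarrow> diameter T \<le> D" and cover: "\<Omega> \<subseteq> \<Union>\<T>"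
      and T: "T \<in> \<T>" "T \<inter> \<Omega> \<noteq> {}" "vertices T \<inter> \<Omega> = {}" for \<T> T
  proof -
    interpret shape_regular_mesh \<T> \<rho> by (rule mesh)
    define h where "h = diameter T"
    have h: "0 < h" "h \<le> D" using diameter_pos[OF T(1)] diam[OF T(1)] by (auto simp: h_def)
    define t where "t = \<tau> * h"
    have t0: "0 < t" using \<tau> h by (simp add: t_def)
    have t5: "5 * t \<le> r"
    proof -
      have "t \<le> r / (5 * D) * D" unfolding t_def using \<tau> h r by (intro mult_mono) auto
      then show ?thesis using D by simp
    qed
    define M where "M = 1 / (2 * \<rho> * \<theta> * h)"
    have M0: "0 < M" using \<rho> \<theta> h by (simp add: M_def)
    have half: "x / 2 < x" if "0 < x" for x :: real using that by simp
    \<comment> \<open>Up and down, a path has length at most \<open>4 * t\<close>, so the loss of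
      the coordinate is at most half of \<open>1 / (n + 1)\<close>.\<close>
    have tM: "4 * t * M < 1 / (real n + 1)"
    proof -
      have "4 * t * M = 2 * \<tau> / (\<rho> * \<theta>)" using h \<rho> \<theta> by (simp add: t_def M_def field_simps)
      also have "\<dots> \<le> 2 * (\<rho> * \<theta> / (4 * (real n + 1))) / (\<rho> * \<theta>)"
        using \<tau>(2) \<rho> \<theta> by (intro divide_right_mono mult_left_mono) auto
      also have "\<dots> = 1 / (real n + 1) / 2" using \<rho> \<theta> by (simp add: divide_simps)
      also have "\<dots> < 1 / (real n + 1)" by (rule half) simp
      finally show ?thesis .
    qed
    obtain x0 where x0: "x0 \<in> T" "x0 \<in> \<Omega>" using T(2) by blast
    obtain v0 where v0: "v0 \<in> vertices T" using simplex_vertices(2)[OF simplex[OF T(1)]]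
      by (metis Suc_eq_plus1 card.empty ex_in_conv nat.distinct(1))
    then have v0T: "v0 \<in> T" "v0 \<notin> \<Omega>" using vertex_mem T(3) by blast+
    obtain s where s: "0 < s" "s \<le> 1" "x0 + s *\<^sub>R (v0 - x0) \<in> frontier \<Omega>"
      "\<And>u. 0 \<le> u \<Longrightarrow> u < s \<Longrightarrow> x0 + u *\<^sub>R (v0 - x0) \<in> \<Omega>"
      using exit_point[OF op x0(2) v0T(2)] by blast
    define z where "z = x0 + s *\<^sub>R (v0 - x0)"
    \<comment> \<open>From the exit point \<open>z\<close> go back towards \<open>x0\<close> by at
      most \<open>\<eta> * t\<close>, to a point of \<open>T\<close> that lies in the
      domain.\<close>
    define u where "u = max 0 (s - \<eta> * t / h)"
    have u: "0 \<le> u" "u < s" "s - u \<le> \<eta> * t / h" using s(1) \<eta> t0 h by (auto simp: u_def max_def)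
    define x where "x = x0 + u *\<^sub>R (v0 - x0)"
    have xO: "x \<in> \<Omega>" unfolding x_def by (rule s(4)[OF u(1,2)])
    have "x = (1 - u) *\<^sub>R x0 + u *\<^sub>R v0" by (simp add: x_def algebra_simps)
    then have xT: "x \<in> T" using convexD[OF convex_elem[OF T(1)] x0(1) v0T(1), of "1 - u" u] u s(2) by simp
    have xz: "norm (x - z) \<le> \<eta> * t"
    proof -
      have "x - z = (u - s) *\<^sub>R (v0 - x0)" by (simp add: x_def z_def algebra_simps)
      then have "norm (x - z) = (s - u) * norm (v0 - x0)" using u by simp
      also have "\<dots> \<le> (\<eta> * t / h) * h"
        using u \<eta> t0 h dist_le_diameter[OF T(1) v0T(1) x0(1)] by (intro mult_mono) (auto simp: h_def)
      finally show ?thesis using h by simp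
    qed
    have zF: "z \<in> frontier \<Omega>" using s(3) by (simp add: z_def)
    obtain \<nu> where \<nu>: "cone_property \<Omega> (ball z r) \<nu> \<kappa>" using cone[OF zF] by blast
    have n\<nu>: "norm \<nu> = 1" using \<nu> by (simp add: cone_property_def)
    \<comment> \<open>A vertex whose coordinate at \<open>x\<close> is large enough for its star to
      contain the paths.\<close>
    obtain v where v: "v \<in> vertices T" "1 / (real n + 1) \<le> bary T v x"
      using bary_bounds(3)[OF simplex[OF T(1)] xT] by (auto simp: n_def add.commute)
    have vO: "v \<notin> \<Omega>" using v(1) T(3) by blast
    let ?S = "{T'. (T, T') \<in> (star_rel \<Omega> v)\<^sup>*}"
    note comp = star_component[OF T(1,2) v(1)]
    have S\<T>: "?S \<subseteq> \<T>" using comp(1) by blast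
    have fS: "finite ?S" using S\<T> finite_mesh finite_subset by blast
    let ?G = "frontier \<Omega> \<inter> \<Union>?S"
    \<comment> \<open>Varying \<open>w\<close> moves the top of the descent over a ball. Each
      landing point \<open>p\<close> is a translate of \<open>y\<close> along \<open>\<nu>\<close>
      by at most \<open>t\<close>, so the landing points have the whole ball as their
      shadow.\<close>
    have shadow: "\<exists>p\<in>?G. \<exists>q\<in>{-t..t}. y = p + q *\<^sub>R \<nu>" if y: "y \<in> ball x (\<eta> * t)" for y
    proof -
      define w where "w = y - x"
      have w: "norm w \<le> \<eta> * t" using y by (simp add: w_def dist_norm norm_minus_commute)
      define b where "b = x + t *\<^sub>R \<nu> + w"
      note cross = cone_property_crossing[OF \<nu> \<kappa> op xO zF t0 t5, of w, folded \<eta>_def, OF xz w, folded b_def]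
      obtain q where q: "0 < q" "q \<le> 1" "b - (q * (2 * t)) *\<^sub>R \<nu> \<in> frontier \<Omega>"
        "\<And>u. 0 \<le> u \<Longrightarrow> u < q \<Longrightarrow> b - (u * (2 * t)) *\<^sub>R \<nu> \<in> \<Omega>"
        using cross(2) by blast
      define p where "p = b - (q * (2 * t)) *\<^sub>R \<nu>"
      have nb: "norm (b - x) \<le> 2 * t"
      proof -
        have "norm (b - x) \<le> norm (t *\<^sub>R \<nu>) + norm w"
          unfolding b_def using norm_triangle_ineq[of "t *\<^sub>R \<nu>" w] by (simp add: algebra_simps)
        moreover have "norm (t *\<^sub>R \<nu>) = t" using n\<nu> t0 by simp
        moreover have "\<eta> * t \<le> 1 / 4 * t" using \<eta> t0 by (intro mult_right_mono) auto
        ultimately show ?thesis using w t0 by linarith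
      qed
      have np: "norm (p - b) \<le> 2 * t" using q t0 n\<nu> by (simp add: p_def mult_left_le_one_le)
      have Mb: "norm (b - x) / (2 * \<rho> * star_size_ratio DIM('a) \<rho> * diameter T) \<le> 2 * t * M"
        using nb M0 mult_right_mono[OF nb, of M] by (simp add: M_def \<theta>_def n_def h_def)
      have Mp: "norm (p - b) / (2 * \<rho> * star_size_ratio DIM('a) \<rho> * diameter T) \<le> 2 * t * M"
        using np M0 mult_right_mono[OF np, of M] by (simp add: M_def \<theta>_def n_def h_def)
      have "\<exists>T2. (T, T2) \<in> (star_rel \<Omega> v)\<^sup>* \<and> b \<in> T2 \<and>
          bary T v x - norm (b - x) / (2 * \<rho> * star_size_ratio DIM('a) \<rho> * diameter T) \<le> bary T2 v b"
      proof (rule segment_stays_in_star[OF op cover T(1,2) v(1) vO _ xT])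
        show "norm (b - x) / (2 * \<rho> * star_size_ratio DIM('a) \<rho> * diameter T) < bary T v x"
          using Mb tM v(2) mult_pos_pos[OF t0 M0] by linarith
      qed (use cross(1) in auto)
      then obtain T2 where T2: "(T, T2) \<in> (star_rel \<Omega> v)\<^sup>*" "b \<in> T2"
        "bary T v x - norm (b - x) / (2 * \<rho> * star_size_ratio DIM('a) \<rho> * diameter T) \<le> bary T2 v b" by blast
      have "\<exists>T3. (T, T3) \<in> (star_rel \<Omega> v)\<^sup>* \<and> p \<in> T3 \<and>
          bary T2 v b - norm (p - b) / (2 * \<rho> * star_size_ratio DIM('a) \<rho> * diameter T) \<le> bary T3 v p"
      proof (rule segment_stays_in_star[OF op cover T(1,2) v(1) vO T2(1,2)])
        show "norm (p - b) / (2 * \<rho> * star_size_ratio DIM('a) \<rho> * diameter T) < bary T2 v b"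
          using Mb Mp tM v(2) T2(3) by linarith
        show "b + u *\<^sub>R (p - b) \<in> \<Omega>" if "0 \<le> u" "u < 1" for u
        proof -
          have "u * q < q" "0 \<le> u * q" using that q(1) by auto
          then have "b - ((u * q) * (2 * t)) *\<^sub>R \<nu> \<in> \<Omega>" by (intro q(4))
          then show ?thesis by (simp add: p_def mult_ac)
        qed
      qed
      then obtain T3 where "T3 \<in> ?S" "p \<in> T3" by blast
      then have "p \<in> ?G" using q(3) by (auto simp: p_def)
      moreover have "y = p + (2 * t * q - t) *\<^sub>R \<nu>" by (simp add: p_def b_def w_def algebra_simps)
      moreover have "2 * t * q - t \<in> {-t..t}" using q t0 by (auto simp: mult_left_le)
      ultimately show ?thesis by blast
    qed
    have closedT: "closed T'" if "T' \<in> ?S" for T' using that S\<T> compact_elem compact_imp_closed by blast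
    have B: "T' \<inter> frontier \<Omega> \<in> sets borel" if "T' \<in> ?S" for T' using closedT[OF that] by auto
    have BG: "?G \<in> sets borel"
    proof -
      have "closed (\<Union>?S)" using closedT fS by (intro closed_Union) auto
      then show ?thesis by auto
    qed
    have "ennreal (cH * (\<eta> * t) ^ n / t) \<le> hausdorff_outer m ?G"
      unfolding n_def m_def by (rule cH(2)[of _ _ \<nu>]) (use shadow \<eta> t0 n\<nu> in auto)
    also have "\<dots> = emeasure surface_measure ?G"
      using emeasure_hausdorff_measure(2)[OF BG meas] by (simp add: m_def n_def)
    also have "?G = (\<Union>T'\<in>?S. T' \<inter> frontier \<Omega>)" by blast
    also have "emeasure surface_measure \<dots> \<le> (\<Sum>T'\<in>?S. emeasure surface_measure (T' \<inter> frontier \<Omega>))"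
      by (rule emeasure_subadditive_finite[OF fS]) (use B in \<open>blast intro: emeasure_hausdorff_measure(1)\<close>)
    finally have big: "ennreal (cH * (\<eta> * t) ^ n / t) \<le> (\<Sum>T'\<in>?S. emeasure surface_measure (T' \<inter> frontier \<Omega>))" .
    have "?S \<subseteq> {T' \<in> \<T>. v \<in> T'}" using comp(1,3) vertex_mem by blast
    then have "card ?S \<le> card {T' \<in> \<T>. v \<in> T'}" by (rule card_mono[rotated]) (simp add: finite_mesh)
    also have "\<dots> \<le> N + 1" using card_star[of v] by (simp add: N_def n_def)
    finally have cS: "card ?S \<le> N + 1" .
    have q0: "0 < cH * (\<eta> * t) ^ n / t" using cH(1) \<eta> t0 by simp
    obtain T' where T': "T' \<in> ?S"
      "ennreal (cH * (\<eta> * t) ^ n / t / (N + 1)) \<le> emeasure surface_measure (T' \<inter> frontier \<Omega>)"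
      using exists_large_summand[OF fS cS big q0] by blast
    have "c * diameter T' ^ m \<le> cH * (\<eta> * t) ^ n / t / (real N + 1)"
    proof -
      have dT': "0 < diameter T'" using diameter_pos S\<T> T'(1) by blast
      have "\<tau> * (\<theta> * diameter T') \<le> \<tau> * h"
        using comp(5)[of T'] T'(1) \<tau> by (intro mult_left_mono) (auto simp: \<theta>_def n_def h_def)
      then have "(\<tau> * (\<theta> * diameter T')) ^ m \<le> t ^ m" using \<tau> \<theta> dT' by (intro power_mono) (auto simp: t_def)
      then have "cH * \<eta> ^ n * (\<tau> * (\<theta> * diameter T')) ^ m \<le> cH * \<eta> ^ n * t ^ m"
        using cH(1) \<eta> by (intro mult_left_mono) auto
      also have "\<dots> = cH * (\<eta> * t) ^ n / t" using t0 by (simp add: nm power_mult_distrib)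
      finally have "cH * \<eta> ^ n * (\<tau> * (\<theta> * diameter T')) ^ m / (real N + 1) \<le> cH * (\<eta> * t) ^ n / t / (real N + 1)"
        by (intro divide_right_mono) auto
      then show ?thesis by (simp add: c_def power_mult_distrib mult_ac)
    qed
    then have "ennreal (c * diameter T' ^ m) \<le> ennreal (cH * (\<eta> * t) ^ n / t / (N + 1))"
      by (intro ennreal_leI) (simp add: add.commute)
    then have "ennreal (c * diameter T' ^ m) \<le> emeasure surface_measure (T' \<inter> frontier \<Omega>)"
      using T'(2) by (rule order_trans)
    moreover have "T' \<in> \<T>" "T' \<inter> \<Omega> \<noteq> {}" "v \<in> vertices T'" "\<theta> * diameter T \<le> diameter T'"
      using comp[of T'] T'(1) by (auto simp: \<theta>_def n_def)
    ultimately show ?thesis using v(1) by blast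
  qed
  show ?thesis
  proof (intro exI[of _ c] conjI allI impI c0)
    fix \<T> T
    assume "shape_regular_mesh \<T> \<rho>" "\<forall>T\<in>\<T>. diameter T \<le> D" "\<Omega> \<subseteq> \<Union>\<T>"
      "T \<in> \<T>" "T \<inter> \<Omega> \<noteq> {}" "vertices T \<inter> \<Omega> = {}"
    then show "\<exists>T'\<in>\<T>. \<exists>v. T' \<inter> \<Omega> \<noteq> {} \<and> v \<in> vertices T \<and> v \<in> vertices T' \<and>
      star_size_ratio DIM('a) \<rho> * diameter T \<le> diameter T' \<and>
      ennreal (c * diameter T' ^ (DIM('a) - 1)) \<le> emeasure surface_measure (T' \<inter> frontier \<Omega>)"
      by (intro main[unfolded \<theta>_def m_def n_def]) (auto simp only:)
  qed
qed

section \<open>Finite element functions on single elements\<close>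

lemma borel_measurable_hausdorff_measure:
  fixes f :: "'a::euclidean_space \<Rightarrow> 'b::topological_space"
  assumes "f \<in> borel_measurable borel"
  shows "f \<in> borel_measurable (hausdorff_measure n)"
proof (rule measurableI)
  fix A :: "'b set" assume "A \<in> sets borel"
  then have "f -` A \<inter> UNIV \<in> sets borel" using measurable_sets[OF assms, of A] by simp
  then show "f -` A \<inter> space (hausdorff_measure n) \<in> sets (hausdorff_measure n)"
    by (simp add: hausdorff_measure_def)
qed simp

lemma set_integrable_surface_measure:
  fixes f :: "'a::euclidean_space \<Rightarrow> real"
  assumes S: "compact S" and f: "continuous_on UNIV f" and fin: "emeasure (hausdorff_measure n) S < \<infinity>"
  shows "set_integrable (hausdorff_measure n) S f"
proof -
  have SB: "S \<in> sets borel" using S by (simp add: borel_compact)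
  have "bounded (f ` S)"
    by (intro compact_imp_bounded compact_continuous_image S continuous_on_subset[OF f]) auto
  then obtain B where B: "\<And>x. x \<in> S \<Longrightarrow> norm (f x) \<le> B" unfolding bounded_iff by blast
  show ?thesis unfolding set_integrable_def
  proof (rule integrableI_bounded_set[OF emeasure_hausdorff_measure(1)[OF SB] _ fin])
    show "(\<lambda>x. indicator S x *\<^sub>R f x) \<in> borel_measurable (hausdorff_measure n)"
      using SB f by (intro borel_measurable_hausdorff_measure borel_measurable_scaleR borel_measurable_indicator
          borel_measurable_continuous_onI)
  qed (use B in \<open>auto simp: indicator_def\<close>)
qed

lemma continuous_on_poly_gradient:
  fixes p :: "'a::euclidean_space \<Rightarrow> real"
  assumes "p \<in> poly_space k" shows "continuous_on S (grad UNIV p)"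
  by (subst continuous_on_componentwise) (intro ballI poly_space_continuous_on[OF poly_space_gradient(2)[OF assms]])

text \<open>The gradient is that of the restriction to the active domain, as in
  \<open>norm_b_sq\<close>, and not to \<open>T\<close>; for finite element functions both agree in
  the interior of \<open>T\<close>.\<close>

definition elem_energy :: "'a::euclidean_space set \<Rightarrow> 'a set set \<Rightarrow> 'a set \<Rightarrow> ('a \<Rightarrow> real) \<Rightarrow> real" where
  "elem_energy \<Omega> \<T> T u = (LINT x:T|lebesgue. grad (active_domain \<Omega> \<T>) u x \<bullet> grad (active_domain \<Omega> \<T>) u x)"

definition elem_trace :: "'a::euclidean_space set \<Rightarrow> 'a set \<Rightarrow> ('a \<Rightarrow> real) \<Rightarrow> real" where
  "elem_trace \<Omega> T u = l2 surface_measure (T \<inter> frontier \<Omega>) u u"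

definition elem_norm :: "real \<Rightarrow> 'a::euclidean_space set \<Rightarrow> 'a set set \<Rightarrow> 'a set \<Rightarrow> ('a \<Rightarrow> real) \<Rightarrow> real" where
  "elem_norm \<gamma> \<Omega> \<T> T u = elem_energy \<Omega> \<T> T u + \<gamma> * (elem_trace \<Omega> T u / diameter T)"

text \<open>\<open>active\<close> and \<open>finite_trace\<close> hold what the assembly of local
  contributions has to know about the surface measure; both are proved where the locale is
  instantiated.\<close>

locale cut_fem = shape_regular_mesh \<T> \<rho> for \<T> :: "'a::euclidean_space set set" and \<rho> +
  fixes \<Omega> :: "'a set" and k :: nat
  assumes open_domain: "open \<Omega>" and cover: "\<Omega> \<subseteq> \<Union>\<T>"
    and active: "active_mesh \<Omega> \<T> = {T \<in> \<T>. T \<inter> \<Omega> \<noteq> {}}"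
    and k: "1 \<le> k" and dim: "2 \<le> DIM('a)"
    and finite_trace: "T \<in> \<T> \<Longrightarrow> emeasure surface_measure (T \<inter> frontier \<Omega>) < \<infinity>"
begin

lemma active_mem: "T \<in> active_mesh \<Omega> \<T> \<Longrightarrow> T \<in> \<T>"
  by (simp add: active)

lemma finite_active: "finite (active_mesh \<Omega> \<T>)"
  using finite_mesh by (simp add: active)

text \<open>Nodes on the frontier of the active domain therefore lie outside
  \<open>\<Omega>\<close>, which makes boundary combinations vanish at every vertex in
  \<open>\<Omega>\<close>.\<close>

lemma domain_interior: "\<Omega> \<subseteq> interior (active_domain \<Omega> \<T>)"
  using cover by (intro interior_maximal open_domain) (auto simp: active)

lemma finite_fe_nodes: "finite (fe_nodes k \<Omega> \<T>)"
  unfolding fe_nodes_def using finite_active card_lagrange_nodes(1)[OF simplex[OF active_mem]] by blast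

lemma finite_boundary_nodes: "finite (boundary_nodes k \<Omega> \<T>)"
  unfolding boundary_nodes_def using finite_fe_nodes by blast

lemma fe_space_poly:
  assumes "u \<in> fe_space k \<Omega> \<T>" "T \<in> active_mesh \<Omega> \<T>"
  obtains p where "p \<in> poly_space k" "\<And>x. x \<in> T \<Longrightarrow> u x = p x"
  using assms unfolding fe_space_def by blast

lemma fe_space_lincomb:
  assumes f: "\<And>i. i \<in> I \<Longrightarrow> f i \<in> fe_space k \<Omega> \<T>"
  shows "(\<lambda>x. \<Sum>i\<in>I. c i * f i x) \<in> fe_space k \<Omega> \<T>"
  unfolding fe_space_def
proof (intro CollectI conjI ballI allI impI)
  show "continuous_on (active_domain \<Omega> \<T>) (\<lambda>x. \<Sum>i\<in>I. c i * f i x)"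
    using f by (intro continuous_intros) (auto simp: fe_space_def)
  show "(\<Sum>i\<in>I. c i * f i x) = 0" if "x \<notin> active_domain \<Omega> \<T>" for x
    using f that by (intro sum.neutral) (auto simp: fe_space_def)
  fix T assume T: "T \<in> active_mesh \<Omega> \<T>"
  have "\<forall>i\<in>I. \<exists>p\<in>poly_space k. \<forall>x\<in>T. f i x = p x"
    using f T by (auto simp: fe_space_def)
  then have "\<exists>p. \<forall>i\<in>I. p i \<in> poly_space k \<and> (\<forall>x\<in>T. f i x = p i x)"
    by (intro bchoice) blast
  then obtain p where p: "\<And>i. i \<in> I \<Longrightarrow> p i \<in> poly_space k" "\<And>i x. i \<in> I \<Longrightarrow> x \<in> T \<Longrightarrow> f i x = p i x"
    by blast
  have "(\<lambda>x. \<Sum>i\<in>I. c i * p i x) \<in> poly_space k"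
    by (intro poly_space_sum poly_space_scale p(1))
  moreover have "\<forall>x\<in>T. (\<Sum>i\<in>I. c i * f i x) = (\<Sum>i\<in>I. c i * p i x)"
    by (intro ballI sum.cong refl) (simp only: p(2))
  ultimately show "\<exists>p\<in>poly_space k. \<forall>x\<in>T. (\<Sum>i\<in>I. c i * f i x) = p x"
    by (intro bexI[of _ "\<lambda>x. \<Sum>i\<in>I. c i * p i x"])
qed

lemma elem_energy_nonneg: "0 \<le> elem_energy \<Omega> \<T> T u"
  by (simp add: elem_energy_def set_lebesgue_integral_def integral_nonneg_AE)

lemma elem_trace_nonneg: "0 \<le> elem_trace \<Omega> T u"
  by (simp add: elem_trace_def l2_def set_lebesgue_integral_def integral_nonneg_AE)

lemma elem_norm_nonneg: "0 \<le> \<gamma> \<Longrightarrow> T \<in> \<T> \<Longrightarrow> 0 \<le> elem_norm \<gamma> \<Omega> \<T> T u"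
  using diameter_pos[of T] by (simp add: elem_norm_def elem_energy_nonneg elem_trace_nonneg)

lemma negligible_frontier_elem: "T \<in> \<T> \<Longrightarrow> negligible (frontier T)"
  using convex_elem negligible_convex_frontier by blast

text \<open>The gradient of \<open>u\<close> can differ from that of \<open>p\<close> only on the
  frontier of \<open>T\<close>, a null set because \<open>T\<close> is convex.\<close>

lemma energy_poly:
  assumes T: "T \<in> active_mesh \<Omega> \<T>" and p: "p \<in> poly_space k" and eq: "\<And>x. x \<in> T \<Longrightarrow> u x = p x"
  shows "elem_energy \<Omega> \<T> T u = (LINT x:T|lebesgue. grad UNIV p x \<bullet> grad UNIV p x)"
    and "set_integrable lebesgue T (\<lambda>x. grad (active_domain \<Omega> \<T>) u x \<bullet> grad (active_domain \<Omega> \<T>) u x)"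
proof -
  let ?g = "\<lambda>x. grad UNIV p x \<bullet> grad UNIV p x"
  let ?f = "\<lambda>x. grad (active_domain \<Omega> \<T>) u x \<bullet> grad (active_domain \<Omega> \<T>) u x"
  have T\<T>: "T \<in> \<T>" by (rule active_mem[OF T])
  have g: "set_integrable lebesgue T ?g"
    by (intro set_integrable_lebesgue_compact compact_elem[OF T\<T>] continuous_on_inner continuous_on_poly_gradient[OF p])
  have fg: "?f x = ?g x" if x: "x \<in> T - frontier T" for x
  proof -
    have xi: "x \<in> interior T" using x by (auto simp: frontier_def closure_def)
    have "grad (active_domain \<Omega> \<T>) u x = grad UNIV p x"
    proof (rule grad_eqI)
      show "(u has_derivative (\<lambda>h. h \<bullet> grad UNIV p x)) (at x)"
        by (rule has_derivative_transform_within_open[OF poly_space_gradient(1)[OF p] open_interior xi])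
          (use eq interior_subset in force)
      show "x \<in> interior (active_domain \<Omega> \<T>)" using xi interior_mono[of T "active_domain \<Omega> \<T>"] T by blast
    qed
    then show ?thesis by simp
  qed
  show f: "set_integrable lebesgue T ?f"
    by (rule absolutely_integrable_spike[OF g negligible_frontier_elem[OF T\<T>] fg])
  have "integral T ?g = integral T ?f"
    by (rule integral_spike[OF negligible_frontier_elem[OF T\<T>] fg])
  then show "elem_energy \<Omega> \<T> T u = (LINT x:T|lebesgue. ?g x)"
    unfolding elem_energy_def using set_lebesgue_integral_eq_integral(2)[OF f] set_lebesgue_integral_eq_integral(2)[OF g]
    by simp
qed

lemma negligible_overlap:
  assumes T: "T1 \<in> \<T>" "T2 \<in> \<T>" "T1 \<noteq> T2" shows "negligible (T1 \<inter> T2)"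
proof -
  have F1: "T1 \<inter> T2 face_of T1" and F2: "T1 \<inter> T2 face_of T2"
    using tri T unfolding triangulation_def by (blast, metis Int_commute)
  have cl: "closed T1" "closed T2" using T compact_elem compact_imp_closed by blast+
  consider "T1 \<inter> T2 \<noteq> T1" | "T1 \<inter> T2 \<noteq> T2" using T(3) by blast
  then show ?thesis
  proof cases
    case 1
    then have "T1 \<inter> T2 \<subseteq> frontier T1"
      using face_of_disjoint_interior[OF F1] cl by (auto simp: frontier_def closure_closed)
    then show ?thesis using negligible_frontier_elem[OF T(1)] negligible_subset by blast
  next
    case 2
    then have "T1 \<inter> T2 \<subseteq> frontier T2"
      using face_of_disjoint_interior[OF F2] cl by (auto simp: frontier_def closure_closed)
    then show ?thesis using negligible_frontier_elem[OF T(2)] negligible_subset by blast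
  qed
qed

text \<open>Elements overlap in null sets, which splits the volume part. The boundary part is a sum
  over elements by definition, and an active element that is not cut adds an integral over the empty
  set.\<close>

lemma norm_b_sq_sum:
  assumes u: "u \<in> fe_space k \<Omega> \<T>"
  shows "norm_b_sq \<gamma> \<Omega> \<T> u = (\<Sum>T\<in>active_mesh \<Omega> \<T>. elem_norm \<gamma> \<Omega> \<T> T u)"
proof -
  let ?A = "active_mesh \<Omega> \<T>"
  have "dirichlet_form (\<Union>T\<in>?A. T) u u = (\<Sum>T\<in>?A. elem_energy \<Omega> \<T> T u)"
    unfolding dirichlet_form_def elem_energy_def image_ident
  proof (subst (1) image_ident[symmetric], rule set_integral_finite_UN_AE[OF finite_active])
    fix T1 T2 assume T: "T1 \<in> ?A" "T2 \<in> ?A"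
    show "AE x in lebesgue. x \<in> T1 \<and> x \<in> T2 \<longrightarrow> T1 = T2"
    proof (cases "T1 = T2")
      case False
      have "T1 \<inter> T2 \<in> null_sets lebesgue"
        using negligible_overlap[OF active_mem[OF T(1)] active_mem[OF T(2)] False] by (simp add: negligible_iff_null_sets)
      from AE_not_in[OF this] show ?thesis by eventually_elim auto
    qed simp
  next
    fix T assume T: "T \<in> ?A"
    show "T \<in> sets lebesgue" using compact_elem[OF active_mem[OF T]] by (simp add: fmeasurableD lmeasurable_compact)
    obtain p where "p \<in> poly_space k" "\<And>x. x \<in> T \<Longrightarrow> u x = p x" using fe_space_poly[OF u T] by blast
    then show "set_integrable lebesgue T (\<lambda>x. grad (active_domain \<Omega> \<T>) u x \<bullet> grad (active_domain \<Omega> \<T>) u x)"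
      by (rule energy_poly(2)[OF T])
  qed
  moreover have "scaled_boundary_form \<Omega> \<T> u u = (\<Sum>T\<in>?A. elem_trace \<Omega> T u / diameter T)"
    unfolding scaled_boundary_form_def
  proof (rule sum.mono_neutral_cong_left[OF finite_active])
    show "cut_elements \<Omega> \<T> \<subseteq> ?A" by (auto simp: cut_elements_def)
    show "\<forall>T\<in>?A - cut_elements \<Omega> \<T>. elem_trace \<Omega> T u / diameter T = 0"
      by (auto simp: cut_elements_def elem_trace_def l2_def set_lebesgue_integral_def)
  qed (simp add: elem_trace_def)
  ultimately show ?thesis
    by (simp add: norm_b_sq_def elem_norm_def sum.distrib sum_distrib_left)
qed

lemma surface_integrable:
  assumes u: "u \<in> fe_space k \<Omega> \<T>" and T: "T \<in> active_mesh \<Omega> \<T>"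
  shows "set_integrable surface_measure (T \<inter> frontier \<Omega>) (\<lambda>x. u x * u x)"
    and "T \<inter> frontier \<Omega> \<in> sets surface_measure"
proof -
  have c: "compact (T \<inter> frontier \<Omega>)"
    using compact_elem[OF active_mem[OF T]] by (intro compact_Int_closed) auto
  then show "T \<inter> frontier \<Omega> \<in> sets surface_measure"
    by (intro emeasure_hausdorff_measure(1) borel_compact)
  obtain p where p: "p \<in> poly_space k" "\<And>x. x \<in> T \<Longrightarrow> u x = p x" using fe_space_poly[OF u T] by blast
  have "set_integrable surface_measure (T \<inter> frontier \<Omega>) (\<lambda>x. p x * p x)"
    by (intro set_integrable_surface_measure c finite_trace active_mem[OF T] continuous_on_mult
        poly_space_continuous_on[OF p(1)])
  then show "set_integrable surface_measure (T \<inter> frontier \<Omega>) (\<lambda>x. u x * u x)"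
    unfolding set_integrable_def
    by (rule Bochner_Integration.integrable_cong[THEN iffD1, rotated 2]) (auto simp: p(2) indicator_def)
qed

lemma inball_elem:
  assumes "T \<in> \<T>"
  obtains c where "cball c (\<rho> * diameter T) \<subseteq> T" "T \<subseteq> cball c (diameter T)" "c \<in> T"
proof -
  obtain c where c: "cball c (\<rho> * diameter T) \<subseteq> T" using inball[OF assms] by blast
  then have "c \<in> T" using \<rho> diameter_pos[OF assms] by (auto simp: subset_iff)
  moreover have "T \<subseteq> cball c (diameter T)"
    using dist_le_diameter[OF assms \<open>c \<in> T\<close>] by (auto simp: dist_norm)
  ultimately show ?thesis using that c by blast
qed

text \<open>The hypothesis \<open>C\<close> is the nodal bound for \<open>T\<close>, used with
  \<open>M = 1\<close> for the size of a basis function and with \<open>M = 0\<close> for its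
  vanishing.\<close>

lemma basis_restrict:
  assumes \<phi>: "nodal_basis k \<Omega> \<T> \<phi>" and \<xi>: "\<xi> \<in> fe_nodes k \<Omega> \<T>" and T: "T \<in> active_mesh \<Omega> \<T>"
    and C: "\<And>f M. f \<in> poly_space k \<Longrightarrow> (\<forall>\<eta>\<in>lagrange_nodes k T. \<bar>f \<eta>\<bar> \<le> M) \<Longrightarrow> (\<forall>x\<in>T. \<bar>f x\<bar> \<le> C * M)"
  shows "x \<in> T \<Longrightarrow> \<bar>\<phi> \<xi> x\<bar> \<le> C" and "\<xi> \<notin> lagrange_nodes k T \<Longrightarrow> x \<in> T \<Longrightarrow> \<phi> \<xi> x = 0"
proof -
  have "\<phi> \<xi> \<in> fe_space k \<Omega> \<T>" using \<phi> \<xi> by (auto simp: nodal_basis_def)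
  then obtain p where p: "p \<in> poly_space k" "\<And>x. x \<in> T \<Longrightarrow> \<phi> \<xi> x = p x" using fe_space_poly[OF _ T] by blast
  have nodes: "\<phi> \<xi> \<eta> = (if \<eta> = \<xi> then 1 else 0)" "\<eta> \<in> T" if "\<eta> \<in> lagrange_nodes k T" for \<eta>
    using \<phi> \<xi> T that lagrange_nodes_subset[OF simplex[OF active_mem[OF T]] k] by (auto simp: nodal_basis_def fe_nodes_def)
  have "\<forall>\<eta>\<in>lagrange_nodes k T. \<bar>p \<eta>\<bar> \<le> 1" using nodes p(2) by (metis abs_0 abs_1 order_refl zero_le_one)
  then show "x \<in> T \<Longrightarrow> \<bar>\<phi> \<xi> x\<bar> \<le> C" using C[OF p(1), of 1] p(2) by auto
  assume n: "\<xi> \<notin> lagrange_nodes k T" and x: "x \<in> T"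
  have "\<forall>\<eta>\<in>lagrange_nodes k T. \<bar>p \<eta>\<bar> \<le> 0" using nodes p(2) n by (metis abs_0 order_refl)
  then show "\<phi> \<xi> x = 0" using C[OF p(1), of 0] p(2)[OF x] x by auto
qed

lemma elem_norm_zero:
  assumes T: "T \<in> active_mesh \<Omega> \<T>" and z: "\<And>x. x \<in> T \<Longrightarrow> u x = 0"
  shows "elem_norm \<gamma> \<Omega> \<T> T u = 0"
proof -
  have "grad UNIV (\<lambda>x::'a. 0::real) x = 0" for x by (rule grad_eqI) auto
  then have "elem_energy \<Omega> \<T> T u = 0"
    using energy_poly(1)[OF T poly_space_0, of u] z by (simp add: set_lebesgue_integral_def)
  moreover have "elem_trace \<Omega> T u = (LINT x:T \<inter> frontier \<Omega>|surface_measure. 0)"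
    unfolding elem_trace_def l2_def set_lebesgue_integral_def
    by (rule Bochner_Integration.integral_cong) (auto simp: z indicator_def)
  ultimately show ?thesis by (simp add: elem_norm_def set_lebesgue_integral_def)
qed

text \<open>Cauchy-Schwarz under the integrals. Only members of \<open>J\<close> live on
  \<open>T\<close>, so \<open>n\<close> counts the functions on one element; the sum is enlarged
  from \<open>J\<close> to \<open>I\<close> at the end so that elements can be added up.\<close>

lemma elem_norm_sum_le:
  assumes f: "\<And>i. i \<in> I \<Longrightarrow> f i \<in> fe_space k \<Omega> \<T>" and T: "T \<in> active_mesh \<Omega> \<T>" and \<gamma>: "0 \<le> \<gamma>"
    and I: "finite I"
    and J: "J \<subseteq> I" "card J \<le> n" "\<And>i x. i \<in> I - J \<Longrightarrow> x \<in> T \<Longrightarrow> f i x = 0"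
  shows "elem_norm \<gamma> \<Omega> \<T> T (\<lambda>x. \<Sum>i\<in>I. c i * f i x) \<le> real n * (\<Sum>i\<in>I. (c i)\<^sup>2 * elem_norm \<gamma> \<Omega> \<T> T (f i))"
proof -
  let ?u = "\<lambda>x. \<Sum>i\<in>I. c i * f i x"
  have T\<T>: "T \<in> \<T>" by (rule active_mem[OF T])
  have fJ: "finite J" using I J(1) finite_subset by blast
  have uJ: "?u x = (\<Sum>i\<in>J. c i * f i x)" if "x \<in> T" for x
    by (rule sum.mono_neutral_right[OF I J(1)]) (use J(3) that in auto)
  have ufe: "?u \<in> fe_space k \<Omega> \<T>" by (rule fe_space_lincomb[OF f])
  have "\<forall>i\<in>J. \<exists>p. p \<in> poly_space k \<and> (\<forall>x\<in>T. f i x = p x)"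
    using fe_space_poly[OF f T] J(1) by (metis subsetD)
  then obtain p where p: "\<And>i. i \<in> J \<Longrightarrow> p i \<in> poly_space k" "\<And>i x. i \<in> J \<Longrightarrow> x \<in> T \<Longrightarrow> f i x = p i x" by metis
  define q where "q x = (\<Sum>i\<in>J. c i * p i x)" for x
  have q: "q \<in> poly_space k" unfolding q_def using p(1) by (intro poly_space_sum poly_space_scale) auto
  have uq: "?u x = q x" if "x \<in> T" for x using uJ[OF that] p(2) that by (simp add: q_def)
  have gq: "grad UNIV q x = (\<Sum>i\<in>J. c i *\<^sub>R grad UNIV (p i) x)" for x
  proof (rule grad_eqI)
    have "((\<lambda>x. \<Sum>i\<in>J. c i * p i x) has_derivative (\<lambda>h. \<Sum>i\<in>J. c i * (h \<bullet> grad UNIV (p i) x))) (at x)"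
      by (intro has_derivative_sum has_derivative_mult_right poly_space_gradient(1)[OF p(1)])
    then show "(q has_derivative (\<lambda>h. h \<bullet> (\<Sum>i\<in>J. c i *\<^sub>R grad UNIV (p i) x))) (at x)"
      by (simp add: q_def[abs_def] inner_sum_right)
  qed simp
  have sq: "(\<Sum>i\<in>J. a i)\<^sup>2 \<le> real n * (\<Sum>i\<in>J. (a i)\<^sup>2)" for a :: "_ \<Rightarrow> real"
  proof -
    have "(\<Sum>i\<in>J. a i)\<^sup>2 \<le> (\<Sum>i\<in>J. (a i)\<^sup>2) * card J" by (rule sum_squared_le_sum_of_squares)
    also have "\<dots> \<le> (\<Sum>i\<in>J. (a i)\<^sup>2) * real n" using J(2) by (intro mult_left_mono sum_nonneg) auto
    finally show ?thesis by (simp add: mult.commute)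
  qed
  have int: "set_integrable lebesgue T (\<lambda>x. grad UNIV r x \<bullet> grad UNIV r x)" if "r \<in> poly_space k" for r
    by (intro set_integrable_lebesgue_compact compact_elem[OF T\<T>] continuous_on_inner continuous_on_poly_gradient[OF that])
  have "elem_energy \<Omega> \<T> T ?u = (LINT x:T|lebesgue. grad UNIV q x \<bullet> grad UNIV q x)"
    by (rule energy_poly(1)[OF T q uq])
  also have "\<dots> \<le> (LINT x:T|lebesgue. \<Sum>i\<in>J. (real n * (c i)\<^sup>2) * (grad UNIV (p i) x \<bullet> grad UNIV (p i) x))"
  proof (rule set_integral_mono[OF int[OF q]])
    show "set_integrable lebesgue T (\<lambda>x. \<Sum>i\<in>J. (real n * (c i)\<^sup>2) * (grad UNIV (p i) x \<bullet> grad UNIV (p i) x))"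
      unfolding set_integrable_def scaleR_sum_right
      by (intro Bochner_Integration.integrable_sum, fold set_integrable_def) (intro set_integrable_mult_right impI int p(1))
    fix x
    have "grad UNIV q x \<bullet> grad UNIV q x = (norm (\<Sum>i\<in>J. c i *\<^sub>R grad UNIV (p i) x))\<^sup>2"
      by (simp add: gq power2_norm_eq_inner)
    also have "\<dots> \<le> (\<Sum>i\<in>J. norm (c i *\<^sub>R grad UNIV (p i) x))\<^sup>2"
      by (intro power_mono norm_sum) auto
    also have "\<dots> \<le> real n * (\<Sum>i\<in>J. (norm (c i *\<^sub>R grad UNIV (p i) x))\<^sup>2)" by (rule sq)
    also have "\<dots> = (\<Sum>i\<in>J. (real n * (c i)\<^sup>2) * (grad UNIV (p i) x \<bullet> grad UNIV (p i) x))"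
      by (simp add: sum_distrib_left power_mult_distrib power2_norm_eq_inner mult.assoc)
    finally show "grad UNIV q x \<bullet> grad UNIV q x \<le> \<dots>" .
  qed
  also have "\<dots> = (\<Sum>i\<in>J. (real n * (c i)\<^sup>2) * elem_energy \<Omega> \<T> T (f i))"
  proof -
    have "(LINT x:T|lebesgue. \<Sum>i\<in>J. (real n * (c i)\<^sup>2) * (grad UNIV (p i) x \<bullet> grad UNIV (p i) x))
      = (\<Sum>i\<in>J. (LINT x:T|lebesgue. (real n * (c i)\<^sup>2) * (grad UNIV (p i) x \<bullet> grad UNIV (p i) x)))"
      unfolding set_lebesgue_integral_def scaleR_sum_right
      by (intro Bochner_Integration.integral_sum, fold set_integrable_def) (intro set_integrable_mult_right impI int p(1))
    also have "\<dots> = (\<Sum>i\<in>J. (real n * (c i)\<^sup>2) * elem_energy \<Omega> \<T> T (f i))"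
      by (intro sum.cong refl) (simp add: energy_poly(1)[OF T p(1) p(2)])
    finally show ?thesis .
  qed
  finally have E: "elem_energy \<Omega> \<T> T ?u \<le> (\<Sum>i\<in>J. (real n * (c i)\<^sup>2) * elem_energy \<Omega> \<T> T (f i))" .
  note int' = surface_integrable(1)[OF f T]
  have "elem_trace \<Omega> T ?u \<le> (LINT x:T \<inter> frontier \<Omega>|surface_measure. \<Sum>i\<in>J. (real n * (c i)\<^sup>2) * (f i x * f i x))"
    unfolding elem_trace_def l2_def
  proof (rule set_integral_mono[OF surface_integrable(1)[OF ufe T]])
    show "set_integrable surface_measure (T \<inter> frontier \<Omega>) (\<lambda>x. \<Sum>i\<in>J. (real n * (c i)\<^sup>2) * (f i x * f i x))"
      unfolding set_integrable_def scaleR_sum_right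
      by (intro Bochner_Integration.integrable_sum, fold set_integrable_def)
        (intro set_integrable_mult_right impI int', use J(1) in blast)
    fix x assume "x \<in> T \<inter> frontier \<Omega>"
    then have "?u x * ?u x = (\<Sum>i\<in>J. c i * f i x)\<^sup>2" using uJ by (simp add: power2_eq_square)
    also have "\<dots> \<le> real n * (\<Sum>i\<in>J. (c i * f i x)\<^sup>2)" by (rule sq)
    also have "\<dots> = (\<Sum>i\<in>J. (real n * (c i)\<^sup>2) * (f i x * f i x))"
      by (simp add: sum_distrib_left power2_eq_square mult_ac)
    finally show "?u x * ?u x \<le> \<dots>" .
  qed
  also have "\<dots> = (\<Sum>i\<in>J. (real n * (c i)\<^sup>2) * elem_trace \<Omega> T (f i))"
  proof -
    have "(LINT x:T \<inter> frontier \<Omega>|surface_measure. \<Sum>i\<in>J. (real n * (c i)\<^sup>2) * (f i x * f i x))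
      = (\<Sum>i\<in>J. (LINT x:T \<inter> frontier \<Omega>|surface_measure. (real n * (c i)\<^sup>2) * (f i x * f i x)))"
      unfolding set_lebesgue_integral_def scaleR_sum_right
      by (intro Bochner_Integration.integral_sum, fold set_integrable_def)
        (intro set_integrable_mult_right impI int', use J(1) in blast)
    then show ?thesis by (simp add: elem_trace_def l2_def)
  qed
  finally have G: "elem_trace \<Omega> T ?u \<le> (\<Sum>i\<in>J. (real n * (c i)\<^sup>2) * elem_trace \<Omega> T (f i))" .
  have "\<gamma> / diameter T * elem_trace \<Omega> T ?u \<le> \<gamma> / diameter T * (\<Sum>i\<in>J. (real n * (c i)\<^sup>2) * elem_trace \<Omega> T (f i))"
    using G \<gamma> diameter_pos[OF T\<T>] by (intro mult_left_mono) auto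
  then have "elem_norm \<gamma> \<Omega> \<T> T ?u \<le> (\<Sum>i\<in>J. (real n * (c i)\<^sup>2) * elem_energy \<Omega> \<T> T (f i))
      + \<gamma> / diameter T * (\<Sum>i\<in>J. (real n * (c i)\<^sup>2) * elem_trace \<Omega> T (f i))"
    using E by (simp add: elem_norm_def)
  also have "\<dots> = real n * (\<Sum>i\<in>J. (c i)\<^sup>2 * elem_norm \<gamma> \<Omega> \<T> T (f i))"
    by (simp add: elem_norm_def sum_distrib_left sum.distrib algebra_simps)
  also have "\<dots> \<le> real n * (\<Sum>i\<in>I. (c i)\<^sup>2 * elem_norm \<gamma> \<Omega> \<T> T (f i))"
    using elem_norm_nonneg[OF \<gamma> T\<T>] by (intro mult_left_mono sum_mono2 I J(1)) auto
  finally show ?thesis .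
qed

end

text \<open>The Poincare inequality divided by \<open>h\<^sup>2\<close>, which leaves the weight
  \<open>h ^ (DIM('a) - 2)\<close>.\<close>

lemma elem_oscillation:
  assumes \<rho>: "0 < \<rho>"
  shows "\<exists>C\<ge>0. \<forall>\<T> (\<Omega> :: 'a::euclidean_space set) u T x y. cut_fem \<T> \<rho> \<Omega> k \<longrightarrow> u \<in> fe_space k \<Omega> \<T> \<longrightarrow>
    T \<in> active_mesh \<Omega> \<T> \<longrightarrow> x \<in> T \<longrightarrow> y \<in> T \<longrightarrow>
    (u x - u y)\<^sup>2 * diameter T ^ (DIM('a) - 2) \<le> C * elem_energy \<Omega> \<T> T u"
proof -
  obtain C where C: "C \<ge> 0" "\<And>f c h T x y. f \<in> poly_space k \<Longrightarrow> x \<in> cball (c::'a) h \<Longrightarrow> y \<in> cball c h \<Longrightarrow>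
    h > 0 \<Longrightarrow> compact T \<Longrightarrow> cball c (\<rho> * h) \<subseteq> T \<Longrightarrow>
    (f x - f y)\<^sup>2 * h ^ DIM('a) \<le> C * h\<^sup>2 * (LINT y:T|lebesgue. grad UNIV f y \<bullet> grad UNIV f y)"
    using poly_oscillation_le_gradient[OF \<rho>, of k, where 'a='a] by blast
  have "(u x - u y)\<^sup>2 * diameter T ^ (DIM('a) - 2) \<le> C * elem_energy \<Omega> \<T> T u"
    if fem: "cut_fem \<T> \<rho> \<Omega> k" and u: "u \<in> fe_space k \<Omega> \<T>" and T: "T \<in> active_mesh \<Omega> \<T>" and xy: "x \<in> T" "y \<in> T"
    for \<T> and \<Omega> :: "'a set" and u T x y
  proof -
    interpret cut_fem \<T> \<rho> \<Omega> k by (rule fem)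
    have T\<T>: "T \<in> \<T>" by (rule active_mem[OF T])
    define h where "h = diameter T"
    have h: "0 < h" using diameter_pos[OF T\<T>] by (simp add: h_def)
    obtain c where c: "cball c (\<rho> * h) \<subseteq> T" "T \<subseteq> cball c h" "c \<in> T"
      by (rule inball_elem[OF T\<T>, folded h_def])
    obtain p where p: "p \<in> poly_space k" "\<And>x. x \<in> T \<Longrightarrow> u x = p x" using fe_space_poly[OF u T] by blast
    have E: "(LINT y:T|lebesgue. grad UNIV p y \<bullet> grad UNIV p y) = elem_energy \<Omega> \<T> T u"
      using energy_poly(1)[OF T p] by simp
    have n: "h ^ DIM('a) = h\<^sup>2 * h ^ (DIM('a) - 2)"
      using dim by (metis le_add_diff_inverse power_add)
    have "(p x - p y)\<^sup>2 * h ^ DIM('a) \<le> C * h\<^sup>2 * elem_energy \<Omega> \<T> T u"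
      unfolding E[symmetric] by (rule C(2)[OF p(1) _ _ h compact_elem[OF T\<T>] c(1)]) (use c(2) xy in auto)
    then have "h\<^sup>2 * ((u x - u y)\<^sup>2 * h ^ (DIM('a) - 2)) \<le> h\<^sup>2 * (C * elem_energy \<Omega> \<T> T u)"
      unfolding n by (simp only: p(2)[OF xy(1)] p(2)[OF xy(2)] mult_ac)
    then show ?thesis using h by (simp add: h_def)
  qed
  then show ?thesis using C(1) by (intro exI[of _ C]) blast
qed

lemma set_integral_const_le:
  fixes f :: "'a \<Rightarrow> real"
  assumes "set_integrable M S f" "S \<in> sets M" "emeasure M S < \<infinity>" "\<And>x. x \<in> S \<Longrightarrow> f x \<le> c"
  shows "(LINT x:S|M. f x) \<le> c * measure M S"
proof -
  have "(LINT x:S|M. f x) \<le> (LINT x:S|M. c)"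
    by (rule set_integral_mono) (use assms in \<open>auto simp: set_integrable_def\<close>)
  then show ?thesis using set_integral_const[of S M c] assms(2,3) by (simp add: mult.commute)
qed

lemma set_integral_const_ge:
  fixes f :: "'a \<Rightarrow> real"
  assumes "set_integrable M S f" "S \<in> sets M" "emeasure M S < \<infinity>" "\<And>x. x \<in> S \<Longrightarrow> c \<le> f x"
  shows "c * measure M S \<le> (LINT x:S|M. f x)"
proof -
  have "(LINT x:S|M. c) \<le> (LINT x:S|M. f x)"
    by (rule set_integral_mono) (use assms in \<open>auto simp: set_integrable_def\<close>)
  then show ?thesis using set_integral_const[of S M c] assms(2,3) by (simp add: mult.commute)
qed

lemma basis_elem_norm:
  assumes \<rho>: "0 < \<rho>" and k: "1 \<le> k" and \<gamma>: "0 \<le> \<gamma>" and dim: "2 \<le> DIM('a::euclidean_space)"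
    and \<Omega>: "lipschitz_domain (\<Omega> :: 'a set)" "bounded \<Omega>"
    and meas: "measure_space UNIV (sets borel) (hausdorff_outer (DIM('a) - 1) :: 'a set \<Rightarrow> ennreal)"
  shows "\<exists>C\<ge>0. \<forall>\<T> \<phi> \<xi> T. cut_fem \<T> \<rho> \<Omega> k \<longrightarrow> nodal_basis k \<Omega> \<T> \<phi> \<longrightarrow> \<xi> \<in> fe_nodes k \<Omega> \<T> \<longrightarrow>
    T \<in> active_mesh \<Omega> \<T> \<longrightarrow> elem_norm \<gamma> \<Omega> \<T> T (\<phi> \<xi>) \<le> C * diameter T ^ (DIM('a) - 2)"
proof -
  obtain C1 where C1: "C1 \<ge> 0" "\<And>f T M. f \<in> poly_space k \<Longrightarrow> int DIM('a) simplex (T::'a set) \<Longrightarrow>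
    (\<forall>\<eta>\<in>lagrange_nodes k T. \<bar>f \<eta>\<bar> \<le> M) \<Longrightarrow> (\<forall>x\<in>T. \<bar>f x\<bar> \<le> C1 * M)"
    using lagrange_nodes_bound[OF k, where 'a='a] by blast
  obtain C2 where C2: "C2 \<ge> 0" "\<And>f c h M x. f \<in> poly_space k \<Longrightarrow> x \<in> cball (c::'a) h \<Longrightarrow> h > 0 \<Longrightarrow>
    (\<forall>y\<in>cball c (\<rho> * h). \<bar>f y\<bar> \<le> M) \<Longrightarrow> norm (grad UNIV f x) * h \<le> C2 * M"
    using poly_gradient_inverse_estimate[OF \<rho>, of k, where 'a='a] by blast
  obtain C3 where C3: "C3 \<ge> 0" "\<And>S z h. 0 < h \<Longrightarrow> S \<subseteq> ball z h \<Longrightarrow> closed S \<Longrightarrow>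
    emeasure surface_measure (S \<inter> frontier \<Omega>) \<le> ennreal (C3 * h ^ (DIM('a) - 1))"
    using lipschitz_frontier_measure_le[OF dim \<Omega> meas] by blast
  define \<omega> where "\<omega> = measure lborel (ball (0::'a) 1)"
  \<comment> \<open>First summand: gradient at most \<open>C2 * C1 / h\<close> on a set within a
    ball of radius \<open>2 * h\<close>. Second summand: values at most \<open>C1\<close> on a piece
    of boundary of measure at most \<open>C3 * (2 * h) ^ (DIM('a) - 1)\<close>, divided by
    \<open>h\<close>.\<close>
  define C where "C = (C2 * C1)\<^sup>2 * (2 ^ DIM('a) * \<omega>) + \<gamma> * (C1\<^sup>2 * (C3 * 2 ^ (DIM('a) - 1)))"
  have \<omega>: "\<omega> \<ge> 0" by (simp add: \<omega>_def)
  have "elem_norm \<gamma> \<Omega> \<T> T (\<phi> \<xi>) \<le> C * diameter T ^ (DIM('a) - 2)"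
    if fem: "cut_fem \<T> \<rho> \<Omega> k" and \<phi>: "nodal_basis k \<Omega> \<T> \<phi>" and \<xi>: "\<xi> \<in> fe_nodes k \<Omega> \<T>" and T: "T \<in> active_mesh \<Omega> \<T>"
    for \<T> \<phi> \<xi> T
  proof -
    interpret cut_fem \<T> \<rho> \<Omega> k by (rule fem)
    have T\<T>: "T \<in> \<T>" by (rule active_mem[OF T])
    define h where "h = diameter T"
    have h: "0 < h" using diameter_pos[OF T\<T>] by (simp add: h_def)
    obtain c where c: "cball c (\<rho> * h) \<subseteq> T" "T \<subseteq> cball c h" "c \<in> T"
      by (rule inball_elem[OF T\<T>, folded h_def])
    have Tb: "T \<subseteq> ball c (2 * h)" using c(2) h by (force simp: subset_iff)
    have n1: "h ^ (DIM('a) - 1) = h * h ^ (DIM('a) - 2)" and n2: "h ^ DIM('a) = h\<^sup>2 * h ^ (DIM('a) - 2)"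
    proof -
      obtain m where "DIM('a) = m + 2" using dim by (metis add.commute le_Suc_ex)
      then show "h ^ (DIM('a) - 1) = h * h ^ (DIM('a) - 2)" "h ^ DIM('a) = h\<^sup>2 * h ^ (DIM('a) - 2)"
        by (simp_all add: power2_eq_square)
    qed
    have fe: "\<phi> \<xi> \<in> fe_space k \<Omega> \<T>" using \<phi> \<xi> by (auto simp: nodal_basis_def)
    obtain p where p: "p \<in> poly_space k" "\<And>x. x \<in> T \<Longrightarrow> \<phi> \<xi> x = p x" using fe_space_poly[OF fe T] by blast
    have bound: "\<bar>\<phi> \<xi> x\<bar> \<le> C1" if "x \<in> T" for x
      by (rule basis_restrict(1)[OF \<phi> \<xi> T C1(2)[OF _ simplex[OF T\<T>]] that])
    have gp: "grad UNIV p x \<bullet> grad UNIV p x \<le> (C2 * C1 / h)\<^sup>2" if x: "x \<in> T" for x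
    proof -
      have "norm (grad UNIV p x) * h \<le> C2 * C1"
        by (rule C2(2)[OF p(1) _ h]) (use x c bound p(2) in auto)
      then have "norm (grad UNIV p x) \<le> C2 * C1 / h" using h by (simp add: pos_le_divide_eq)
      then show ?thesis unfolding power2_norm_eq_inner[symmetric] by (intro power_mono) auto
    qed
    have lmT: "T \<in> lmeasurable" using compact_elem[OF T\<T>] by (rule lmeasurable_compact)
    have "elem_energy \<Omega> \<T> T (\<phi> \<xi>) = (LINT x:T|lebesgue. grad UNIV p x \<bullet> grad UNIV p x)"
      by (rule energy_poly(1)[OF T p])
    also have "\<dots> \<le> (C2 * C1 / h)\<^sup>2 * measure lebesgue T"
      by (rule set_integral_const_le) (use gp lmT in \<open>auto simp: fmeasurable_def less_top intro!: set_integrable_lebesgue_compact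
          compact_elem[OF T\<T>] continuous_on_inner continuous_on_poly_gradient[OF p(1)]\<close>)
    also have "\<dots> \<le> (C2 * C1 / h)\<^sup>2 * ((2 * h) ^ DIM('a) * \<omega>)"
    proof (rule mult_left_mono)
      have "measure lebesgue T \<le> measure lebesgue (ball c (2 * h))"
        by (rule measure_mono_fmeasurable[OF Tb]) (use lmT in \<open>auto simp: fmeasurableD\<close>)
      also have "\<dots> = (2 * h) ^ DIM('a) * \<omega>"
        using content_ball_conv_unit_ball[of "2 * h" c] h unfolding \<omega>_def by simp
      finally show "measure lebesgue T \<le> (2 * h) ^ DIM('a) * \<omega>" .
    qed simp
    also have "\<dots> = (C2 * C1)\<^sup>2 * (2 ^ DIM('a) * \<omega>) * h ^ (DIM('a) - 2)"
      using h by (simp add: power_mult_distrib n2 power_divide)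
    finally have E: "elem_energy \<Omega> \<T> T (\<phi> \<xi>) \<le> (C2 * C1)\<^sup>2 * (2 ^ DIM('a) * \<omega>) * h ^ (DIM('a) - 2)" .
    let ?\<Gamma> = "T \<inter> frontier \<Omega>"
    have "emeasure surface_measure ?\<Gamma> \<le> ennreal (C3 * (2 * h) ^ (DIM('a) - 1))"
      by (rule C3(2)[OF _ Tb]) (use h compact_elem[OF T\<T>] compact_imp_closed in auto)
    then have m: "measure surface_measure ?\<Gamma> \<le> C3 * (2 * h) ^ (DIM('a) - 1)"
      unfolding measure_def using C3(1) h by (intro enn2real_leI) auto
    have "elem_trace \<Omega> T (\<phi> \<xi>) \<le> C1\<^sup>2 * measure surface_measure ?\<Gamma>"
      unfolding elem_trace_def l2_def
    proof (rule set_integral_const_le[OF surface_integrable[OF fe T] finite_trace[OF T\<T>]])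
      fix x assume "x \<in> ?\<Gamma>"
      then have "\<bar>\<phi> \<xi> x\<bar>\<^sup>2 \<le> C1\<^sup>2" using bound[of x] by (intro power_mono) auto
      then show "\<phi> \<xi> x * \<phi> \<xi> x \<le> C1\<^sup>2" by (simp add: power2_eq_square)
    qed
    also have "\<dots> \<le> C1\<^sup>2 * (C3 * (2 * h) ^ (DIM('a) - 1))" by (rule mult_left_mono[OF m]) simp
    also have "\<dots> = C1\<^sup>2 * (C3 * 2 ^ (DIM('a) - 1)) * h ^ (DIM('a) - 2) * h"
      by (simp only: power_mult_distrib n1 mult_ac)
    finally have "elem_trace \<Omega> T (\<phi> \<xi>) / h \<le> C1\<^sup>2 * (C3 * 2 ^ (DIM('a) - 1)) * h ^ (DIM('a) - 2)"
      using h by (simp add: pos_divide_le_eq)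
    then have "\<gamma> * (elem_trace \<Omega> T (\<phi> \<xi>) / h) \<le> \<gamma> * (C1\<^sup>2 * (C3 * 2 ^ (DIM('a) - 1)) * h ^ (DIM('a) - 2))"
      using \<gamma> by (rule mult_left_mono)
    from add_mono[OF E this] show ?thesis
      unfolding elem_norm_def C_def h_def[symmetric] by (simp only: distrib_right mult.assoc)
  qed
  moreover have "C \<ge> 0" using C1 C3 \<omega> \<gamma> by (simp add: C_def)
  ultimately show ?thesis by (intro exI[of _ C]) blast
qed

text \<open>Regrouping by \<open>f i\<close>: no \<open>j\<close> is chosen as a neighbour more than
  \<open>K\<close> times, so the neighbour terms are absorbed into the full sum.\<close>

lemma sum_neighbours_le:
  fixes b :: "'i \<Rightarrow> real"
  assumes A: "finite A" "B \<subseteq> A" and f: "f ` B \<subseteq> A" and b: "\<And>i. i \<in> A \<Longrightarrow> 0 \<le> b i"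
    and K: "\<And>j. j \<in> A \<Longrightarrow> card {i \<in> B. f i = j} \<le> K"
  shows "(\<Sum>i\<in>B. b i + b (f i)) \<le> (1 + real K) * (\<Sum>i\<in>A. b i)"
proof -
  have fB: "finite B" using A finite_subset by blast
  have "(\<Sum>i\<in>B. b (f i)) = (\<Sum>j\<in>A. \<Sum>i\<in>{i \<in> B. f i = j}. b (f i))"
    by (rule sum.group[OF fB A(1) f, symmetric])
  also have "\<dots> = (\<Sum>j\<in>A. real (card {i \<in> B. f i = j}) * b j)"
    by (intro sum.cong refl) simp
  also have "\<dots> \<le> (\<Sum>j\<in>A. real K * b j)"
    using K b by (intro sum_mono mult_right_mono) auto
  finally have "(\<Sum>i\<in>B. b (f i)) \<le> real K * (\<Sum>j\<in>A. b j)" by (simp add: sum_distrib_left)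
  moreover have "(\<Sum>i\<in>B. b i) \<le> (\<Sum>i\<in>A. b i)" by (rule sum_mono2[OF A]) (use b in auto)
  ultimately show ?thesis by (simp add: sum.distrib algebra_simps)
qed

section \<open>Values of boundary combinations and their control by the norm\<close>

context cut_fem
begin

lemma boundary_comb_at_node:
  assumes \<phi>: "nodal_basis k \<Omega> \<T> \<phi>" and \<xi>: "\<xi> \<in> fe_nodes k \<Omega> \<T>"
  shows "boundary_comb k \<Omega> \<T> \<phi> \<mu> \<xi> = (if \<xi> \<in> boundary_nodes k \<Omega> \<T> then \<mu> \<xi> else 0)"
proof -
  have "boundary_comb k \<Omega> \<T> \<phi> \<mu> \<xi> = (\<Sum>\<eta>\<in>boundary_nodes k \<Omega> \<T>. if \<eta> = \<xi> then \<mu> \<eta> else 0)"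
    unfolding boundary_comb_def
    by (intro sum.cong refl) (use \<phi> \<xi> in \<open>auto simp: nodal_basis_def boundary_nodes_def\<close>)
  then show ?thesis by (simp add: sum.delta finite_boundary_nodes)
qed

lemma boundary_comb_fe_space:
  assumes \<phi>: "nodal_basis k \<Omega> \<T> \<phi>" shows "boundary_comb k \<Omega> \<T> \<phi> \<mu> \<in> fe_space k \<Omega> \<T>"
  unfolding boundary_comb_def
  by (rule fe_space_lincomb) (use \<phi> in \<open>auto simp: nodal_basis_def boundary_nodes_def\<close>)

lemma boundary_comb_interior_vertex:
  assumes \<phi>: "nodal_basis k \<Omega> \<T> \<phi>" and T: "T \<in> active_mesh \<Omega> \<T>" and v: "v \<in> vertices T" "v \<in> \<Omega>"
  shows "boundary_comb k \<Omega> \<T> \<phi> \<mu> v = 0"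
proof -
  have "v \<in> lagrange_nodes k T" using vertex_in_lagrange_nodes[OF simplex[OF active_mem[OF T]] k] v by simp
  then have "v \<in> fe_nodes k \<Omega> \<T>" using T by (auto simp: fe_nodes_def)
  moreover have "v \<notin> boundary_nodes k \<Omega> \<T>"
    using domain_interior v(2) by (auto simp: boundary_nodes_def frontier_def)
  ultimately show ?thesis using boundary_comb_at_node[OF \<phi>] by simp
qed

end

text \<open>If a vertex of \<open>T\<close> lies in the domain, \<open>T' = T\<close> serves.
  Otherwise a bound for \<open>u\<close> at the common vertex is obtained on \<open>T'\<close> and
  passed back to \<open>T\<close>, for which the weight of \<open>T'\<close> must not be much
  smaller than that of \<open>T\<close>.\<close>

lemma boundary_elem_control:
  assumes \<rho>: "0 < \<rho>" and k: "1 \<le> k" and \<gamma>: "0 < \<gamma>" and D: "0 < D" and dim: "2 \<le> DIM('a::euclidean_space)"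
    and \<Omega>: "lipschitz_domain (\<Omega> :: 'a set)" "bounded \<Omega>"
    and meas: "measure_space UNIV (sets borel) (hausdorff_outer (DIM('a) - 1) :: 'a set \<Rightarrow> ennreal)"
  shows "\<exists>C\<ge>0. \<forall>\<T> \<phi> \<mu> T. cut_fem \<T> \<rho> \<Omega> k \<longrightarrow> (\<forall>T\<in>\<T>. diameter T \<le> D) \<longrightarrow> nodal_basis k \<Omega> \<T> \<phi> \<longrightarrow>
    T \<in> active_mesh \<Omega> \<T> \<longrightarrow>
    (\<exists>T'\<in>active_mesh \<Omega> \<T>. (\<exists>v. v \<in> vertices T \<and> v \<in> vertices T') \<and>
      (\<forall>y\<in>T. (boundary_comb k \<Omega> \<T> \<phi> \<mu> y)\<^sup>2 * diameter T ^ (DIM('a) - 2)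
        \<le> C * (elem_norm \<gamma> \<Omega> \<T> T (boundary_comb k \<Omega> \<T> \<phi> \<mu>) + elem_norm \<gamma> \<Omega> \<T> T' (boundary_comb k \<Omega> \<T> \<phi> \<mu>))))"
proof -
  obtain C1 where C1: "C1 \<ge> 0" "\<And>\<T> (\<Omega> :: 'a set) u T x y. cut_fem \<T> \<rho> \<Omega> k \<Longrightarrow> u \<in> fe_space k \<Omega> \<T> \<Longrightarrow>
    T \<in> active_mesh \<Omega> \<T> \<Longrightarrow> x \<in> T \<Longrightarrow> y \<in> T \<Longrightarrow>
    (u x - u y)\<^sup>2 * diameter T ^ (DIM('a) - 2) \<le> C1 * elem_energy \<Omega> \<T> T u"
    using elem_oscillation[OF \<rho>, of k, where 'a='a] by blast
  define \<theta> where "\<theta> = star_size_ratio DIM('a) \<rho>"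
  have \<theta>: "0 < \<theta>" using \<rho> by (simp add: \<theta>_def star_size_ratio_def)
  obtain c where c: "c > 0" and rich: "\<And>\<T> T. shape_regular_mesh \<T> \<rho> \<Longrightarrow> (\<forall>T\<in>\<T>. diameter T \<le> D) \<Longrightarrow> \<Omega> \<subseteq> \<Union>\<T> \<Longrightarrow>
    T \<in> \<T> \<Longrightarrow> T \<inter> \<Omega> \<noteq> {} \<Longrightarrow> vertices T \<inter> \<Omega> = {} \<Longrightarrow>
    (\<exists>T'\<in>\<T>. \<exists>v. T' \<inter> \<Omega> \<noteq> {} \<and> v \<in> vertices T \<and> v \<in> vertices T' \<and> \<theta> * diameter T \<le> diameter T' \<and>
      ennreal (c * diameter T' ^ (DIM('a) - 1)) \<le> emeasure surface_measure (T' \<inter> frontier \<Omega>))"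
    using boundary_rich_neighbour[OF dim \<Omega> meas \<rho> D] unfolding \<theta>_def by blast
  define m where "m = DIM('a) - 2"
  have nm: "DIM('a) - 1 = Suc m" using dim by (simp add: m_def)
  \<comment> \<open>In the bracket stand the trace part \<open>2 / (c * \<gamma>)\<close> and the
    oscillation part \<open>2 * C1\<close> on \<open>T'\<close>; \<open>\<theta> ^ m\<close>
    converts the weight of \<open>T'\<close> into that of \<open>T\<close>, and 2 comes from
    splitting \<open>u y\<close> into \<open>u v\<close> and a difference.\<close>
  define K where "K = 2 / \<theta> ^ m * (2 / (c * \<gamma>) + 2 * C1)"
  have K: "K \<ge> 0" using c \<gamma> C1(1) \<theta> by (simp add: K_def)
  define C where "C = K + 2 * C1"
  have C: "C \<ge> 0" "C1 \<le> C" "K \<le> C" using K C1(1) by (auto simp: C_def)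
  have main: "\<exists>T'\<in>active_mesh \<Omega> \<T>. (\<exists>v. v \<in> vertices T \<and> v \<in> vertices T') \<and>
      (\<forall>y\<in>T. (u y)\<^sup>2 * diameter T ^ m \<le> C * (elem_norm \<gamma> \<Omega> \<T> T u + elem_norm \<gamma> \<Omega> \<T> T' u))"
    if fem: "cut_fem \<T> \<rho> \<Omega> k" and diam: "\<forall>T\<in>\<T>. diameter T \<le> D" and \<phi>: "nodal_basis k \<Omega> \<T> \<phi>"
      and T: "T \<in> active_mesh \<Omega> \<T>" and u_def: "u = boundary_comb k \<Omega> \<T> \<phi> \<mu>" for \<T> \<phi> \<mu> T u
  proof -
    interpret cut_fem \<T> \<rho> \<Omega> k by (rule fem)
    have T\<T>: "T \<in> \<T>" by (rule active_mem[OF T])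
    have u: "u \<in> fe_space k \<Omega> \<T>" unfolding u_def by (rule boundary_comb_fe_space[OF \<phi>])
    have osc: "(u x - u y)\<^sup>2 * diameter T' ^ m \<le> C1 * elem_energy \<Omega> \<T> T' u"
      if "T' \<in> active_mesh \<Omega> \<T>" "x \<in> T'" "y \<in> T'" for T' x y
      unfolding m_def by (rule C1(2)[OF fem u that])
    have EN: "elem_energy \<Omega> \<T> T' u \<le> elem_norm \<gamma> \<Omega> \<T> T' u"
      "elem_trace \<Omega> T' u / diameter T' \<le> elem_norm \<gamma> \<Omega> \<T> T' u / \<gamma>" "0 \<le> elem_norm \<gamma> \<Omega> \<T> T' u"
      if "T' \<in> active_mesh \<Omega> \<T>" for T'
      using \<gamma> elem_energy_nonneg[of T' u] elem_trace_nonneg[of T' u] diameter_pos[OF active_mem[OF that]]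
        elem_norm_nonneg[of \<gamma> T' u, OF _ active_mem[OF that]]
      by (auto simp: elem_norm_def field_simps)
    show ?thesis
    proof (cases "vertices T \<inter> \<Omega> = {}")
      case False
      then obtain v where v: "v \<in> vertices T" "v \<in> \<Omega>" by blast
      have uv: "u v = 0" unfolding u_def by (rule boundary_comb_interior_vertex[OF \<phi> T v])
      have "(u y)\<^sup>2 * diameter T ^ m \<le> C * (elem_norm \<gamma> \<Omega> \<T> T u + elem_norm \<gamma> \<Omega> \<T> T u)" if y: "y \<in> T" for y
      proof -
        have "(u y)\<^sup>2 * diameter T ^ m \<le> C1 * elem_energy \<Omega> \<T> T u"
          using osc[OF T y vertex_mem[OF v(1)]] uv by simp
        also have "\<dots> \<le> C * (elem_norm \<gamma> \<Omega> \<T> T u + elem_norm \<gamma> \<Omega> \<T> T u)"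
          using EN[OF T] C C1(1) elem_energy_nonneg by (intro mult_mono) auto
        finally show ?thesis .
      qed
      then show ?thesis using T v(1) by blast
    next
      case True
      have "T \<inter> \<Omega> \<noteq> {}" using T active by auto
      obtain T' v where T'0: "T' \<in> \<T>" "T' \<inter> \<Omega> \<noteq> {}" and v: "v \<in> vertices T" "v \<in> vertices T'"
        and size: "\<theta> * diameter T \<le> diameter T'"
        and big: "ennreal (c * diameter T' ^ (DIM('a) - 1)) \<le> emeasure surface_measure (T' \<inter> frontier \<Omega>)"
        using rich[OF shape_regular_mesh_axioms diam cover T\<T> \<open>T \<inter> \<Omega> \<noteq> {}\<close> True] by blast
      have T': "T' \<in> active_mesh \<Omega> \<T>" using T'0 by (simp add: active)
      define h h' where "h = diameter T" and "h' = diameter T'"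
      have h: "0 < h" "0 < h'" using diameter_pos T\<T> T'0 by (auto simp: h_def h'_def)
      let ?\<Gamma> = "T' \<inter> frontier \<Omega>"
      define M where "M = measure surface_measure ?\<Gamma>"
      have M: "c * (h' * h' ^ m) \<le> M"
      proof -
        have "emeasure surface_measure ?\<Gamma> = ennreal M"
          unfolding M_def using finite_trace[OF T'0(1)] by (intro emeasure_eq_ennreal_measure) auto
        then show ?thesis using big unfolding nm by (simp add: h'_def M_def)
      qed
      define N where "N = elem_norm \<gamma> \<Omega> \<T> T' u"
      have N: "elem_energy \<Omega> \<T> T' u \<le> N" "elem_trace \<Omega> T' u / h' \<le> N / \<gamma>" "0 \<le> N"
        using EN[OF T'] by (auto simp: N_def h'_def)
      define B where "B = C1 * N / h' ^ m"
      have point: "((u v)\<^sup>2 - 2 * B) / 2 \<le> u p * u p" if p: "p \<in> ?\<Gamma>" for p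
      proof -
        have "(u v - u p)\<^sup>2 * h' ^ m \<le> C1 * N"
          using osc[OF T' vertex_mem[OF v(2)], of p] p mult_left_mono[OF N(1) C1(1)] by (auto simp: h'_def)
        then have "(u v - u p)\<^sup>2 \<le> B" using h by (simp add: B_def pos_le_divide_eq)
        moreover have "(u v)\<^sup>2 \<le> 2 * (u v - u p)\<^sup>2 + 2 * (u p * u p)"
        proof -
          have "0 \<le> (u v - 2 * u p)\<^sup>2" by simp
          then show ?thesis by (simp add: power2_eq_square algebra_simps)
        qed
        ultimately show ?thesis by simp
      qed
      have "((u v)\<^sup>2 - 2 * B) / 2 * M \<le> elem_trace \<Omega> T' u"
        unfolding elem_trace_def l2_def M_def
        by (rule set_integral_const_ge[OF surface_integrable[OF u T'] finite_trace[OF T'0(1)] point])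
      also have "\<dots> \<le> N / \<gamma> * h'" using N(2) h by (simp add: pos_divide_le_eq)
      finally have half: "((u v)\<^sup>2 - 2 * B) / 2 * M \<le> N / \<gamma> * h'" .
      have "X * M \<le> 2 * (Y * h')" if "X / 2 * M \<le> Y * h'" for X Y using that by simp
      from this[OF half] have XM: "((u v)\<^sup>2 - 2 * B) * M \<le> 2 * (N / \<gamma> * h')" .
      \<comment> \<open>Either \<open>u v\<close> is dominated by the oscillation on
        \<open>T'\<close>, or the pointwise lower bound for the square of \<open>u\<close> on the
        boundary is positive and its integral is at most the trace term.\<close>
      have 1: "(u v)\<^sup>2 * h' ^ m \<le> (2 / (c * \<gamma>) + 2 * C1) * N"
      proof (cases "(u v)\<^sup>2 - 2 * B \<le> 0")
        case True
        then have "(u v)\<^sup>2 \<le> 2 * B" by simp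
        then have "(u v)\<^sup>2 * h' ^ m \<le> 2 * B * h' ^ m" by (rule mult_right_mono) (use h in simp)
        also have "\<dots> = 2 * C1 * N" using h by (simp add: B_def)
        also have "\<dots> \<le> (2 / (c * \<gamma>) + 2 * C1) * N" using c \<gamma> N(3) by (intro mult_right_mono) auto
        finally show ?thesis .
      next
        case False
        then have "((u v)\<^sup>2 - 2 * B) * (c * (h' * h' ^ m)) \<le> ((u v)\<^sup>2 - 2 * B) * M"
          using M by (intro mult_left_mono) auto
        also have "\<dots> \<le> 2 * (N / \<gamma> * h')" by (rule XM)
        finally have "h' * (c * (((u v)\<^sup>2 - 2 * B) * h' ^ m)) \<le> h' * (2 * (N / \<gamma>))" by (simp add: mult_ac)
        then have "c * (((u v)\<^sup>2 - 2 * B) * h' ^ m) \<le> 2 * (N / \<gamma>)"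
          using h(2) by (rule mult_left_le_imp_le)
        then have "((u v)\<^sup>2 - 2 * B) * h' ^ m \<le> 2 / (c * \<gamma>) * N" using c \<gamma> by (simp add: field_simps)
        moreover have "2 * B * h' ^ m = 2 * C1 * N" using h by (simp add: B_def)
        ultimately show ?thesis by (simp add: algebra_simps)
      qed
      have "(u y)\<^sup>2 * h ^ m \<le> C * (elem_norm \<gamma> \<Omega> \<T> T u + N)" if y: "y \<in> T" for y
      proof -
        have "\<theta> ^ m * h ^ m \<le> h' ^ m"
          using power_mono[of "\<theta> * h" h' m] size \<theta> h by (simp add: power_mult_distrib h_def h'_def)
        then have "(u v)\<^sup>2 * (\<theta> ^ m * h ^ m) \<le> (u v)\<^sup>2 * h' ^ m" by (intro mult_left_mono) auto
        with 1 have "(u v)\<^sup>2 * (\<theta> ^ m * h ^ m) \<le> (2 / (c * \<gamma>) + 2 * C1) * N" by (rule order_trans[rotated])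
        then have w: "(u v)\<^sup>2 * h ^ m * \<theta> ^ m \<le> (2 / (c * \<gamma>) + 2 * C1) * N" by (simp only: mult_ac)
        have "2 * a \<le> 2 / t * V" if "a * t \<le> V" "0 < t" for a t V :: real
          using that by (simp add: field_simps)
        from this[OF w zero_less_power[OF \<theta>]] have "2 * ((u v)\<^sup>2 * h ^ m) \<le> K * N"
          by (simp only: K_def mult.assoc)
        moreover have "(u y - u v)\<^sup>2 * h ^ m \<le> C1 * elem_norm \<gamma> \<Omega> \<T> T u"
          using osc[OF T y vertex_mem[OF v(1)]] mult_left_mono[OF EN(1)[OF T] C1(1)] by (simp add: h_def)
        moreover have "(u y)\<^sup>2 * h ^ m \<le> 2 * ((u y - u v)\<^sup>2 * h ^ m) + 2 * ((u v)\<^sup>2 * h ^ m)"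
        proof -
          have "0 \<le> (u y - 2 * u v)\<^sup>2" by simp
          then have "(u y)\<^sup>2 \<le> 2 * (u y - u v)\<^sup>2 + 2 * (u v)\<^sup>2" by (simp add: power2_eq_square algebra_simps)
          from mult_right_mono[OF this, of "h ^ m"] h show ?thesis by (simp add: distrib_right)
        qed
        moreover have "K * N + 2 * (C1 * elem_norm \<gamma> \<Omega> \<T> T u) \<le> C * N + C * elem_norm \<gamma> \<Omega> \<T> T u"
        proof -
          have "2 * C1 \<le> C" using K by (simp add: C_def)
          then have "2 * C1 * elem_norm \<gamma> \<Omega> \<T> T u \<le> C * elem_norm \<gamma> \<Omega> \<T> T u" using EN(3)[OF T] by (rule mult_right_mono)
          moreover have "K * N \<le> C * N" using C(3) N(3) by (rule mult_right_mono)
          ultimately show ?thesis by (simp add: mult.assoc)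
        qed
        ultimately show ?thesis by (simp add: distrib_left)
      qed
      then show ?thesis using T' v unfolding h_def N_def by blast
    qed
  qed
  show ?thesis
  proof (intro exI[of _ C] conjI allI impI C(1))
    fix \<T> \<phi> \<mu> T
    assume "cut_fem \<T> \<rho> \<Omega> k" "\<forall>T\<in>\<T>. diameter T \<le> D" "nodal_basis k \<Omega> \<T> \<phi>" "T \<in> active_mesh \<Omega> \<T>"
    from main[OF this refl, of \<mu>] show "\<exists>T'\<in>active_mesh \<Omega> \<T>. (\<exists>v. v \<in> vertices T \<and> v \<in> vertices T') \<and>
      (\<forall>y\<in>T. (boundary_comb k \<Omega> \<T> \<phi> \<mu> y)\<^sup>2 * diameter T ^ (DIM('a) - 2)
        \<le> C * (elem_norm \<gamma> \<Omega> \<T> T (boundary_comb k \<Omega> \<T> \<phi> \<mu>) + elem_norm \<gamma> \<Omega> \<T> T' (boundary_comb k \<Omega> \<T> \<phi> \<mu>)))"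
      unfolding m_def .
  qed
qed

section \<open>Stability of the boundary basis\<close>

text \<open>A simplex that meets an open set meets it in a set with interior points, and a ball is a
  shadow of itself along any direction, so the surface measure is positive. The measure condition in
  \<open>active_mesh\<close> thus becomes a topological one.\<close>

lemma (in shape_regular_mesh) active_mesh_eq:
  assumes dim: "2 \<le> DIM('a)" and op: "open \<Omega>"
    and meas: "measure_space UNIV (sets borel) (hausdorff_outer (DIM('a) - 1) :: 'a set \<Rightarrow> ennreal)"
  shows "active_mesh \<Omega> \<T> = {T \<in> \<T>. T \<inter> \<Omega> \<noteq> {}}"
proof -
  have "0 < emeasure surface_measure (T \<inter> \<Omega>)" if T: "T \<in> \<T>" and x: "x \<in> T \<inter> \<Omega>" for T x
  proof -
    obtain c where c: "cball c (\<rho> * diameter T) \<subseteq> T" using inball[OF T] by blast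
    have cl: "closed T" using compact_elem[OF T] by (rule compact_imp_closed)
    have "ball c (\<rho> * diameter T) \<subseteq> interior T"
      using c ball_subset_cball by (intro interior_maximal) (blast, rule open_ball)
    moreover have "c \<in> ball c (\<rho> * diameter T)" using \<rho> diameter_pos[OF T] by simp
    ultimately have "interior T \<noteq> {}" by blast
    then have "closure (interior T) = T"
      using convex_closure_interior[OF convex_elem[OF T]] cl by (simp add: closure_closed)
    then have "\<Omega> \<inter> interior T \<noteq> {}" using x open_Int_closure_eq_empty[OF op, of "interior T"] by blast
    then obtain y where y: "y \<in> \<Omega> \<inter> interior T" by blast
    have "open (\<Omega> \<inter> interior T)" using op by blast
    from openE[OF this y] obtain r where r: "r > 0" "ball y r \<subseteq> \<Omega> \<inter> interior T" .
    obtain e :: 'a where e: "norm e = 1" using norm_Basis[OF SOME_Basis] by blast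
    obtain a where a: "a > 0" "\<And>S x \<delta> t \<nu>. 0 < \<delta> \<Longrightarrow> 0 < t \<Longrightarrow> norm \<nu> = 1 \<Longrightarrow>
      \<forall>y\<in>ball (x::'a) \<delta>. \<exists>p\<in>S. \<exists>s\<in>{-t..t}. y = p + s *\<^sub>R \<nu> \<Longrightarrow>
      ennreal (a * \<delta> ^ DIM('a) / t) \<le> hausdorff_outer (DIM('a) - 1) S"
      using hausdorff_outer_ge_shadow[OF dim] by blast
    have B: "T \<inter> \<Omega> \<in> sets borel" using cl op by auto
    have "0 < ennreal (a * r ^ DIM('a) / 1)" using a(1) r(1) by simp
    also have "\<dots> \<le> hausdorff_outer (DIM('a) - 1) (T \<inter> \<Omega>)"
    proof (rule a(2)[OF r(1) zero_less_one e])
      show "\<forall>z\<in>ball y r. \<exists>p\<in>T \<inter> \<Omega>. \<exists>s\<in>{-1..1}. z = p + s *\<^sub>R e"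
      proof
        fix z assume "z \<in> ball y r"
        then have "z \<in> T \<inter> \<Omega>" using r(2) interior_subset by blast
        moreover have "z = z + 0 *\<^sub>R e" by simp
        moreover have "(0::real) \<in> {-1..1}" by simp
        ultimately show "\<exists>p\<in>T \<inter> \<Omega>. \<exists>s\<in>{-1..1}. z = p + s *\<^sub>R e" by blast
      qed
    qed
    also have "\<dots> = emeasure surface_measure (T \<inter> \<Omega>)" using emeasure_hausdorff_measure(2)[OF B meas] by simp
    finally show ?thesis .
  qed
  then show ?thesis unfolding active_mesh_def by force
qed

lemma (in cut_fem) basis_support:
  assumes "nodal_basis k \<Omega> \<T> \<phi>" "\<xi> \<in> fe_nodes k \<Omega> \<T>" "T \<in> active_mesh \<Omega> \<T>"
    "\<xi> \<notin> lagrange_nodes k T" "x \<in> T"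
  shows "\<phi> \<xi> x = 0"
proof -
  obtain C where C: "\<And>f T M. f \<in> poly_space k \<Longrightarrow> int DIM('a) simplex (T::'a set) \<Longrightarrow>
    (\<forall>\<eta>\<in>lagrange_nodes k T. \<bar>f \<eta>\<bar> \<le> M) \<Longrightarrow> (\<forall>x\<in>T. \<bar>f x\<bar> \<le> C * M)"
    using lagrange_nodes_bound[OF k, where 'a='a] by blast
  show ?thesis
    by (rule basis_restrict(2)[OF assms(1-3) C[OF _ simplex[OF active_mem[OF assms(3)]]] assms(4,5)])
qed

text \<open>The constant bounds the number of Lagrange nodes of one element, so this half depends
  neither on the shape of the elements nor on the boundary.\<close>

lemma (in cut_fem) norm_b_sq_comb_le:
  assumes \<phi>: "nodal_basis k \<Omega> \<T> \<phi>" and \<gamma>: "0 \<le> \<gamma>"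
  shows "norm_b_sq \<gamma> \<Omega> \<T> (boundary_comb k \<Omega> \<T> \<phi> \<mu>)
    \<le> real ((k + 1) ^ (DIM('a) + 1)) * (\<Sum>\<xi>\<in>boundary_nodes k \<Omega> \<T>. (\<mu> \<xi>)\<^sup>2 * norm_b_sq \<gamma> \<Omega> \<T> (\<phi> \<xi>))"
proof -
  let ?A = "active_mesh \<Omega> \<T>" and ?I = "boundary_nodes k \<Omega> \<T>" and ?n = "(k + 1) ^ (DIM('a) + 1)"
  have I: "\<xi> \<in> fe_nodes k \<Omega> \<T>" if "\<xi> \<in> ?I" for \<xi> using that by (simp add: boundary_nodes_def)
  have fe: "\<phi> \<xi> \<in> fe_space k \<Omega> \<T>" if "\<xi> \<in> ?I" for \<xi> using \<phi> I[OF that] by (simp add: nodal_basis_def)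
  have "norm_b_sq \<gamma> \<Omega> \<T> (boundary_comb k \<Omega> \<T> \<phi> \<mu>) = (\<Sum>T\<in>?A. elem_norm \<gamma> \<Omega> \<T> T (boundary_comb k \<Omega> \<T> \<phi> \<mu>))"
    by (rule norm_b_sq_sum[OF boundary_comb_fe_space[OF \<phi>]])
  also have "\<dots> \<le> (\<Sum>T\<in>?A. real ?n * (\<Sum>\<xi>\<in>?I. (\<mu> \<xi>)\<^sup>2 * elem_norm \<gamma> \<Omega> \<T> T (\<phi> \<xi>)))"
    unfolding boundary_comb_def
  proof (rule sum_mono)
    fix T assume T: "T \<in> ?A"
    note L = card_lagrange_nodes[OF simplex[OF active_mem[OF T]], of k]
    show "elem_norm \<gamma> \<Omega> \<T> T (\<lambda>x. \<Sum>\<xi>\<in>?I. \<mu> \<xi> * \<phi> \<xi> x) \<le> real ?n * (\<Sum>\<xi>\<in>?I. (\<mu> \<xi>)\<^sup>2 * elem_norm \<gamma> \<Omega> \<T> T (\<phi> \<xi>))"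
    proof (rule elem_norm_sum_le[OF fe T \<gamma> finite_boundary_nodes, where J="?I \<inter> lagrange_nodes k T"])
      show "card (?I \<inter> lagrange_nodes k T) \<le> ?n"
        using card_mono[OF L(1), of "?I \<inter> lagrange_nodes k T"] L(2) by (meson Int_lower2 order_trans)
      show "\<phi> \<xi> x = 0" if "\<xi> \<in> ?I - ?I \<inter> lagrange_nodes k T" "x \<in> T" for \<xi> x
        by (rule basis_support[OF \<phi> I T]) (use that in auto)
    qed auto
  qed
  also have "\<dots> = real ?n * (\<Sum>\<xi>\<in>?I. (\<mu> \<xi>)\<^sup>2 * (\<Sum>T\<in>?A. elem_norm \<gamma> \<Omega> \<T> T (\<phi> \<xi>)))"
    unfolding sum_distrib_left[symmetric] by (subst sum.swap) (simp only: sum_distrib_left)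
  also have "(\<Sum>\<xi>\<in>?I. (\<mu> \<xi>)\<^sup>2 * (\<Sum>T\<in>?A. elem_norm \<gamma> \<Omega> \<T> T (\<phi> \<xi>))) = (\<Sum>\<xi>\<in>?I. (\<mu> \<xi>)\<^sup>2 * norm_b_sq \<gamma> \<Omega> \<T> (\<phi> \<xi>))"
    by (intro sum.cong refl) (simp only: norm_b_sq_sum[OF fe])
  finally show ?thesis .
qed

lemma boundary_space_stable:
  assumes \<rho>: "0 < \<rho>" and k: "1 \<le> k" and \<gamma>: "0 < \<gamma>" and D: "0 < D" and dim: "2 \<le> DIM('a::euclidean_space)"
    and \<Omega>: "lipschitz_domain (\<Omega> :: 'a set)" "bounded \<Omega>"
    and meas: "measure_space UNIV (sets borel) (hausdorff_outer (DIM('a) - 1) :: 'a set \<Rightarrow> ennreal)"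
  shows "\<exists>C\<ge>0. \<forall>\<T> \<phi> \<mu>. cut_fem \<T> \<rho> \<Omega> k \<longrightarrow> (\<forall>T\<in>\<T>. diameter T \<le> D) \<longrightarrow> nodal_basis k \<Omega> \<T> \<phi> \<longrightarrow>
    (\<Sum>\<xi>\<in>boundary_nodes k \<Omega> \<T>. (\<mu> \<xi>)\<^sup>2 * norm_b_sq \<gamma> \<Omega> \<T> (\<phi> \<xi>)) \<le> C * norm_b_sq \<gamma> \<Omega> \<T> (boundary_comb k \<Omega> \<T> \<phi> \<mu>)"
proof -
  obtain C1 where C1: "C1 \<ge> 0" "\<And>\<T> \<phi> \<xi> T. cut_fem \<T> \<rho> \<Omega> k \<Longrightarrow> nodal_basis k \<Omega> \<T> \<phi> \<Longrightarrow> \<xi> \<in> fe_nodes k \<Omega> \<T> \<Longrightarrow>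
    T \<in> active_mesh \<Omega> \<T> \<Longrightarrow> elem_norm \<gamma> \<Omega> \<T> T (\<phi> \<xi>) \<le> C1 * diameter T ^ (DIM('a) - 2)"
    using basis_elem_norm[OF \<rho> k less_imp_le[OF \<gamma>] dim \<Omega> meas] by blast
  obtain C2 where C2: "C2 \<ge> 0" "\<And>\<T> \<phi> \<mu> T. cut_fem \<T> \<rho> \<Omega> k \<Longrightarrow> (\<forall>T\<in>\<T>. diameter T \<le> D) \<Longrightarrow> nodal_basis k \<Omega> \<T> \<phi> \<Longrightarrow>
    T \<in> active_mesh \<Omega> \<T> \<Longrightarrow>
    (\<exists>T'\<in>active_mesh \<Omega> \<T>. (\<exists>v. v \<in> vertices T \<and> v \<in> vertices T') \<and>
      (\<forall>y\<in>T. (boundary_comb k \<Omega> \<T> \<phi> \<mu> y)\<^sup>2 * diameter T ^ (DIM('a) - 2)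
        \<le> C2 * (elem_norm \<gamma> \<Omega> \<T> T (boundary_comb k \<Omega> \<T> \<phi> \<mu>) + elem_norm \<gamma> \<Omega> \<T> T' (boundary_comb k \<Omega> \<T> \<phi> \<mu>))))"
    using boundary_elem_control[OF \<rho> k \<gamma> D dim \<Omega> meas] by blast
  define n where "n = (k + 1) ^ (DIM('a) + 1)"
  \<comment> \<open>Each element with chosen neighbour \<open>T'\<close> contains one of the
    \<open>DIM('a) + 1\<close> vertices of \<open>T'\<close>, and the star of each vertex is bounded
    in number.\<close>
  define K where "K = (DIM('a) + 1) * star_size_bound DIM('a) \<rho>"
  define C where "C = real n * (C1 * C2) * (1 + real K)"
  have main: "(\<Sum>\<xi>\<in>boundary_nodes k \<Omega> \<T>. (\<mu> \<xi>)\<^sup>2 * norm_b_sq \<gamma> \<Omega> \<T> (\<phi> \<xi>)) \<le> C * norm_b_sq \<gamma> \<Omega> \<T> (boundary_comb k \<Omega> \<T> \<phi> \<mu>)"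
    if fem: "cut_fem \<T> \<rho> \<Omega> k" and diam: "\<forall>T\<in>\<T>. diameter T \<le> D" and \<phi>: "nodal_basis k \<Omega> \<T> \<phi>" for \<T> \<phi> \<mu>
  proof -
    interpret cut_fem \<T> \<rho> \<Omega> k by (rule fem)
    let ?A = "active_mesh \<Omega> \<T>" and ?I = "boundary_nodes k \<Omega> \<T>"
    define u where "u = boundary_comb k \<Omega> \<T> \<phi> \<mu>"
    define b where "b T = elem_norm \<gamma> \<Omega> \<T> T u" for T
    have b0: "0 \<le> b T" if "T \<in> ?A" for T unfolding b_def using elem_norm_nonneg \<gamma> active_mem[OF that] by simp
    have I: "\<xi> \<in> fe_nodes k \<Omega> \<T>" if "\<xi> \<in> ?I" for \<xi> using that by (simp add: boundary_nodes_def)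
    have fe: "\<phi> \<xi> \<in> fe_space k \<Omega> \<T>" if "\<xi> \<in> ?I" for \<xi> using \<phi> I[OF that] by (simp add: nodal_basis_def)
    have \<mu>u: "\<mu> \<xi> = u \<xi>" if "\<xi> \<in> ?I" for \<xi> using boundary_comb_at_node[OF \<phi> I[OF that], of \<mu>] that by (simp add: u_def)
    have "\<forall>T\<in>?A. \<exists>T'. T' \<in> ?A \<and> (\<exists>v. v \<in> vertices T \<and> v \<in> vertices T') \<and>
      (\<forall>y\<in>T. (u y)\<^sup>2 * diameter T ^ (DIM('a) - 2) \<le> C2 * (b T + b T'))"
      unfolding u_def b_def using C2(2)[OF fem diam \<phi>, of _ \<mu>] by blast
    from bchoice[OF this] obtain f where f: "\<And>T. T \<in> ?A \<Longrightarrow> f T \<in> ?A"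
      "\<And>T. T \<in> ?A \<Longrightarrow> \<exists>v. v \<in> vertices T \<and> v \<in> vertices (f T)"
      "\<And>T y. T \<in> ?A \<Longrightarrow> y \<in> T \<Longrightarrow> (u y)\<^sup>2 * diameter T ^ (DIM('a) - 2) \<le> C2 * (b T + b (f T))" by blast
    have elem: "(\<Sum>\<xi>\<in>?I. (\<mu> \<xi>)\<^sup>2 * elem_norm \<gamma> \<Omega> \<T> T (\<phi> \<xi>)) \<le> real n * (C1 * C2) * (b T + b (f T))" if T: "T \<in> ?A" for T
    proof -
      let ?J = "?I \<inter> lagrange_nodes k T"
      note L = card_lagrange_nodes[OF simplex[OF active_mem[OF T]], of k]
      have cJ: "card ?J \<le> n" unfolding n_def
        using card_mono[OF L(1), of ?J] L(2) by (meson Int_lower2 order_trans)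
      have "(\<Sum>\<xi>\<in>?I. (\<mu> \<xi>)\<^sup>2 * elem_norm \<gamma> \<Omega> \<T> T (\<phi> \<xi>)) = (\<Sum>\<xi>\<in>?J. (\<mu> \<xi>)\<^sup>2 * elem_norm \<gamma> \<Omega> \<T> T (\<phi> \<xi>))"
      proof (rule sum.mono_neutral_right[OF finite_boundary_nodes])
        show "\<forall>\<xi>\<in>?I - ?J. (\<mu> \<xi>)\<^sup>2 * elem_norm \<gamma> \<Omega> \<T> T (\<phi> \<xi>) = 0"
        proof
          fix \<xi> assume \<xi>: "\<xi> \<in> ?I - ?J"
          have "elem_norm \<gamma> \<Omega> \<T> T (\<phi> \<xi>) = 0"
            by (rule elem_norm_zero[OF T basis_support[OF \<phi> I T]]) (use \<xi> in auto)
          then show "(\<mu> \<xi>)\<^sup>2 * elem_norm \<gamma> \<Omega> \<T> T (\<phi> \<xi>) = 0" by simp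
        qed
      qed auto
      also have "\<dots> \<le> (\<Sum>\<xi>\<in>?J. C1 * C2 * (b T + b (f T)))"
      proof (rule sum_mono)
        fix \<xi> assume \<xi>: "\<xi> \<in> ?J"
        have \<xi>T: "\<xi> \<in> T" using \<xi> lagrange_nodes_subset[OF simplex[OF active_mem[OF T]] k] by blast
        have "(\<mu> \<xi>)\<^sup>2 * elem_norm \<gamma> \<Omega> \<T> T (\<phi> \<xi>) \<le> (\<mu> \<xi>)\<^sup>2 * (C1 * diameter T ^ (DIM('a) - 2))"
          by (rule mult_left_mono[OF C1(2)[OF fem \<phi> I T]]) (use \<xi> in auto)
        also have "\<dots> = C1 * ((u \<xi>)\<^sup>2 * diameter T ^ (DIM('a) - 2))" using \<mu>u \<xi> by simp
        also have "\<dots> \<le> C1 * (C2 * (b T + b (f T)))" by (rule mult_left_mono[OF f(3)[OF T \<xi>T] C1(1)])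
        finally show "(\<mu> \<xi>)\<^sup>2 * elem_norm \<gamma> \<Omega> \<T> T (\<phi> \<xi>) \<le> C1 * C2 * (b T + b (f T))" by (simp add: mult.assoc)
      qed
      also have "\<dots> = real (card ?J) * (C1 * C2 * (b T + b (f T)))" by simp
      also have "\<dots> \<le> real n * (C1 * C2 * (b T + b (f T)))"
        using cJ C1(1) C2(1) b0[OF T] b0[OF f(1)[OF T]] by (intro mult_right_mono) auto
      finally show ?thesis by (simp add: mult.assoc)
    qed
    have "(\<Sum>\<xi>\<in>?I. (\<mu> \<xi>)\<^sup>2 * norm_b_sq \<gamma> \<Omega> \<T> (\<phi> \<xi>)) = (\<Sum>\<xi>\<in>?I. \<Sum>T\<in>?A. (\<mu> \<xi>)\<^sup>2 * elem_norm \<gamma> \<Omega> \<T> T (\<phi> \<xi>))"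
      by (intro sum.cong refl) (simp only: norm_b_sq_sum[OF fe] sum_distrib_left)
    also have "\<dots> = (\<Sum>T\<in>?A. \<Sum>\<xi>\<in>?I. (\<mu> \<xi>)\<^sup>2 * elem_norm \<gamma> \<Omega> \<T> T (\<phi> \<xi>))" by (rule sum.swap)
    also have "\<dots> \<le> (\<Sum>T\<in>?A. real n * (C1 * C2) * (b T + b (f T)))" by (rule sum_mono[OF elem])
    also have "\<dots> = real n * (C1 * C2) * (\<Sum>T\<in>?A. b T + b (f T))" by (simp only: sum_distrib_left)
    also have "\<dots> \<le> real n * (C1 * C2) * ((1 + real K) * (\<Sum>T\<in>?A. b T))"
    proof (rule mult_left_mono[OF sum_neighbours_le[OF finite_active order_refl]])
      show "card {T \<in> ?A. f T = T'} \<le> K" if T': "T' \<in> ?A" for T'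
      proof -
        note V = simplex_vertices[OF simplex[OF active_mem[OF T']]]
        have "{T \<in> ?A. f T = T'} \<subseteq> (\<Union>v\<in>vertices T'. {T \<in> \<T>. v \<in> T})"
        proof
          fix T assume "T \<in> {T \<in> ?A. f T = T'}"
          then have T: "T \<in> ?A" "f T = T'" by auto
          then obtain v where "v \<in> vertices T" "v \<in> vertices T'" using f(2) by blast
          then show "T \<in> (\<Union>v\<in>vertices T'. {T \<in> \<T>. v \<in> T})" using vertex_mem active_mem[OF T(1)] by blast
        qed
        moreover have "finite (\<Union>v\<in>vertices T'. {T \<in> \<T>. v \<in> T})"
          using V(1) finite_mesh by (intro finite_UN_I) auto
        ultimately have "card {T \<in> ?A. f T = T'} \<le> card (\<Union>v\<in>vertices T'. {T \<in> \<T>. v \<in> T})"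
          by (intro card_mono)
        also have "\<dots> \<le> (\<Sum>v\<in>vertices T'. card {T \<in> \<T>. v \<in> T})" by (rule card_UN_le[OF V(1)])
        also have "\<dots> \<le> (\<Sum>v\<in>vertices T'. star_size_bound DIM('a) \<rho>)" by (rule sum_mono[OF card_star])
        also have "\<dots> = K" unfolding sum_constant V(2) K_def by simp
        finally show ?thesis .
      qed
    qed (use f(1) b0 C1(1) C2(1) in auto)
    also have "\<dots> = C * norm_b_sq \<gamma> \<Omega> \<T> u"
      unfolding C_def b_def norm_b_sq_sum[OF boundary_comb_fe_space[OF \<phi>], of \<gamma> \<mu>, folded u_def] by (simp only: mult.assoc)
    finally show ?thesis unfolding u_def .
  qed
  have "C \<ge> 0" using C1(1) C2(1) by (simp add: C_def)
  then show ?thesis using main by blast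
qed

text \<open>The constants \<open>c\<close> and \<open>C\<close> of the norm equivalence stand
  outside the quantifier over meshes; this expresses that they do not depend on \<open>h\<close> or
  on the cut. \<open>\<gamma>\<^sub>1\<close> and \<open>\<rho>\<^sub>1\<close> precede the mesh in
  the same way.\<close>

theorem lemma4p2:
  fixes \<Omega> \<Omega>s :: "'a::euclidean_space set"
    and k :: nat
    and \<gamma> \<beta> \<sigma> c C :: real
  assumes "DIM('a) \<in> {2, 3}"
    and "lipschitz_domain \<Omega>"
    and "polyhedral_domain \<Omega>s"
    and "\<Omega> \<subseteq> \<Omega>s"
    and "k \<ge> 1"
    and "\<gamma> > 0"
    and "\<beta> > 0"
    and "c > 0"
    and "C > 0"
  shows "\<exists>\<gamma>\<^sub>1 > 0. \<exists>\<rho>\<^sub>1 > 0. \<forall>\<T> \<phi> A B.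
      simplicial_mesh_of \<Omega>s \<T> \<longrightarrow> shape_regular \<sigma> \<T> \<longrightarrow> boundary_resolved \<Omega> \<T> \<longrightarrow>
      norm_equivalence c C k \<gamma> \<beta> \<Omega> \<T> \<longrightarrow>
      nodal_basis k \<Omega> \<T> \<phi> \<longrightarrow>
      is_boundary_operator k \<gamma> \<beta> \<Omega> \<T> \<phi> A \<longrightarrow>
      is_jacobi_preconditioner k \<gamma> \<beta> \<Omega> \<T> \<phi> B \<longrightarrow>
      (\<forall>u \<in> boundary_space k \<Omega> \<T> \<phi>.
         \<gamma>\<^sub>1 * l2_active \<Omega> \<T> (B u) u \<le> l2_active \<Omega> \<T> (A u) u \<and>
         l2_active \<Omega> \<T> (A u) u \<le> \<rho>\<^sub>1 * l2_active \<Omega> \<T> (B u) u)"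
proof (cases "measure_space UNIV (sets borel) (hausdorff_outer (DIM('a) - 1) :: 'a set \<Rightarrow> ennreal)")
  \<comment> \<open>This case does not occur, but excluding it would need Caratheodory's theorem. It is harmless: then
    the surface measure is the null measure, hence no element is active.\<close>
  case False
  have op: "open \<Omega>" using assms(2) by (simp add: lipschitz_domain_def)
  have "l2_active \<Omega> \<T> v w = 0" if mesh: "simplicial_mesh_of \<Omega>s \<T>" for \<T> v w
  proof -
    have "emeasure surface_measure (T \<inter> \<Omega>) = 0" if "T \<in> \<T>" for T
    proof -
      have "closed T" using mesh that closed_simplex by (auto simp: simplicial_mesh_of_def)
      then have "T \<inter> \<Omega> \<in> sets borel" using op by auto
      from emeasure_hausdorff_measure(3)[OF this False] show ?thesis .
    qed
    then have "active_mesh \<Omega> \<T> = {}" by (auto simp: active_mesh_def)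
    then show ?thesis by (simp add: l2_def set_lebesgue_integral_def)
  qed
  then show ?thesis by (intro exI[of _ "1::real"] conjI allI impI ballI) simp_all
next
  case True
  note meas = True
  have dim: "2 \<le> DIM('a)" using assms(1) by auto
  have op: "open \<Omega>" using assms(2) by (simp add: lipschitz_domain_def)
  have bs: "bounded (closure \<Omega>s)" using assms(3) by (simp add: polyhedral_domain_def bounded_closure)
  have b\<Omega>: "bounded \<Omega>" by (rule bounded_subset[OF bs order_trans[OF assms(4) closure_subset]])
  define \<rho> where "\<rho> = 1 / (2 * max \<sigma> 1)"
  have \<rho>: "0 < \<rho>" by (simp add: \<rho>_def)
  \<comment> \<open>All elements lie in the closure of \<open>\<Omega>s\<close>, so one bound serves
    all meshes; adding 1 makes it positive.\<close>
  define D where "D = diameter (closure \<Omega>s) + 1"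
  have D: "0 < D" using diameter_ge_0[OF bs] by (simp add: D_def)
  obtain C3 where C3: "C3 \<ge> 0" "\<And>S z h. 0 < h \<Longrightarrow> S \<subseteq> ball z h \<Longrightarrow> closed S \<Longrightarrow>
    emeasure surface_measure (S \<inter> frontier \<Omega>) \<le> ennreal (C3 * h ^ (DIM('a) - 1))"
    using lipschitz_frontier_measure_le[OF dim assms(2) b\<Omega> meas] by blast
  obtain C0 where C0: "C0 \<ge> 0" "\<And>\<T> \<phi> \<mu>. cut_fem \<T> \<rho> \<Omega> k \<Longrightarrow> (\<forall>T\<in>\<T>. diameter T \<le> D) \<Longrightarrow> nodal_basis k \<Omega> \<T> \<phi> \<Longrightarrow>
    (\<Sum>\<xi>\<in>boundary_nodes k \<Omega> \<T>. (\<mu> \<xi>)\<^sup>2 * norm_b_sq \<gamma> \<Omega> \<T> (\<phi> \<xi>)) \<le> C0 * norm_b_sq \<gamma> \<Omega> \<T> (boundary_comb k \<Omega> \<T> \<phi> \<mu>)"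
    using boundary_space_stable[OF \<rho> assms(5,6) D dim assms(2) b\<Omega> meas] by blast
  define n where "n = real ((k + 1) ^ (DIM('a) + 1))"
  have n: "0 < n" unfolding n_def by (rule of_nat_0_less_iff[THEN iffD2]) (rule zero_less_power, simp)
  \<comment> \<open>Adding 1 to \<open>C * C0\<close> guards against \<open>C0 = 0\<close>.\<close>
  define \<gamma>\<^sub>1 where "\<gamma>\<^sub>1 = c / (C * C0 + 1)"
  define \<rho>\<^sub>1 where "\<rho>\<^sub>1 = C * n / c"
  have CC: "0 \<le> C * C0" using assms(9) C0(1) by simp
  have "\<gamma>\<^sub>1 > 0" using assms(8) CC by (simp add: \<gamma>\<^sub>1_def)
  moreover have "\<rho>\<^sub>1 > 0" using assms(8,9) n by (simp add: \<rho>\<^sub>1_def)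
  moreover have "\<gamma>\<^sub>1 * l2_active \<Omega> \<T> (B u) u \<le> l2_active \<Omega> \<T> (A u) u \<and>
         l2_active \<Omega> \<T> (A u) u \<le> \<rho>\<^sub>1 * l2_active \<Omega> \<T> (B u) u"
    if mesh: "simplicial_mesh_of \<Omega>s \<T>" and reg: "shape_regular \<sigma> \<T>"
      and ne: "norm_equivalence c C k \<gamma> \<beta> \<Omega> \<T>" and \<phi>: "nodal_basis k \<Omega> \<T> \<phi>"
      and A: "is_boundary_operator k \<gamma> \<beta> \<Omega> \<T> \<phi> A" and B: "is_jacobi_preconditioner k \<gamma> \<beta> \<Omega> \<T> \<phi> B"
      and uV: "u \<in> boundary_space k \<Omega> \<T> \<phi>" for \<T> \<phi> A B u
  proof -
    have tri: "triangulation \<T>" and sim: "\<And>T. T \<in> \<T> \<Longrightarrow> int DIM('a) simplex T" and un: "\<Union>\<T> = closure \<Omega>s"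
      using mesh by (auto simp: simplicial_mesh_of_def)
    interpret M: shape_regular_mesh \<T> \<rho> unfolding \<rho>_def by (rule shape_regular_imp_mesh[OF tri sim reg])
    have diam: "\<forall>T\<in>\<T>. diameter T \<le> D"
    proof
      fix T assume "T \<in> \<T>"
      then have "T \<subseteq> closure \<Omega>s" using un by blast
      then show "diameter T \<le> D" using diameter_subset[OF _ bs, of T] by (simp add: D_def)
    qed
    have fem: "cut_fem \<T> \<rho> \<Omega> k"
    proof
      show "\<Omega> \<subseteq> \<Union>\<T>" unfolding un by (rule order_trans[OF assms(4) closure_subset])
      show "active_mesh \<Omega> \<T> = {T \<in> \<T>. T \<inter> \<Omega> \<noteq> {}}" by (rule M.active_mesh_eq[OF dim op meas])
      fix T assume T: "T \<in> \<T>"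
      obtain r where r: "0 < r" "T \<subseteq> ball 0 r"
        using compact_imp_bounded[OF M.compact_elem[OF T]] bounded_subset_ballD by metis
      have "emeasure surface_measure (T \<inter> frontier \<Omega>) \<le> ennreal (C3 * r ^ (DIM('a) - 1))"
        by (rule C3(2)[OF r]) (rule compact_imp_closed[OF M.compact_elem[OF T]])
      then show "emeasure surface_measure (T \<inter> frontier \<Omega>) < \<infinity>" by (rule le_less_trans) simp
    qed (use op dim assms(5) in auto)
    interpret cut_fem \<T> \<rho> \<Omega> k by (rule fem)
    obtain \<mu> where \<mu>: "u = boundary_comb k \<Omega> \<T> \<phi> \<mu>" using uV by (auto simp: boundary_space_def)
    let ?a = "\<lambda>v. cut_form k \<gamma> \<beta> \<Omega> \<T> v v" and ?b = "norm_b_sq \<gamma> \<Omega> \<T>" and ?I = "boundary_nodes k \<Omega> \<T>"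
    have ab: "c * ?b v \<le> ?a v" "?a v \<le> C * ?b v" if "v \<in> fe_space k \<Omega> \<T>" for v
      using ne that by (auto simp: norm_equivalence_def)
    have ufe: "u \<in> fe_space k \<Omega> \<T>" unfolding \<mu> by (rule boundary_comb_fe_space[OF \<phi>])
    have fe: "\<phi> \<xi> \<in> fe_space k \<Omega> \<T>" if "\<xi> \<in> ?I" for \<xi>
      using \<phi> that by (auto simp: nodal_basis_def boundary_nodes_def)
    have Au: "l2_active \<Omega> \<T> (A u) u = ?a u" using A uV by (simp add: is_boundary_operator_def)
    have Bu: "l2_active \<Omega> \<T> (B u) u = (\<Sum>\<xi>\<in>?I. (\<mu> \<xi>)\<^sup>2 * ?a (\<phi> \<xi>))"
      using B unfolding is_jacobi_preconditioner_def \<mu> by (simp add: power2_eq_square)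
    have b0: "0 \<le> ?b u"
      unfolding norm_b_sq_sum[OF ufe] using elem_norm_nonneg assms(6) active_mem by (intro sum_nonneg) simp
    have "(\<Sum>\<xi>\<in>?I. (\<mu> \<xi>)\<^sup>2 * ?a (\<phi> \<xi>)) \<le> (\<Sum>\<xi>\<in>?I. (\<mu> \<xi>)\<^sup>2 * (C * ?b (\<phi> \<xi>)))"
      by (intro sum_mono mult_left_mono ab(2) fe) auto
    also have "\<dots> = C * (\<Sum>\<xi>\<in>?I. (\<mu> \<xi>)\<^sup>2 * ?b (\<phi> \<xi>))" by (simp only: sum_distrib_left mult.left_commute)
    also have "\<dots> \<le> C * (C0 * ?b u)"
      unfolding \<mu> using assms(9) by (intro mult_left_mono C0(2)[OF fem diam \<phi>]) auto
    finally have "l2_active \<Omega> \<T> (B u) u \<le> C * C0 * ?b u" unfolding Bu by (simp only: mult.assoc)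
    then have "\<gamma>\<^sub>1 * l2_active \<Omega> \<T> (B u) u \<le> \<gamma>\<^sub>1 * ((C * C0 + 1) * ?b u)"
      using \<open>\<gamma>\<^sub>1 > 0\<close> b0 by (intro mult_left_mono) (auto simp: distrib_right)
    also have "\<dots> = c * ?b u" using CC by (simp add: \<gamma>\<^sub>1_def)
    also have "\<dots> \<le> l2_active \<Omega> \<T> (A u) u" unfolding Au by (rule ab(1)[OF ufe])
    finally have lower: "\<gamma>\<^sub>1 * l2_active \<Omega> \<T> (B u) u \<le> l2_active \<Omega> \<T> (A u) u" .
    have "l2_active \<Omega> \<T> (A u) u \<le> C * ?b u" unfolding Au by (rule ab(2)[OF ufe])
    also have "\<dots> \<le> C * (n * (\<Sum>\<xi>\<in>?I. (\<mu> \<xi>)\<^sup>2 * ?b (\<phi> \<xi>)))"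
      unfolding \<mu> n_def using assms(6,9) by (intro mult_left_mono norm_b_sq_comb_le[OF \<phi>]) auto
    also have "\<dots> = \<rho>\<^sub>1 * (\<Sum>\<xi>\<in>?I. (\<mu> \<xi>)\<^sup>2 * (c * ?b (\<phi> \<xi>)))"
    proof -
      have "(\<Sum>\<xi>\<in>?I. (\<mu> \<xi>)\<^sup>2 * (c * ?b (\<phi> \<xi>))) = c * (\<Sum>\<xi>\<in>?I. (\<mu> \<xi>)\<^sup>2 * ?b (\<phi> \<xi>))"
        by (simp only: sum_distrib_left mult.left_commute)
      then show ?thesis using assms(8) by (simp add: \<rho>\<^sub>1_def)
    qed
    also have "\<dots> \<le> \<rho>\<^sub>1 * (\<Sum>\<xi>\<in>?I. (\<mu> \<xi>)\<^sup>2 * ?a (\<phi> \<xi>))"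
      using \<open>\<rho>\<^sub>1 > 0\<close> by (intro mult_left_mono sum_mono ab(1) fe) auto
    finally show ?thesis using lower unfolding Bu by blast
  qed
  ultimately show ?thesis by blast
qed

end
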